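(* Let $X=(X_n)_{n\in\mathbb{Z}}$ be a purely innovating weakly stationary process, and let $\psi(z)=\sum_{n\ge 0}c_nz^n$ be an element of the Hardy space $\mathbb{H}^2$ such that the spectral measure of $X$ equals $|\psi(e^{i\theta})|^2\,\frac{d\theta}{2\pi}$. Let $\psi_{\mathrm{out}}$ denote the outer factor of $\psi$ (in the inner–outer factorization $\psi=\psi_{\mathrm{inn}}\psi_{\mathrm{out}}$). Then the dual scattering function $s(\theta)$ associated with $X$ is given by $$ s(\theta)=\frac{\overline{\psi_{\mathrm{out}}(e^{i\theta})}}{\psi_{\mathrm{out}}(e^{i\theta})}$$ (for a suitable normalization of the intertwiners $\phi_\pm$, i.e. up to a multiplicative constant of modulus $1$).
   Context: A (weakly) stationary time series is a sequence $X=(X_n)_{n\in\mathbb{Z}}$ of square-integrable, mean-zero random variables with $\mathbf{E}(\overline{X_n}X_m)=\gamma_{n-m}$ depending only on $n-m$, and $\gamma_0>0$. Its spectral measure is the unique positive finite measure $\mu$ on the unit circle $S^1$ with $\gamma_j=\int z^{-j}\,d\mu$. Let $H(X)$ be the closed linear span of the $X_n$ in $L^2$ of the probability space, and $U$ the unitary operator on $H(X)$ with $U(X_n)=X_{n+1}$ (corresponding to multiplication by $z$ under the isometry $L^2(S^1,d\mu)\to H(X)$, $z^n\mapsto X_n$). Let $H_n$ be the closed span of $\{X_m: m\le n\}$; $X$ is purely innovating if $\bigcap_n H_n=\{0\}$. The dual scattering associated with $X$ uses the incoming space $\mathcal{D}_-=\big(\overline{\mathrm{Span}\{X_n,n\ge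 0\}}\big)^{\perp}$ and outgoing space $\mathcal{D}_+=\big(\overline{\mathrm{Span}\{X_n,n<0\}}\big)^{\perp}$ (orthogonal complements in $H(X)$). There exist isometric (onto) intertwiners $\phi_-,\phi_+:H(X)\to L^2(S^1,\frac{d\theta}{2\pi})$, each unique up to a multiplicative constant of modulus $1$, intertwining $U$ with multiplication by $z$, such that $\phi_-(\mathcal{D}_-)=(\mathbb{H}^2)^\perp$ and $\phi_+(\mathcal{D}_+)=\mathbb{H}^2$. The scattering operator $S=\phi_+\circ\phi_-^{-1}$ commutes with multiplication by $z$, hence is multiplication by a measurable unimodular function $s(\theta)$ on the circle, called the dual scattering function. *)

theory Defs
  imports "HOL-Probability.Probability"
begin

section \<open>Square-integrable functions\<close>

text \<open>
  Elements of a complex \<open>L\<^sup>2\<close> space are represented by square-integrable functions.  All the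
  subspaces below are closed under almost-everywhere equality, and identities between elements
  of \<open>L\<^sup>2\<close> are stated almost everywhere.
\<close>

definition L2 :: "'a measure \<Rightarrow> ('a \<Rightarrow> complex) set" where
  "L2 M = {f \<in> borel_measurable M. integrable M (\<lambda>x. (norm (f x))\<^sup>2)}"

definition L2_inner :: "'a measure \<Rightarrow> ('a \<Rightarrow> complex) \<Rightarrow> ('a \<Rightarrow> complex) \<Rightarrow> complex" where
  "L2_inner M f g = (LINT x|M. cnj (f x) * g x)"

text \<open>
  The closed span is meant for families \<open>X\<close> in \<open>L2 M\<close>: otherwise the integral below could be 0
  by the convention for non-integrable functions.
\<close>

definition L2_closed_span ::
  "'a measure \<Rightarrow> ('i \<Rightarrow> 'a \<Rightarrow> complex) \<Rightarrow> 'i set \<Rightarrow> ('a \<Rightarrow> complex) set" where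
  "L2_closed_span M X I = {f \<in> L2 M. \<forall>e>0. \<exists>F a. finite F \<and> F \<subseteq> I \<and>
     (LINT x|M. (norm (f x - (\<Sum>i\<in>F. a i * X i x)))\<^sup>2) < (e::real)}"

definition L2_orth_in ::
  "'a measure \<Rightarrow> ('a \<Rightarrow> complex) set \<Rightarrow> ('a \<Rightarrow> complex) set \<Rightarrow> ('a \<Rightarrow> complex) set" where
  "L2_orth_in M H K = {f \<in> H. \<forall>g\<in>K. L2_inner M g f = 0}"

text \<open>The image of a set of elements of \<open>L\<^sup>2\<close>, closed under almost-everywhere equality.\<close>

definition L2_image ::
  "'b measure \<Rightarrow> (('a \<Rightarrow> complex) \<Rightarrow> 'b \<Rightarrow> complex) \<Rightarrow> ('a \<Rightarrow> complex) set \<Rightarrow> ('b \<Rightarrow> complex) set"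
where
  "L2_image N \<phi> D = {k \<in> L2 N. \<exists>f\<in>D. AE y in N. \<phi> f y = k y}"

text \<open>
  Linear isometries of a subspace \<open>H\<close> of \<open>L\<^sup>2(M)\<close> onto a subspace \<open>K\<close> of \<open>L\<^sup>2(N)\<close>.  Linearity and
  isometry imply that \<open>\<phi>\<close> respects almost-everywhere equality.
\<close>

definition L2_unitary ::
  "'a measure \<Rightarrow> ('a \<Rightarrow> complex) set \<Rightarrow> 'b measure \<Rightarrow> ('b \<Rightarrow> complex) set \<Rightarrow>
   (('a \<Rightarrow> complex) \<Rightarrow> 'b \<Rightarrow> complex) \<Rightarrow> bool" where
  "L2_unitary M H N K \<phi> \<longleftrightarrow>
     (\<forall>f\<in>H. \<phi> f \<in> K) \<and>
     (\<forall>f\<in>H. \<forall>g\<in>H. \<forall>a b. AE y in N. \<phi> (\<lambda>x. a * f x + b * g x) y = a * \<phi> f y + b * \<phi> g y) \<and>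
     (\<forall>f\<in>H. (LINT y|N. (norm (\<phi> f y))\<^sup>2) = (LINT x|M. (norm (f x))\<^sup>2)) \<and>
     L2_image N \<phi> H = K"

definition L2_inv ::
  "('a \<Rightarrow> complex) set \<Rightarrow> 'b measure \<Rightarrow> (('a \<Rightarrow> complex) \<Rightarrow> 'b \<Rightarrow> complex) \<Rightarrow>
   ('b \<Rightarrow> complex) \<Rightarrow> 'a \<Rightarrow> complex" where
  "L2_inv H N \<phi> k = (SOME f. f \<in> H \<and> (AE y in N. \<phi> f y = k y))"


section \<open>The Hardy space of the unit circle\<close>

text \<open>The normalized arc length measure \<open>d\<theta>/2\<pi>\<close>.\<close>

definition circle_measure :: "complex measure" where
  "circle_measure =
     distr (uniform_measure lborel {0..<2 * pi}) (restrict_space borel (sphere 0 1)) cis"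

definition fourier_coeff :: "(complex \<Rightarrow> complex) \<Rightarrow> int \<Rightarrow> complex" where
  "fourier_coeff f n = (LINT z|circle_measure. z powi (- n) * f z)"

text \<open>
  An element \<open>\<Sum>n\<ge>0. c\<^sub>n z\<^sup>n\<close> of the Hardy space is identified with its boundary function in
  \<open>L\<^sup>2\<close> of the circle; \<open>hardy_ext\<close> recovers the holomorphic function on the open unit disc.
\<close>

definition hardy2 :: "(complex \<Rightarrow> complex) set" where
  "hardy2 = {f \<in> L2 circle_measure. \<forall>n<0. fourier_coeff f n = 0}"

definition hardy_ext :: "(complex \<Rightarrow> complex) \<Rightarrow> complex \<Rightarrow> complex" where
  "hardy_ext f z = (\<Sum>n. fourier_coeff f (int n) * z ^ n)"

definition inner_function :: "(complex \<Rightarrow> complex) \<Rightarrow> bool" where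
  "inner_function f \<longleftrightarrow> f \<in> hardy2 \<and> (AE z in circle_measure. norm (f z) = 1)"

definition outer_function :: "(complex \<Rightarrow> complex) \<Rightarrow> bool" where
  "outer_function f \<longleftrightarrow> f \<in> hardy2 \<and>
     (\<exists>c (k :: complex \<Rightarrow> real). norm c = 1 \<and> integrable circle_measure k \<and>
        (\<forall>z\<in>ball 0 1. hardy_ext f z =
           c * exp (LINT w|circle_measure. (w + z) / (w - z) * of_real (k w))))"

definition inner_outer_factorization ::
  "(complex \<Rightarrow> complex) \<Rightarrow> (complex \<Rightarrow> complex) \<Rightarrow> (complex \<Rightarrow> complex) \<Rightarrow> bool" where
  "inner_outer_factorization \<psi> \<psi>inn \<psi>out \<longleftrightarrow>
     inner_function \<psi>inn \<and> outer_function \<psi>out \<and>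
     (AE z in circle_measure. \<psi> z = \<psi>inn z * \<psi>out z)"


section \<open>Weakly stationary processes\<close>

definition autocov :: "'a measure \<Rightarrow> (int \<Rightarrow> 'a \<Rightarrow> complex) \<Rightarrow> int \<Rightarrow> complex" where
  "autocov M X j = (LINT x|M. cnj (X j x) * X 0 x)"

definition weakly_stationary :: "'a measure \<Rightarrow> (int \<Rightarrow> 'a \<Rightarrow> complex) \<Rightarrow> bool" where
  "weakly_stationary M X \<longleftrightarrow> prob_space M \<and>
     (\<forall>n. X n \<in> L2 M) \<and>
     (\<forall>n. (LINT x|M. X n x) = 0) \<and>
     (\<forall>n m. (LINT x|M. cnj (X n x) * X m x) = autocov M X (n - m)) \<and>
     Re (autocov M X 0) > 0"

definition is_spectral_measure ::
  "'a measure \<Rightarrow> (int \<Rightarrow> 'a \<Rightarrow> complex) \<Rightarrow> complex measure \<Rightarrow> bool" where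
  "is_spectral_measure M X \<mu> \<longleftrightarrow>
     sets \<mu> = sets (restrict_space borel (sphere 0 1)) \<and> finite_measure \<mu> \<and>
     (\<forall>j. autocov M X j = (LINT z|\<mu>. z powi (- j)))"

abbreviation process_space :: "'a measure \<Rightarrow> (int \<Rightarrow> 'a \<Rightarrow> complex) \<Rightarrow> ('a \<Rightarrow> complex) set" where
  "process_space M X \<equiv> L2_closed_span M X UNIV"

definition purely_innovating :: "'a measure \<Rightarrow> (int \<Rightarrow> 'a \<Rightarrow> complex) \<Rightarrow> bool" where
  "purely_innovating M X \<longleftrightarrow>
     (\<Inter>n. L2_closed_span M X {..n}) = {f \<in> L2 M. AE x in M. f x = 0}"


section \<open>The dual scattering of a stationary process\<close>

definition shift_operator ::
  "'a measure \<Rightarrow> (int \<Rightarrow> 'a \<Rightarrow> complex) \<Rightarrow> (('a \<Rightarrow> complex) \<Rightarrow> 'a \<Rightarrow> complex) \<Rightarrow> bool" where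
  "shift_operator M X U \<longleftrightarrow>
     L2_unitary M (process_space M X) M (process_space M X) U \<and>
     (\<forall>n. AE x in M. U (X n) x = X (n + 1) x)"

definition dual_incoming :: "'a measure \<Rightarrow> (int \<Rightarrow> 'a \<Rightarrow> complex) \<Rightarrow> ('a \<Rightarrow> complex) set" where
  "dual_incoming M X = L2_orth_in M (process_space M X) (L2_closed_span M X {0..})"

definition dual_outgoing :: "'a measure \<Rightarrow> (int \<Rightarrow> 'a \<Rightarrow> complex) \<Rightarrow> ('a \<Rightarrow> complex) set" where
  "dual_outgoing M X = L2_orth_in M (process_space M X) (L2_closed_span M X {..<0})"

definition intertwiner ::
  "'a measure \<Rightarrow> (int \<Rightarrow> 'a \<Rightarrow> complex) \<Rightarrow> (('a \<Rightarrow> complex) \<Rightarrow> 'a \<Rightarrow> complex) \<Rightarrow>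
   (('a \<Rightarrow> complex) \<Rightarrow> complex \<Rightarrow> complex) \<Rightarrow> bool" where
  "intertwiner M X U \<phi> \<longleftrightarrow>
     L2_unitary M (process_space M X) circle_measure (L2 circle_measure) \<phi> \<and>
     (\<forall>f\<in>process_space M X. AE z in circle_measure. \<phi> (U f) z = z * \<phi> f z)"

definition incoming_intertwiner ::
  "'a measure \<Rightarrow> (int \<Rightarrow> 'a \<Rightarrow> complex) \<Rightarrow> (('a \<Rightarrow> complex) \<Rightarrow> 'a \<Rightarrow> complex) \<Rightarrow>
   (('a \<Rightarrow> complex) \<Rightarrow> complex \<Rightarrow> complex) \<Rightarrow> bool" where
  "incoming_intertwiner M X U \<phi> \<longleftrightarrow> intertwiner M X U \<phi> \<and>
     L2_image circle_measure \<phi> (dual_incoming M X) =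
       L2_orth_in circle_measure (L2 circle_measure) hardy2"

definition outgoing_intertwiner ::
  "'a measure \<Rightarrow> (int \<Rightarrow> 'a \<Rightarrow> complex) \<Rightarrow> (('a \<Rightarrow> complex) \<Rightarrow> 'a \<Rightarrow> complex) \<Rightarrow>
   (('a \<Rightarrow> complex) \<Rightarrow> complex \<Rightarrow> complex) \<Rightarrow> bool" where
  "outgoing_intertwiner M X U \<phi> \<longleftrightarrow> intertwiner M X U \<phi> \<and>
     L2_image circle_measure \<phi> (dual_outgoing M X) = hardy2"

definition scattering_operator ::
  "'a measure \<Rightarrow> (int \<Rightarrow> 'a \<Rightarrow> complex) \<Rightarrow> (('a \<Rightarrow> complex) \<Rightarrow> complex \<Rightarrow> complex) \<Rightarrow>
   (('a \<Rightarrow> complex) \<Rightarrow> complex \<Rightarrow> complex) \<Rightarrow> (complex \<Rightarrow> complex) \<Rightarrow> complex \<Rightarrow> complex" where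
  "scattering_operator M X \<phi>m \<phi>p = \<phi>p \<circ> L2_inv (process_space M X) circle_measure \<phi>m"

text \<open>
  The intertwiners are determined only up to unimodular constants, so the dual scattering
  function is a relation: \<open>s\<close> is a dual scattering function if it arises from some choice of the
  intertwiners.  As a function on the circle it depends on \<open>z = e\<^sup>i\<^sup>\<theta>\<close>.
\<close>

definition is_dual_scattering_function ::
  "'a measure \<Rightarrow> (int \<Rightarrow> 'a \<Rightarrow> complex) \<Rightarrow> (complex \<Rightarrow> complex) \<Rightarrow> bool" where
  "is_dual_scattering_function M X s \<longleftrightarrow>
     s \<in> borel_measurable circle_measure \<and> (AE z in circle_measure. norm (s z) = 1) \<and>
     (\<exists>U \<phi>m \<phi>p. shift_operator M X U \<and>
        incoming_intertwiner M X U \<phi>m \<and> outgoing_intertwiner M X U \<phi>p \<and>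
        (\<forall>k\<in>L2 circle_measure. AE z in circle_measure.
           scattering_operator M X \<phi>m \<phi>p k z = s z * k z))"

end

theory Submission
  imports Defs "HOL-Complex_Analysis.Complex_Analysis"
begin

text \<open>
  The map \<open>X\<^sub>n \<mapsto> z\<^sup>n \<psi>\<^sub>o\<^sub>u\<^sub>t\<close> is isometric because \<open>\<bar>\<psi>\<bar> = \<bar>\<psi>\<^sub>o\<^sub>u\<^sub>t\<bar>\<close> almost everywhere.  It carries the closed
  span of the future onto the closed span of \<open>z\<^sup>n \<psi>\<^sub>o\<^sub>u\<^sub>t\<close>, \<open>n \<ge> 0\<close>, which is the Hardy space since
  outer functions are cyclic; hence it is an incoming intertwiner.  Conjugating,
  \<open>X\<^sub>n \<mapsto> z\<^sup>n cnj \<psi>\<^sub>o\<^sub>u\<^sub>t\<close> is an outgoing one, and the scattering operator is multiplication by the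
  quotient.  The intertwiners are unique up to constants because a unitary operator of \<open>L\<^sup>2\<close> of the
  circle which commutes with multiplication by \<open>z\<close> and preserves the Hardy space and its complement
  is a constant.

  Cyclicity of an outer function \<open>f\<close> with \<open>\<bar>f\<bar> = exp k\<close> is obtained by truncation: let \<open>h\<close> be the
  outer function with \<open>\<bar>h\<bar> = exp (- max k (- n))\<close> on the circle, which is
  bounded.  The dilations of \<open>h\<close> multiplied by \<open>f\<close> lie in the closed span of \<open>z\<^sup>n f\<close>, have
  \<open>L\<^sup>2\<close> norm at most \<open>1\<close> in the limit, and have mean \<open>c exp (\<integral> min 0 (k + n))\<close>, which tends to the
  unimodular constant \<open>c\<close>.  So they approach \<open>c\<close> in \<open>L\<^sup>2\<close>.
\<close>

section \<open>The geometry of \<open>L\<^sup>2\<close>\<close>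

text \<open>The obstacle is cyclicity. The reciprocal of an outer function need not be
  square-integrable, so the constants cannot be reached by dividing by \<open>f\<close>. Truncating
  \<open>k\<close> from below keeps the substitute \<open>h\<close> for the reciprocal bounded by
  \<open>exp n\<close>, and convergence of the products need not be proved directly: a vector of
  norm at most about 1 whose inner product with a unit vector is close to 1 is close to that vector.
  Dilation is needed because the Taylor series of \<open>h\<close> converges uniformly only on
  circles of radius below 1; there it exhibits the product as a limit of polynomials times
  \<open>f\<close>.

  Outer functions are given by a formula inside the disc, so \<open>\<bar>f\<bar> = exp k\<close> on
  the circle has to be derived. As \<open>k\<close> is merely integrable, this rests on
  \<open>L\<^sup>1\<close> convergence of Poisson integrals, which gives almost everywhere limits
  along subsequences of radii; that suffices because only moduli are compared.

  Elements of \<open>L\<^sup>2\<close> are functions rather than classes, so linearity, inverses and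
  agreement of operators hold only almost everywhere and must be transported through null
  sets.\<close>

lemma borel_measurable_cnj [measurable (raw)]:
  "f \<in> borel_measurable M \<Longrightarrow> (\<lambda>x. cnj (f x)) \<in> borel_measurable M"
  by (rule borel_measurable_continuous_on[where f = cnj]) (auto intro: continuous_intros)

definition L2_norm :: "'a measure \<Rightarrow> ('a \<Rightarrow> complex) \<Rightarrow> real" where
  "L2_norm M f = sqrt (LINT x|M. (norm (f x))\<^sup>2)"

lemma L2_measurable: "f \<in> L2 M \<Longrightarrow> f \<in> borel_measurable M"
  by (simp add: L2_def)

lemma L2_integrable: "f \<in> L2 M \<Longrightarrow> integrable M (\<lambda>x. (norm (f x))\<^sup>2)"
  by (simp add: L2_def)

lemma L2_lin:
  assumes f: "f \<in> L2 M" and g: "g \<in> L2 M"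
  shows "(\<lambda>x. a * f x + b * g x) \<in> L2 M"
proof -
  note [measurable] = L2_measurable[OF f] L2_measurable[OF g]
  have "integrable M (\<lambda>x. 2 * (norm a)\<^sup>2 * (norm (f x))\<^sup>2 + 2 * (norm b)\<^sup>2 * (norm (g x))\<^sup>2)"
    using f g by (intro Bochner_Integration.integrable_add integrable_mult_right L2_integrable)
  then have "integrable M (\<lambda>x. (norm (a * f x + b * g x))\<^sup>2)"
  proof (rule Bochner_Integration.integrable_bound)
    have "(norm (a * f x + b * g x))\<^sup>2 \<le> 2 * (norm a)\<^sup>2 * (norm (f x))\<^sup>2 + 2 * (norm b)\<^sup>2 * (norm (g x))\<^sup>2" for x
    proof -
      have "(norm (a * f x + b * g x))\<^sup>2 \<le> (norm a * norm (f x) + norm b * norm (g x))\<^sup>2"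
        by (intro power_mono) (metis norm_mult norm_triangle_ineq, simp)
      also have "\<dots> \<le> 2 * (norm a * norm (f x))\<^sup>2 + 2 * (norm b * norm (g x))\<^sup>2"
        using sum_squares_bound[of "norm a * norm (f x)" "norm b * norm (g x)"]
        by (simp add: power2_sum)
      finally show ?thesis by (simp add: power_mult_distrib)
    qed
    then show "AE x in M. norm ((norm (a * f x + b * g x))\<^sup>2) \<le>
        norm (2 * (norm a)\<^sup>2 * (norm (f x))\<^sup>2 + 2 * (norm b)\<^sup>2 * (norm (g x))\<^sup>2)"
      by (intro AE_I2) (smt (verit) real_norm_def zero_le_power2)
  qed measurable
  then show ?thesis by (simp add: L2_def)
qed

lemma L2_zero: "(\<lambda>x. 0) \<in> L2 M"
  by (simp add: L2_def)

lemma L2_mult: "f \<in> L2 M \<Longrightarrow> (\<lambda>x. a * f x) \<in> L2 M"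
  using L2_lin[of f M f a 0] by simp

lemma L2_add: "f \<in> L2 M \<Longrightarrow> g \<in> L2 M \<Longrightarrow> (\<lambda>x. f x + g x) \<in> L2 M"
  using L2_lin[of f M g 1 1] by simp

lemma L2_diff: "f \<in> L2 M \<Longrightarrow> g \<in> L2 M \<Longrightarrow> (\<lambda>x. f x - g x) \<in> L2 M"
  using L2_lin[of f M g 1 "-1"] by simp

lemma L2_sum:
  assumes "\<And>i. i \<in> F \<Longrightarrow> X i \<in> L2 M"
  shows "(\<lambda>x. \<Sum>i\<in>F. a i * X i x) \<in> L2 M"
  using assms by (induction F rule: infinite_finite_induct) (auto intro!: L2_add L2_mult simp: L2_zero)

lemma L2_bounded_mult:
  assumes f: "f \<in> L2 M" and h[measurable]: "h \<in> borel_measurable M"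
    and b: "AE x in M. norm (h x) \<le> B"
  shows "(\<lambda>x. h x * f x) \<in> L2 M"
proof -
  note [measurable] = L2_measurable[OF f]
  have "integrable M (\<lambda>x. B\<^sup>2 * (norm (f x))\<^sup>2)"
    using L2_integrable[OF f] by simp
  then have "integrable M (\<lambda>x. (norm (h x * f x))\<^sup>2)"
  proof (rule Bochner_Integration.integrable_bound)
    show "AE x in M. norm ((norm (h x * f x))\<^sup>2) \<le> norm (B\<^sup>2 * (norm (f x))\<^sup>2)"
      using b by eventually_elim
        (auto simp: norm_mult power_mult_distrib abs_mult intro!: mult_right_mono power_mono)
  qed measurable
  then show ?thesis by (simp add: L2_def)
qed

lemma L2_unimodular_mult:
  assumes "f \<in> L2 M" "h \<in> borel_measurable M" "AE x in M. norm (h x) = 1"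
  shows "(\<lambda>x. h x * f x) \<in> L2 M"
proof (rule L2_bounded_mult[OF assms(1,2)])
  show "AE x in M. norm (h x) \<le> 1"
    using assms(3) by eventually_elim simp
qed

section \<open>Inner product, Cauchy-Schwarz inequality and completeness\<close>

lemma L2_inner_integrable:
  assumes f: "f \<in> L2 M" and g: "g \<in> L2 M"
  shows "integrable M (\<lambda>x. cnj (f x) * g x)"
proof -
  note [measurable] = L2_measurable[OF f] L2_measurable[OF g]
  have "integrable M (\<lambda>x. (norm (f x))\<^sup>2 + (norm (g x))\<^sup>2)"
    using f g by (intro Bochner_Integration.integrable_add L2_integrable)
  then show ?thesis
  proof (rule Bochner_Integration.integrable_bound)
    have "norm (f x) * norm (g x) \<le> (norm (f x))\<^sup>2 + (norm (g x))\<^sup>2" for x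
      using sum_squares_bound[of "norm (f x)" "norm (g x)"] mult_nonneg_nonneg[OF norm_ge_zero[of "f x"] norm_ge_zero[of "g x"]]
      unfolding mult.assoc by linarith
    then show "AE x in M. norm (cnj (f x) * g x) \<le> norm ((norm (f x))\<^sup>2 + (norm (g x))\<^sup>2)"
      by (simp add: norm_mult)
  qed measurable
qed

lemma L2_inner_lin_right:
  assumes "h \<in> L2 M" "f \<in> L2 M" "g \<in> L2 M"
  shows "L2_inner M h (\<lambda>x. a * f x + b * g x) = a * L2_inner M h f + b * L2_inner M h g"
proof -
  have "L2_inner M h (\<lambda>x. a * f x + b * g x)
      = (LINT x|M. a * (cnj (h x) * f x) + b * (cnj (h x) * g x))"
    unfolding L2_inner_def by (intro Bochner_Integration.integral_cong) (auto simp: algebra_simps)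
  then show ?thesis
    using assms by (simp add: L2_inner_integrable L2_inner_def)
qed

lemma L2_inner_cnj: "L2_inner M g f = cnj (L2_inner M f g)"
  unfolding L2_inner_def using Bochner_Integration.integral_cnj[of M "\<lambda>x. cnj (f x) * g x"] by (simp add: mult.commute)

lemma L2_inner_lin_left:
  assumes "h \<in> L2 M" "f \<in> L2 M" "g \<in> L2 M"
  shows "L2_inner M (\<lambda>x. a * f x + b * g x) h = cnj a * L2_inner M f h + cnj b * L2_inner M g h"
  using L2_inner_lin_right[OF assms, of a b]
  by (metis L2_inner_cnj complex_cnj_add complex_cnj_mult)

lemma L2_inner_diff_right:
  assumes "h \<in> L2 M" "f \<in> L2 M" "g \<in> L2 M"
  shows "L2_inner M h (\<lambda>x. f x - g x) = L2_inner M h f - L2_inner M h g"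
  using L2_inner_lin_right[OF assms, of 1 "-1"] by simp

lemma L2_norm_square: "(L2_norm M f)\<^sup>2 = (LINT x|M. (norm (f x))\<^sup>2)"
  by (simp add: L2_norm_def)

lemma L2_norm_nonneg: "0 \<le> L2_norm M f"
  by (simp add: L2_norm_def)

lemma L2_inner_self: "L2_inner M f f = of_real ((L2_norm M f)\<^sup>2)"
  unfolding L2_norm_square L2_inner_def integral_complex_of_real[symmetric]
  by (intro Bochner_Integration.integral_cong) (auto simp: complex_norm_square mult.commute simp del: of_real_power)

text \<open>Both coefficients are kept free because different choices yield the Cauchy-Schwarz
  inequality, polarization, Pythagoras, and the final estimate of the distance to a
  constant.\<close>

lemma L2_norm_lin:
  assumes "f \<in> L2 M" "g \<in> L2 M"
  shows "(L2_norm M (\<lambda>x. a * f x + b * g x))\<^sup>2 =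
    (norm a)\<^sup>2 * (L2_norm M f)\<^sup>2 + (norm b)\<^sup>2 * (L2_norm M g)\<^sup>2
      + 2 * Re (cnj a * b * L2_inner M f g)"
proof -
  have "of_real ((L2_norm M (\<lambda>x. a * f x + b * g x))\<^sup>2) =
      a * cnj a * of_real ((L2_norm M f)\<^sup>2) + b * cnj b * of_real ((L2_norm M g)\<^sup>2)
      + (cnj a * b * L2_inner M f g + cnj (cnj a * b * L2_inner M f g))"
    using assms unfolding L2_inner_self[symmetric]
    by (simp add: L2_inner_lin_left L2_inner_lin_right L2_lin L2_inner_cnj[of M g f] algebra_simps)
  also have "\<dots> = of_real ((norm a)\<^sup>2 * (L2_norm M f)\<^sup>2 + (norm b)\<^sup>2 * (L2_norm M g)\<^sup>2
      + 2 * Re (cnj a * b * L2_inner M f g))"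
    by (simp only: complex_norm_square[symmetric] complex_add_cnj of_real_mult of_real_add)
  finally show ?thesis by (simp only: of_real_eq_iff)
qed

lemma L2_norm_mult: "L2_norm M (\<lambda>x. a * f x) = norm a * L2_norm M f"
  by (simp add: L2_norm_def norm_mult power_mult_distrib real_sqrt_mult)

lemma L2_norm_cong_AE:
  assumes "f \<in> borel_measurable M" "g \<in> borel_measurable M" "AE x in M. norm (f x) = norm (g x)"
  shows "L2_norm M f = L2_norm M g"
  unfolding L2_norm_def using assms by (intro arg_cong[where f = sqrt] integral_cong_AE) auto

lemma L2_norm_eq_0:
  assumes "f \<in> L2 M"
  shows "L2_norm M f = 0 \<longleftrightarrow> (AE x in M. f x = 0)"
  using integral_nonneg_eq_0_iff_AE[OF L2_integrable[OF assms]] by (simp add: L2_norm_def)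

lemma L2_cauchy_schwarz:
  assumes f: "f \<in> L2 M" and g: "g \<in> L2 M"
  shows "norm (L2_inner M f g) \<le> L2_norm M f * L2_norm M g"
proof (cases "L2_norm M g = 0")
  case True
  then have "AE x in M. g x = 0" using L2_norm_eq_0[OF g] by simp
  then have "AE x in M. cnj (f x) * g x = 0" by eventually_elim simp
  then have "L2_inner M f g = 0"
    unfolding L2_inner_def by (rule integral_eq_zero_AE)
  then show ?thesis by (simp add: L2_norm_nonneg)
next
  case False
  \<comment> \<open>The combination \<open>B f - cnj C g\<close> used below is \<open>B\<close>
    times the component of \<open>f\<close> orthogonal to \<open>g\<close>; nonnegativity of its
    squared norm is the inequality up to the factor \<open>B\<close>.\<close>
  define A B C where "A = (L2_norm M f)\<^sup>2" and "B = (L2_norm M g)\<^sup>2" and "C = L2_inner M f g"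
  have "cnj (complex_of_real B) * - cnj C * C = - of_real (B * (norm C)\<^sup>2)"
    using complex_norm_square[of C] by (simp add: mult_ac)
  then have "0 \<le> B\<^sup>2 * A + (norm C)\<^sup>2 * B + 2 * - (B * (norm C)\<^sup>2)"
    using L2_norm_lin[OF f g, of "of_real B" "- cnj C"] zero_le_power2[of "L2_norm M (\<lambda>x. of_real B * f x + - cnj C * g x)"]
    unfolding A_def[symmetric] B_def[symmetric] C_def[symmetric]
    by (metis Re_complex_of_real complex_mod_cnj norm_minus_cancel norm_of_real of_real_minus power2_abs)
  then have "0 \<le> B * (A * B - (norm C)\<^sup>2)"
    by (simp add: algebra_simps power2_eq_square)
  moreover have "B > 0" using False by (simp add: B_def)
  ultimately have "(norm C)\<^sup>2 \<le> A * B"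
    by (simp add: zero_le_mult_iff)
  then have "(norm C)\<^sup>2 \<le> (L2_norm M f * L2_norm M g)\<^sup>2"
    by (simp add: A_def B_def power_mult_distrib)
  then show ?thesis
    unfolding C_def by (rule power2_le_imp_le) (simp add: L2_norm_nonneg)
qed

lemma L2_norm_triangle:
  assumes f: "f \<in> L2 M" and g: "g \<in> L2 M"
  shows "L2_norm M (\<lambda>x. f x + g x) \<le> L2_norm M f + L2_norm M g"
proof (rule power2_le_imp_le)
  show "(L2_norm M (\<lambda>x. f x + g x))\<^sup>2 \<le> (L2_norm M f + L2_norm M g)\<^sup>2"
    using L2_norm_lin[OF f g, of 1 1] complex_Re_le_cmod[of "L2_inner M f g"] L2_cauchy_schwarz[OF f g]
    by (simp add: power2_sum)
qed (simp add: L2_norm_nonneg)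

lemma L2_norm_minus_commute: "L2_norm M (\<lambda>x. f x - g x) = L2_norm M (\<lambda>x. g x - f x)"
  by (simp add: L2_norm_def norm_minus_commute)

lemma L2_norm_triangle_sub:
  assumes "f \<in> L2 M" "g \<in> L2 M" "h \<in> L2 M"
  shows "L2_norm M (\<lambda>x. f x - h x) \<le> L2_norm M (\<lambda>x. f x - g x) + L2_norm M (\<lambda>x. g x - h x)"
  using L2_norm_triangle[of "\<lambda>x. f x - g x" M "\<lambda>x. g x - h x"] assms by (simp add: L2_diff)

lemma L2_norm_diff_bound:
  assumes f: "f \<in> L2 M" and g: "g \<in> L2 M"
  shows "\<bar>L2_norm M f - L2_norm M g\<bar> \<le> L2_norm M (\<lambda>x. f x - g x)"
  using L2_norm_triangle[OF L2_diff[OF f g] g] L2_norm_triangle[OF L2_diff[OF g f] f]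
    L2_norm_minus_commute[of M f g] by simp

lemma L2_norm_lin_le:
  assumes f: "f \<in> L2 M" and g: "g \<in> L2 M"
  shows "L2_norm M (\<lambda>x. a * f x + b * g x) \<le> norm a * L2_norm M f + norm b * L2_norm M g"
  using L2_norm_triangle[OF L2_mult[OF f, of a] L2_mult[OF g, of b]] by (simp add: L2_norm_mult)

text \<open>Cauchy-Schwarz against the constant 1, which is square-integrable because the measure is
  finite.\<close>

lemma L2_integral_norm_le:
  assumes "finite_measure M" and f: "f \<in> L2 M"
  shows "integrable M f" "(LINT x|M. norm (f x)) \<le> sqrt (measure M (space M)) * L2_norm M f"
proof -
  interpret finite_measure M by fact
  have one: "(\<lambda>x. 1) \<in> L2 M" by (simp add: L2_def)
  show "integrable M f" using L2_inner_integrable[OF one f] by simp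
  have nf: "(\<lambda>x. of_real (norm (f x))) \<in> L2 M"
    using f by (auto simp: L2_def)
  have "norm (L2_inner M (\<lambda>x. 1) (\<lambda>x. of_real (norm (f x)))) \<le>
      L2_norm M (\<lambda>x. 1) * L2_norm M (\<lambda>x. of_real (norm (f x)))"
    by (rule L2_cauchy_schwarz[OF one nf])
  then show "(LINT x|M. norm (f x)) \<le> sqrt (measure M (space M)) * L2_norm M f"
    by (simp add: L2_inner_def L2_norm_def)
qed

text \<open>Finiteness of the measure turns an \<open>L\<^sup>2\<close> Cauchy sequence into an
  \<open>L\<^sup>1\<close> Cauchy sequence, which has an almost everywhere convergent subsequence;
  Fatou's lemma then recovers the \<open>L\<^sup>2\<close> bounds for its limit.\<close>

lemma L2_complete:
  assumes fin: "finite_measure M" and u: "\<And>n. u n \<in> L2 M"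
    and cauchy: "\<And>e. e > 0 \<Longrightarrow> \<exists>N. \<forall>i\<ge>N. \<forall>j\<ge>N. L2_norm M (\<lambda>x. u i x - u j x) < e"
  obtains f where "f \<in> L2 M" "(\<lambda>n. L2_norm M (\<lambda>x. u n x - f x)) \<longlonglongrightarrow> 0"
proof -
  interpret finite_measure M by fact
  note [measurable] = L2_measurable[OF u]
  have c: "\<exists>N. \<forall>i\<ge>N. \<forall>j\<ge>N. (LINT x|M. norm (u i x - u j x)) < e" if e: "e > 0" for e
  proof -
    \<comment> \<open>The summand 1 keeps \<open>K\<close> positive even when the measure is
      zero.\<close>
    define K where "K = sqrt (measure M (space M)) + 1"
    have K: "K > 0" unfolding K_def by (smt (verit) measure_nonneg real_sqrt_ge_zero)
    obtain N where N: "\<And>i j. i \<ge> N \<Longrightarrow> j \<ge> N \<Longrightarrow> L2_norm M (\<lambda>x. u i x - u j x) < e / K"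
      using cauchy[of "e / K"] e K by auto
    have "(LINT x|M. norm (u i x - u j x)) < e" if "i \<ge> N" "j \<ge> N" for i j
    proof -
      have "(LINT x|M. norm (u i x - u j x)) \<le> sqrt (measure M (space M)) * L2_norm M (\<lambda>x. u i x - u j x)"
        by (intro L2_integral_norm_le fin L2_diff u)
      also have "\<dots> \<le> K * L2_norm M (\<lambda>x. u i x - u j x)"
        by (intro mult_right_mono L2_norm_nonneg) (simp add: K_def)
      also have "\<dots> < e"
        using N[OF that] K by (simp add: field_simps)
      finally show ?thesis .
    qed
    then show ?thesis by blast
  qed
  obtain r where r: "strict_mono r" "AE x in M. Cauchy (\<lambda>i. u (r i) x)"
    using cauchy_L1_AE_cauchy_subseq[OF L2_integral_norm_le(1)[OF fin u] c] by blast
  \<comment> \<open>The value 0 where the subsequence fails to be Cauchy makes \<open>f\<close>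
    measurable on the whole space.\<close>
  define f where "f x = (if Cauchy (\<lambda>i. u (r i) x) then lim (\<lambda>i. u (r i) x) else 0)" for x
  have fm[measurable]: "f \<in> borel_measurable M"
    unfolding f_def by measurable
  have lim: "AE x in M. (\<lambda>i. u (r i) x) \<longlonglongrightarrow> f x"
    using r(2) by eventually_elim (simp add: f_def Cauchy_convergent_iff convergent_LIMSEQ_iff)
  have fatou: "integrable M (\<lambda>x. (norm (u n x - f x))\<^sup>2) \<and> L2_norm M (\<lambda>x. u n x - f x) \<le> e"
    if e: "e > 0" and N: "\<forall>i\<ge>N. \<forall>j\<ge>N. L2_norm M (\<lambda>x. u i x - u j x) < e" "n \<ge> N" for n N e
  proof -
    have "(\<integral>\<^sup>+ x. ennreal ((norm (u n x - f x))\<^sup>2) \<partial>M) =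
      (\<integral>\<^sup>+ x. liminf (\<lambda>i. ennreal ((norm (u n x - u (r i) x))\<^sup>2)) \<partial>M)"
    proof (rule nn_integral_cong_AE, use lim in eventually_elim)
      fix x assume "(\<lambda>i. u (r i) x) \<longlonglongrightarrow> f x"
      then have "(\<lambda>i. ennreal ((norm (u n x - u (r i) x))\<^sup>2)) \<longlonglongrightarrow> ennreal ((norm (u n x - f x))\<^sup>2)"
        by (intro tendsto_ennrealI tendsto_intros)
      then show "ennreal ((norm (u n x - f x))\<^sup>2) = liminf (\<lambda>i. ennreal ((norm (u n x - u (r i) x))\<^sup>2))"
        by (rule lim_imp_Liminf[OF sequentially_bot, symmetric])
    qed
    also have "\<dots> \<le> liminf (\<lambda>i. \<integral>\<^sup>+ x. ennreal ((norm (u n x - u (r i) x))\<^sup>2) \<partial>M)"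
      by (rule nn_integral_liminf) measurable
    also have "\<dots> \<le> ennreal (e\<^sup>2)"
    proof (rule Liminf_le)
      show "\<forall>\<^sub>F i in sequentially. (\<integral>\<^sup>+ x. ennreal ((norm (u n x - u (r i) x))\<^sup>2) \<partial>M) \<le> ennreal (e\<^sup>2)"
        using eventually_ge_at_top[of N]
      proof eventually_elim
        case (elim i)
        have lt: "L2_norm M (\<lambda>x. u n x - u (r i) x) < e"
          using N elim seq_suble[OF r(1), of i] by auto
        have "(\<integral>\<^sup>+ x. ennreal ((norm (u n x - u (r i) x))\<^sup>2) \<partial>M) = ennreal ((L2_norm M (\<lambda>x. u n x - u (r i) x))\<^sup>2)"
          unfolding L2_norm_square by (intro nn_integral_eq_integral L2_integrable L2_diff u) auto
        also have "\<dots> \<le> ennreal (e\<^sup>2)"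
          using lt by (intro ennreal_leI power_mono) (auto simp: L2_norm_nonneg)
        finally show ?case .
      qed
    qed simp
    finally have *: "(\<integral>\<^sup>+ x. ennreal ((norm (u n x - f x))\<^sup>2) \<partial>M) \<le> ennreal (e\<^sup>2)" .
    have int: "integrable M (\<lambda>x. (norm (u n x - f x))\<^sup>2)"
      using * by (intro integrableI_bounded) (auto simp: le_less_trans[OF _ ennreal_less_top])
    have "(L2_norm M (\<lambda>x. u n x - f x))\<^sup>2 \<le> e\<^sup>2"
      using * e unfolding L2_norm_square
      by (subst (asm) nn_integral_eq_integral[OF int]) auto
    then show ?thesis using int e by (auto intro: power2_le_imp_le)
  qed
  \<comment> \<open>Tolerance 1 is enough here: finiteness of one distance \<open>u N - f\<close>
    already puts \<open>f\<close> into \<open>L\<^sup>2\<close>.\<close>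
  obtain N where "\<forall>i\<ge>N. \<forall>j\<ge>N. L2_norm M (\<lambda>x. u i x - u j x) < 1" using cauchy[of 1] by auto
  from fatou[OF _ this] have "(\<lambda>x. u N x - f x) \<in> L2 M" by (simp add: L2_def)
  from L2_diff[OF u[of N] this] have "f \<in> L2 M" by simp
  moreover have "(\<lambda>n. L2_norm M (\<lambda>x. u n x - f x)) \<longlonglongrightarrow> 0"
  proof (rule LIMSEQ_I)
    fix e :: real assume "e > 0"
    obtain N where N: "\<forall>i\<ge>N. \<forall>j\<ge>N. L2_norm M (\<lambda>x. u i x - u j x) < e / 2"
      using cauchy[of "e / 2"] \<open>e > 0\<close> by auto
    have "norm (L2_norm M (\<lambda>x. u n x - f x) - 0) < e" if "n \<ge> N" for n
      using fatou[OF _ N that] \<open>e > 0\<close> L2_norm_nonneg[of M "\<lambda>x. u n x - f x"] by auto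
    then show "\<exists>N. \<forall>n\<ge>N. norm (L2_norm M (\<lambda>x. u n x - f x) - 0) < e" by blast
  qed
  ultimately show ?thesis by (rule that)
qed

section \<open>Closed subspaces and closed spans\<close>

text \<open>Closedness is phrased by approximation, without sequences. Since functions at distance 0
  approximate each other, it also forces invariance under almost everywhere equality.\<close>

definition L2_subspace :: "'a measure \<Rightarrow> ('a \<Rightarrow> complex) set \<Rightarrow> bool" where
  "L2_subspace M S \<longleftrightarrow> S \<subseteq> L2 M \<and> (\<lambda>x. 0) \<in> S \<and>
     (\<forall>f\<in>S. \<forall>g\<in>S. \<forall>a b. (\<lambda>x. a * f x + b * g x) \<in> S) \<and>
     (\<forall>f\<in>L2 M. (\<forall>e>0. \<exists>g\<in>S. L2_norm M (\<lambda>x. f x - g x) < e) \<longrightarrow> f \<in> S)"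

lemma L2_subspaceD:
  assumes "L2_subspace M S"
  shows "f \<in> S \<Longrightarrow> f \<in> L2 M" "(\<lambda>x. 0) \<in> S"
    "f \<in> S \<Longrightarrow> g \<in> S \<Longrightarrow> (\<lambda>x. a * f x + b * g x) \<in> S"
    "f \<in> L2 M \<Longrightarrow> (\<And>e. e > 0 \<Longrightarrow> \<exists>g\<in>S. L2_norm M (\<lambda>x. f x - g x) < e) \<Longrightarrow> f \<in> S"
  using assms by (auto simp: L2_subspace_def)

lemma L2_subspace_mult: "L2_subspace M S \<Longrightarrow> f \<in> S \<Longrightarrow> (\<lambda>x. a * f x) \<in> S"
  using L2_subspaceD(3)[of M S f f a 0] by simp

lemma L2_subspace_diff: "L2_subspace M S \<Longrightarrow> f \<in> S \<Longrightarrow> g \<in> S \<Longrightarrow> (\<lambda>x. f x - g x) \<in> S"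
  using L2_subspaceD(3)[of M S f g 1 "-1"] by simp

lemma L2_subspace_sum:
  assumes S: "L2_subspace M S" and "\<And>i. i \<in> F \<Longrightarrow> X i \<in> S"
  shows "(\<lambda>x. \<Sum>i\<in>F. a i * X i x) \<in> S"
  using assms(2)
proof (induction F rule: infinite_finite_induct)
  case (insert i F)
  then show ?case
    using L2_subspaceD(3)[OF S, of "X i" "\<lambda>x. \<Sum>i\<in>F. a i * X i x" "a i" 1] by simp
qed (auto simp: L2_subspaceD(2)[OF S])

lemma L2_subspace_cong_AE:
  assumes S: "L2_subspace M S" and f: "f \<in> S" and g: "g \<in> L2 M" and "AE x in M. f x = g x"
  shows "g \<in> S"
proof (rule L2_subspaceD(4)[OF S g])
  fix e :: real assume "e > 0"
  have "AE x in M. g x - f x = 0" using assms(4) by eventually_elim simp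
  then have "L2_norm M (\<lambda>x. g x - f x) = 0"
    using L2_norm_eq_0[OF L2_diff[OF g L2_subspaceD(1)[OF S f]]] by simp
  then show "\<exists>h\<in>S. L2_norm M (\<lambda>x. g x - h x) < e" using f \<open>e > 0\<close> by (intro bexI[of _ f]) auto
qed

lemma L2_subspace_L2: "L2_subspace M (L2 M)"
  by (auto simp: L2_subspace_def L2_zero L2_lin)

lemma L2_inner_cong_AE:
  assumes "f \<in> L2 M" "g \<in> L2 M" "f' \<in> L2 M" "g' \<in> L2 M"
    and "AE x in M. f x = f' x" "AE x in M. g x = g' x"
  shows "L2_inner M f g = L2_inner M f' g'"
proof -
  note [measurable] = assms(1-4)[THEN L2_measurable]
  have "AE x in M. cnj (f x) * g x = cnj (f' x) * g' x"
    using assms(5,6) by eventually_elim simp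
  then show ?thesis
    unfolding L2_inner_def by (rule integral_cong_AE[rotated 2]) measurable
qed

text \<open>The common ending of the epsilon arguments. The test value
  \<open>a / (2 * (\<bar>K\<bar> + 1))\<close> works whatever the sign of \<open>K\<close>.\<close>

lemma small_multiples_imp_zero:
  fixes a K :: real
  assumes "\<And>e. e > 0 \<Longrightarrow> a \<le> K * e" "0 \<le> a"
  shows "a = 0"
proof (rule ccontr)
  assume "a \<noteq> 0"
  then have a: "a > 0" using assms(2) by simp
  then have "a \<le> K * (a / (2 * (\<bar>K\<bar> + 1)))" by (intro assms(1)) auto
  also have "\<dots> \<le> \<bar>K\<bar> * (a / (2 * (\<bar>K\<bar> + 1)))" using a by (intro mult_right_mono) auto
  also have "\<dots> < a"
    using a by (simp add: field_simps) (smt (verit) mult_nonneg_nonneg)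
  finally show False by simp
qed

text \<open>Closedness is continuity of the inner product, that is, Cauchy-Schwarz applied to the
  difference of \<open>f\<close> and an approximant.\<close>

lemma L2_subspace_orth:
  assumes "K \<subseteq> L2 M"
  shows "L2_subspace M (L2_orth_in M (L2 M) K)"
  unfolding L2_subspace_def L2_orth_in_def
proof (intro conjI ballI allI impI CollectI; (elim CollectE conjE)?)
  fix f k assume f: "f \<in> L2 M" and k: "k \<in> K"
    and *: "\<forall>e>0. \<exists>g\<in>{f \<in> L2 M. \<forall>g\<in>K. L2_inner M g f = 0}. L2_norm M (\<lambda>x. f x - g x) < e"
  have kL: "k \<in> L2 M" using k assms by auto
  have "norm (L2_inner M k f) \<le> L2_norm M k * e" if e: "e > 0" for e
  proof -
    obtain g where g: "g \<in> L2 M" "L2_inner M k g = 0" "L2_norm M (\<lambda>x. f x - g x) < e"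
      using *[rule_format, OF e] k by auto
    have "L2_inner M k f = L2_inner M k (\<lambda>x. f x - g x)"
      using g f kL by (simp add: L2_inner_diff_right)
    also have "norm \<dots> \<le> L2_norm M k * L2_norm M (\<lambda>x. f x - g x)"
      by (intro L2_cauchy_schwarz kL L2_diff f g)
    also have "\<dots> \<le> L2_norm M k * e"
      using g by (intro mult_left_mono) (auto simp: L2_norm_nonneg)
    finally show ?thesis .
  qed
  then show "L2_inner M k f = 0"
    using small_multiples_imp_zero[of "norm (L2_inner M k f)" "L2_norm M k"] by simp
next
  fix f g a b k assume "f \<in> L2 M" "g \<in> L2 M" "k \<in> K"
    "\<forall>k\<in>K. L2_inner M k f = 0" "\<forall>k\<in>K. L2_inner M k g = 0"
  moreover have "k \<in> L2 M" using \<open>k \<in> K\<close> assms by auto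
  ultimately show "L2_inner M k (\<lambda>x. a * f x + b * g x) = 0"
    by (simp add: L2_inner_lin_right)
qed (use assms in \<open>auto simp: L2_zero L2_lin, auto simp: L2_inner_def\<close>)

text \<open>The definition bounds the squared distance. Replacing \<open>e\<close> by its square, or
  by \<open>sqrt e\<close>, passes to the norm, for which the triangle inequality is
  available.\<close>

lemma L2_closed_span_iff:
  "f \<in> L2_closed_span M X I \<longleftrightarrow> f \<in> L2 M \<and> (\<forall>e>0. \<exists>F a. finite F \<and> F \<subseteq> I \<and>
     L2_norm M (\<lambda>x. f x - (\<Sum>i\<in>F. a i * X i x)) < e)"
proof -
  have eq: "L2_norm M g < e \<longleftrightarrow> (LINT x|M. (norm (g x))\<^sup>2) < e\<^sup>2" if "e > 0" for e g
    using that unfolding L2_norm_square[symmetric]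
    by (metis L2_norm_nonneg less_imp_le power2_less_imp_less power_strict_mono zero_less_numeral)
  show ?thesis
  proof (safe)
    fix e :: real assume "f \<in> L2_closed_span M X I" "e > 0"
    then show "\<exists>F a. finite F \<and> F \<subseteq> I \<and> L2_norm M (\<lambda>x. f x - (\<Sum>i\<in>F. a i * X i x)) < e"
      by (simp add: eq L2_closed_span_def)
  next
    assume f: "f \<in> L2 M" and *: "\<forall>e>0. \<exists>F a. finite F \<and> F \<subseteq> I \<and>
      L2_norm M (\<lambda>x. f x - (\<Sum>i\<in>F. a i * X i x)) < e"
    have "\<exists>F a. finite F \<and> F \<subseteq> I \<and> (LINT x|M. (norm (f x - (\<Sum>i\<in>F. a i * X i x)))\<^sup>2) < e"
      if "e > 0" for e
      using *[rule_format, of "sqrt e"] that by (simp add: eq)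
    then show "f \<in> L2_closed_span M X I" using f by (simp add: L2_closed_span_def)
  qed (simp add: L2_closed_span_def)
qed

text \<open>Coefficients are extended by zero so that two combinations over different index sets can
  be added over the union.\<close>

lemma sum_merge:
  fixes a b :: "'i \<Rightarrow> complex"
  assumes "finite F" "finite G"
  shows "\<alpha> * (\<Sum>i\<in>F. a i * X i x) + \<beta> * (\<Sum>i\<in>G. b i * X i x) =
    (\<Sum>i\<in>F \<union> G. (\<alpha> * (if i \<in> F then a i else 0) + \<beta> * (if i \<in> G then b i else 0)) * X i x)"
proof -
  have "(\<Sum>i\<in>F. a i * X i x) = (\<Sum>i\<in>F \<union> G. (if i \<in> F then a i else 0) * X i x)"
    "(\<Sum>i\<in>G. b i * X i x) = (\<Sum>i\<in>F \<union> G. (if i \<in> G then b i else 0) * X i x)"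
    using assms by (auto intro!: sum.mono_neutral_cong_left)
  then show ?thesis by (simp add: algebra_simps sum.distrib sum_distrib_left)
qed

lemma L2_norm_lin_diff_less:
  assumes "f \<in> L2 M" "g \<in> L2 M" "p \<in> L2 M" "q \<in> L2 M" "e > 0"
    and "L2_norm M (\<lambda>x. f x - p x) < e / (norm a + norm b + 1)"
    and "L2_norm M (\<lambda>x. g x - q x) < e / (norm a + norm b + 1)"
  shows "L2_norm M (\<lambda>x. (a * f x + b * g x) - (a * p x + b * q x)) < e"
proof -
  let ?K = "norm a + norm b + 1"
  have K: "?K > 0" using norm_ge_zero[of a] norm_ge_zero[of b] by linarith
  have "L2_norm M (\<lambda>x. (a * f x + b * g x) - (a * p x + b * q x)) =
      L2_norm M (\<lambda>x. a * (f x - p x) + b * (g x - q x))"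
    by (simp add: algebra_simps)
  also have "\<dots> \<le> norm a * L2_norm M (\<lambda>x. f x - p x) + norm b * L2_norm M (\<lambda>x. g x - q x)"
    by (intro L2_norm_lin_le L2_diff assms)
  also have "\<dots> \<le> norm a * (e / ?K) + norm b * (e / ?K)"
    using assms by (intro add_mono mult_left_mono) auto
  also have "\<dots> = (norm a + norm b) * e / ?K"
    by (simp add: add_divide_distrib distrib_right)
  also have "\<dots> < e" using K \<open>e > 0\<close> by (simp add: pos_divide_less_eq algebra_simps)
  finally show ?thesis .
qed

lemma L2_subspace_closed_span:
  assumes X: "\<And>i. i \<in> I \<Longrightarrow> X i \<in> L2 M"
  shows "L2_subspace M (L2_closed_span M X I)"
  unfolding L2_subspace_def
proof (intro conjI ballI allI impI)
  show "L2_closed_span M X I \<subseteq> L2 M" by (auto simp: L2_closed_span_def)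
  show "(\<lambda>x. 0) \<in> L2_closed_span M X I"
    by (auto simp: L2_closed_span_def L2_zero intro!: exI[of _ "{}"])
next
  fix f g and a b :: complex assume f: "f \<in> L2_closed_span M X I" and g: "g \<in> L2_closed_span M X I"
  let ?K = "norm a + norm b + 1"
  show "(\<lambda>x. a * f x + b * g x) \<in> L2_closed_span M X I"
    unfolding L2_closed_span_iff
  proof (intro conjI allI impI)
    show "(\<lambda>x. a * f x + b * g x) \<in> L2 M"
      using f g by (auto simp: L2_closed_span_def intro: L2_lin)
    fix e :: real assume e: "e > 0"
    have K: "?K > 0" using norm_ge_zero[of a] norm_ge_zero[of b] by linarith
    obtain F p where F: "finite F" "F \<subseteq> I" "L2_norm M (\<lambda>x. f x - (\<Sum>i\<in>F. p i * X i x)) < e / ?K"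
      using f K e unfolding L2_closed_span_iff by (meson divide_pos_pos)
    obtain G q where G: "finite G" "G \<subseteq> I" "L2_norm M (\<lambda>x. g x - (\<Sum>i\<in>G. q i * X i x)) < e / ?K"
      using g K e unfolding L2_closed_span_iff by (meson divide_pos_pos)
    have "L2_norm M (\<lambda>x. (a * f x + b * g x) -
        (a * (\<Sum>i\<in>F. p i * X i x) + b * (\<Sum>i\<in>G. q i * X i x))) < e"
      using f g F G e X by (intro L2_norm_lin_diff_less L2_sum) (auto simp: L2_closed_span_def)
    then show "\<exists>F' c. finite F' \<and> F' \<subseteq> I \<and>
        L2_norm M (\<lambda>x. a * f x + b * g x - (\<Sum>i\<in>F'. c i * X i x)) < e"
      unfolding sum_merge[OF F(1) G(1)]
      using F G by (intro exI[of _ "F \<union> G"] exI conjI) auto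
  qed
next
  fix f assume f: "f \<in> L2 M"
    and *: "\<forall>e>0. \<exists>g\<in>L2_closed_span M X I. L2_norm M (\<lambda>x. f x - g x) < e"
  show "f \<in> L2_closed_span M X I"
    unfolding L2_closed_span_iff
  proof (intro conjI allI impI f)
    fix e :: real assume e: "e > 0"
    obtain g where g: "g \<in> L2_closed_span M X I" "L2_norm M (\<lambda>x. f x - g x) < e / 2"
      using * e by (meson half_gt_zero)
    obtain F a where F: "finite F" "F \<subseteq> I" "L2_norm M (\<lambda>x. g x - (\<Sum>i\<in>F. a i * X i x)) < e / 2"
      using g e unfolding L2_closed_span_iff by (meson half_gt_zero)
    have "L2_norm M (\<lambda>x. f x - (\<Sum>i\<in>F. a i * X i x)) < e"
      using L2_norm_triangle_sub[of f M g "\<lambda>x. \<Sum>i\<in>F. a i * X i x"] f g F X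
      by (force simp: L2_closed_span_def intro!: L2_sum)
    then show "\<exists>F a. finite F \<and> F \<subseteq> I \<and> L2_norm M (\<lambda>x. f x - (\<Sum>i\<in>F. a i * X i x)) < e"
      using F by blast
  qed
qed

text \<open>The induction principle for closed spans: a property of all elements follows once its
  extension is a closed subspace and the generators have it.\<close>

lemma L2_closed_span_least:
  assumes S: "L2_subspace M S" and X: "\<And>i. i \<in> I \<Longrightarrow> X i \<in> S"
  shows "L2_closed_span M X I \<subseteq> S"
proof
  fix f assume f: "f \<in> L2_closed_span M X I"
  show "f \<in> S"
  proof (rule L2_subspaceD(4)[OF S])
    show "f \<in> L2 M" using f by (simp add: L2_closed_span_def)
    fix e :: real assume "e > 0"
    then obtain F a where F: "finite F" "F \<subseteq> I" "L2_norm M (\<lambda>x. f x - (\<Sum>i\<in>F. a i * X i x)) < e"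
      using f unfolding L2_closed_span_iff by blast
    then show "\<exists>g\<in>S. L2_norm M (\<lambda>x. f x - g x) < e"
      using X by (intro bexI[of _ "\<lambda>x. \<Sum>i\<in>F. a i * X i x"] L2_subspace_sum[OF S]) auto
  qed
qed

lemma L2_closed_span_superset:
  assumes "i \<in> I" "X i \<in> L2 M"
  shows "X i \<in> L2_closed_span M X I"
  unfolding L2_closed_span_iff
  using assms by (auto intro!: exI[of _ "{i}"] exI[of _ "\<lambda>_. 1"] simp: L2_norm_def)

text \<open>Orthogonality needs testing only on generators, because the vectors orthogonal to a
  fixed \<open>f\<close> form a closed subspace.\<close>

lemma L2_orth_closed_span:
  assumes H: "H \<subseteq> L2 M" and X: "\<And>i. i \<in> I \<Longrightarrow> X i \<in> L2 M"
  shows "L2_orth_in M H (L2_closed_span M X I) = {f \<in> H. \<forall>i\<in>I. L2_inner M (X i) f = 0}"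
proof (safe)
  fix f assume f: "f \<in> L2_orth_in M H (L2_closed_span M X I)"
  then show "f \<in> H" by (simp add: L2_orth_in_def)
  fix i assume "i \<in> I"
  with f X show "L2_inner M (X i) f = 0"
    by (auto simp: L2_orth_in_def L2_closed_span_superset)
next
  fix f assume f: "f \<in> H" and *: "\<forall>i\<in>I. L2_inner M (X i) f = 0"
  have "L2_closed_span M X I \<subseteq> L2_orth_in M (L2 M) {f}"
  proof (rule L2_closed_span_least)
    show "L2_subspace M (L2_orth_in M (L2 M) {f})"
      using f H by (intro L2_subspace_orth) auto
    show "X i \<in> L2_orth_in M (L2 M) {f}" if "i \<in> I" for i
      using * that X L2_inner_cnj[of M f "X i"] by (auto simp: L2_orth_in_def)
  qed
  then have "L2_inner M g f = 0" if "g \<in> L2_closed_span M X I" for g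
    using that L2_inner_cnj[of M g f] by (auto simp: L2_orth_in_def)
  then show "f \<in> L2_orth_in M H (L2_closed_span M X I)"
    using f by (simp add: L2_orth_in_def)
qed

section \<open>Unitary maps between subspaces of \<open>L\<^sup>2\<close>\<close>

lemma L2_unitaryI:
  assumes K: "L2_subspace N K"
    and "\<And>f. f \<in> H \<Longrightarrow> \<phi> f \<in> K"
    and "\<And>f g a b. f \<in> H \<Longrightarrow> g \<in> H \<Longrightarrow>
      AE y in N. \<phi> (\<lambda>x. a * f x + b * g x) y = a * \<phi> f y + b * \<phi> g y"
    and "\<And>f. f \<in> H \<Longrightarrow> L2_norm N (\<phi> f) = L2_norm M f"
    and "\<And>k. k \<in> K \<Longrightarrow> \<exists>f\<in>H. AE y in N. \<phi> f y = k y"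
  shows "L2_unitary M H N K \<phi>"
  unfolding L2_unitary_def
proof (intro conjI ballI allI)
  show "L2_image N \<phi> H = K"
    using assms(2,5) by (auto simp: L2_image_def intro: L2_subspaceD(1)[OF K] L2_subspace_cong_AE[OF K])
qed (use assms in \<open>auto simp flip: L2_norm_square\<close>)

lemma L2_unitaryD:
  assumes "L2_unitary M H N K \<phi>"
  shows "f \<in> H \<Longrightarrow> \<phi> f \<in> K" 
    "f \<in> H \<Longrightarrow> g \<in> H \<Longrightarrow> AE y in N. \<phi> (\<lambda>x. a * f x + b * g x) y = a * \<phi> f y + b * \<phi> g y"
    "f \<in> H \<Longrightarrow> L2_norm N (\<phi> f) = L2_norm M f"
    "k \<in> K \<Longrightarrow> \<exists>f\<in>H. AE y in N. \<phi> f y = k y"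
    "f \<in> H \<Longrightarrow> \<phi> f \<in> L2 N"
proof -
  have im: "L2_image N \<phi> H = K" using assms by (simp add: L2_unitary_def)
  then have "K \<subseteq> L2 N" by (auto simp: L2_image_def)
  then show "f \<in> H \<Longrightarrow> \<phi> f \<in> K" "f \<in> H \<Longrightarrow> \<phi> f \<in> L2 N"
    using assms by (auto simp: L2_unitary_def)
  show "k \<in> K \<Longrightarrow> \<exists>f\<in>H. AE y in N. \<phi> f y = k y" using im by (auto simp: L2_image_def)
qed (use assms in \<open>auto simp: L2_unitary_def L2_norm_def\<close>)

lemma L2_unitary_norm_diff:
  assumes \<phi>: "L2_unitary M H N K \<phi>" and H: "L2_subspace M H" and f: "f \<in> H" and g: "g \<in> H"
  shows "L2_norm N (\<lambda>y. \<phi> f y - \<phi> g y) = L2_norm M (\<lambda>x. f x - g x)"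
proof -
  have fg: "(\<lambda>x. f x - g x) \<in> H" by (rule L2_subspace_diff[OF H f g])
  have "AE y in N. \<phi> (\<lambda>x. f x - g x) y = \<phi> f y - \<phi> g y"
    using L2_unitaryD(2)[OF \<phi> f g, of 1 "-1"] by simp
  then have ae: "AE y in N. norm (\<phi> f y - \<phi> g y) = norm (\<phi> (\<lambda>x. f x - g x) y)"
    by eventually_elim simp
  have "L2_norm N (\<lambda>y. \<phi> f y - \<phi> g y) = L2_norm N (\<phi> (\<lambda>x. f x - g x))"
    using L2_unitaryD(5)[OF \<phi> f] L2_unitaryD(5)[OF \<phi> g] L2_unitaryD(5)[OF \<phi> fg]
    by (intro L2_norm_cong_AE ae L2_measurable L2_diff)
  also have "\<dots> = L2_norm M (\<lambda>x. f x - g x)"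
    by (rule L2_unitaryD(3)[OF \<phi> fg])
  finally show ?thesis .
qed

lemma AE_eq_if_L2_norm_diff_zero:
  assumes "f \<in> L2 M" "g \<in> L2 M" "L2_norm M (\<lambda>x. f x - g x) = 0"
  shows "AE x in M. f x = g x"
  using L2_norm_eq_0[OF L2_diff[OF assms(1,2)]] assms(3) by simp

lemma L2_norm_diff_zero_if_AE_eq:
  assumes "f \<in> L2 M" "g \<in> L2 M" "AE x in M. f x = g x"
  shows "L2_norm M (\<lambda>x. f x - g x) = 0"
  using L2_norm_eq_0[OF L2_diff[OF assms(1,2)]] assms(3) by simp

text \<open>Linear isometries preserve distances, and distance 0 is almost everywhere equality. This
  is what lets \<open>\<phi>\<close> act on classes of functions, and it is the device for replacing
  its argument on a null set.\<close>

lemma L2_unitary_AE_eq_iff: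
  assumes \<phi>: "L2_unitary M H N K \<phi>" and H: "L2_subspace M H" and f: "f \<in> H" and g: "g \<in> H"
  shows "(AE y in N. \<phi> f y = \<phi> g y) \<longleftrightarrow> (AE x in M. f x = g x)"
  using L2_unitary_norm_diff[OF assms] AE_eq_if_L2_norm_diff_zero L2_norm_diff_zero_if_AE_eq
    L2_unitaryD(5)[OF \<phi> f] L2_unitaryD(5)[OF \<phi> g] L2_subspaceD(1)[OF H f] L2_subspaceD(1)[OF H g]
  by metis

text \<open>Polarization: comparing the norms of \<open>f + b g\<close> and of its image determines
  \<open>Re (b * L2_inner M f g)\<close>; \<open>b = 1\<close> gives the real part of the inner
  product and \<open>b = \<i>\<close> the imaginary part.\<close>

lemma L2_unitary_inner:
  assumes \<phi>: "L2_unitary M H N K \<phi>" and H: "L2_subspace M H" and f: "f \<in> H" and g: "g \<in> H"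
  shows "L2_inner N (\<phi> f) (\<phi> g) = L2_inner M f g"
proof -
  have *: "Re (b * L2_inner N (\<phi> f) (\<phi> g)) = Re (b * L2_inner M f g)" for b
  proof -
    let ?h = "\<lambda>x. 1 * f x + b * g x"
    have h: "?h \<in> H" by (rule L2_subspaceD(3)[OF H f g])
    have "L2_norm N (\<lambda>y. 1 * \<phi> f y + b * \<phi> g y) = L2_norm N (\<phi> ?h)"
      using L2_unitaryD(2)[OF \<phi> f g, of 1 b]
      by (intro L2_norm_cong_AE L2_measurable L2_lin L2_unitaryD(5)[OF \<phi>] h f g) auto
    also have "\<dots> = L2_norm M ?h" by (rule L2_unitaryD(3)[OF \<phi> h])
    finally have "(L2_norm N (\<lambda>y. 1 * \<phi> f y + b * \<phi> g y))\<^sup>2 = (L2_norm M ?h)\<^sup>2" by simp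
    then show ?thesis
      unfolding L2_norm_lin[OF L2_unitaryD(5)[OF \<phi> f] L2_unitaryD(5)[OF \<phi> g]]
        L2_norm_lin[OF L2_subspaceD(1)[OF H f] L2_subspaceD(1)[OF H g]]
      by (simp add: L2_unitaryD(3)[OF \<phi>] f g)
  qed
  from *[of 1] *[of \<i>] show ?thesis by (simp add: complex_eq_iff)
qed

text \<open>The set on which the two maps agree is a closed subspace: near a limit point both maps
  move by the same small distance.\<close>

lemma L2_unitary_eq_on_span:
  assumes \<phi>: "L2_unitary M (L2_closed_span M X I) N K \<phi>"
    and \<phi>': "L2_unitary M (L2_closed_span M X I) N K' \<phi>'"
    and X: "\<And>i. i \<in> I \<Longrightarrow> X i \<in> L2 M"
    and eq: "\<And>i. i \<in> I \<Longrightarrow> AE y in N. \<phi> (X i) y = \<phi>' (X i) y"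
    and f: "f \<in> L2_closed_span M X I"
  shows "AE y in N. \<phi> f y = \<phi>' f y"
proof -
  let ?H = "L2_closed_span M X I"
  let ?S = "{f \<in> ?H. AE y in N. \<phi> f y = \<phi>' f y}"
  have H: "L2_subspace M ?H" by (rule L2_subspace_closed_span[OF X])
  have "L2_subspace M ?S"
    unfolding L2_subspace_def
  proof (intro conjI ballI allI impI CollectI; (elim CollectE conjE)?)
    show "?S \<subseteq> L2 M" using L2_subspaceD(1)[OF H] by auto
    show z: "(\<lambda>x. 0) \<in> ?H" by (rule L2_subspaceD(2)[OF H])
    show "AE y in N. \<phi> (\<lambda>x. 0) y = \<phi>' (\<lambda>x. 0) y"
      using L2_unitaryD(2)[OF \<phi> z z, of 0 0] L2_unitaryD(2)[OF \<phi>' z z, of 0 0]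
      by eventually_elim simp
  next
    fix f g a b assume f: "f \<in> ?H" "AE y in N. \<phi> f y = \<phi>' f y"
      and g: "g \<in> ?H" "AE y in N. \<phi> g y = \<phi>' g y"
    show "(\<lambda>x. a * f x + b * g x) \<in> ?H" by (rule L2_subspaceD(3)[OF H f(1) g(1)])
    show "AE y in N. \<phi> (\<lambda>x. a * f x + b * g x) y = \<phi>' (\<lambda>x. a * f x + b * g x) y"
      using L2_unitaryD(2)[OF \<phi> f(1) g(1), of a b] L2_unitaryD(2)[OF \<phi>' f(1) g(1), of a b] f(2) g(2)
      by eventually_elim simp
  next
    fix f assume f: "f \<in> L2 M" and *: "\<forall>e>0. \<exists>g\<in>?S. L2_norm M (\<lambda>x. f x - g x) < e"
    show fH: "f \<in> ?H" by (rule L2_subspaceD(4)[OF H f]) (use * in blast)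
    have "L2_norm N (\<lambda>y. \<phi> f y - \<phi>' f y) \<le> 2 * e" if e: "e > 0" for e
    proof -
      obtain g where g: "g \<in> ?H" "AE y in N. \<phi> g y = \<phi>' g y" "L2_norm M (\<lambda>x. f x - g x) < e"
        using *[rule_format, OF e] by auto
      have m: "\<phi> f \<in> L2 N" "\<phi>' f \<in> L2 N" "\<phi> g \<in> L2 N" "\<phi>' g \<in> L2 N"
        using L2_unitaryD(5)[OF \<phi>] L2_unitaryD(5)[OF \<phi>'] fH g by auto
      have "L2_norm N (\<lambda>y. \<phi> f y - \<phi>' f y) \<le> L2_norm N (\<lambda>y. \<phi> f y - \<phi> g y)
         + (L2_norm N (\<lambda>y. \<phi> g y - \<phi>' g y) + L2_norm N (\<lambda>y. \<phi>' g y - \<phi>' f y))"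
        using L2_norm_triangle_sub[OF m(1) m(3) m(2)] L2_norm_triangle_sub[OF m(3) m(4) m(2)] by simp
      also have "\<dots> \<le> 2 * e"
        using L2_unitary_norm_diff[OF \<phi> H fH g(1)] L2_unitary_norm_diff[OF \<phi>' H g(1) fH]
          L2_norm_diff_zero_if_AE_eq[OF m(3,4) g(2)] g(3) L2_norm_minus_commute[of M f g] by simp
      finally show ?thesis .
    qed
    then have "L2_norm N (\<lambda>y. \<phi> f y - \<phi>' f y) = 0"
      using small_multiples_imp_zero L2_norm_nonneg by metis
    then show "AE y in N. \<phi> f y = \<phi>' f y"
      using L2_unitaryD(5)[OF \<phi> fH] L2_unitaryD(5)[OF \<phi>' fH] by (intro AE_eq_if_L2_norm_diff_zero)
  qed
  then have "?H \<subseteq> ?S"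
    by (rule L2_closed_span_least) (use X eq in \<open>auto intro: L2_closed_span_superset\<close>)
  then show ?thesis using f by blast
qed

lemma L2_unitary_compose:
  assumes U: "L2_unitary M G M' H U" and \<phi>: "L2_unitary M' H N K \<phi>"
    and G: "L2_subspace M G" and H: "L2_subspace M' H" and K: "L2_subspace N K"
  shows "L2_unitary M G N K (\<lambda>f. \<phi> (U f))"
proof (rule L2_unitaryI[OF K])
  fix f g a b assume f: "f \<in> G" and g: "g \<in> G"
  let ?h = "\<lambda>x. a * f x + b * g x"
  have "?h \<in> G" by (rule L2_subspaceD(3)[OF G f g])
  moreover have "AE x in M'. U ?h x = a * U f x + b * U g x" by (rule L2_unitaryD(2)[OF U f g])
  \<comment> \<open>\<open>U\<close> is linear only up to null sets, so the argument of
    \<open>\<phi>\<close> changes on a null set before linearity of \<open>\<phi>\<close>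
    applies.\<close>
  ultimately have "AE y in N. \<phi> (U ?h) y = \<phi> (\<lambda>x. a * U f x + b * U g x) y"
    using f g by (subst L2_unitary_AE_eq_iff[OF \<phi> H]) (auto intro!: L2_unitaryD(1)[OF U] L2_subspaceD(3)[OF H])
  then show "AE y in N. \<phi> (U ?h) y = a * \<phi> (U f) y + b * \<phi> (U g) y"
    using L2_unitaryD(2)[OF \<phi> L2_unitaryD(1)[OF U f] L2_unitaryD(1)[OF U g], of a b]
    by eventually_elim simp
next
  fix k assume "k \<in> K"
  then obtain f where f: "f \<in> H" "AE y in N. \<phi> f y = k y" using L2_unitaryD(4)[OF \<phi>] by blast
  obtain g where g: "g \<in> G" "AE x in M'. U g x = f x" using L2_unitaryD(4)[OF U f(1)] by blast
  have "AE y in N. \<phi> (U g) y = \<phi> f y"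
    using g f L2_unitaryD(1)[OF U g(1)] by (subst L2_unitary_AE_eq_iff[OF \<phi> H]) auto
  then have "AE y in N. \<phi> (U g) y = k y" using f(2) by eventually_elim simp
  then show "\<exists>f\<in>G. AE y in N. \<phi> (U f) y = k y" using g by blast
qed (auto simp: L2_unitaryD(1,3)[OF U] L2_unitaryD(1,3)[OF \<phi>])

lemma L2_unitary_unimodular_mult:
  assumes \<phi>: "L2_unitary M H N (L2 N) \<phi>"
    and h[measurable]: "h \<in> borel_measurable N" and h1: "AE y in N. norm (h y) = 1"
  shows "L2_unitary M H N (L2 N) (\<lambda>f y. h y * \<phi> f y)"
proof (rule L2_unitaryI[OF L2_subspace_L2])
  fix f assume f: "f \<in> H"
  then have m: "\<phi> f \<in> L2 N" by (rule L2_unitaryD(5)[OF \<phi>])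
  then show m': "(\<lambda>y. h y * \<phi> f y) \<in> L2 N" by (rule L2_unimodular_mult[OF _ h h1])
  have "AE y in N. norm (h y * \<phi> f y) = norm (\<phi> f y)"
    using h1 by eventually_elim (simp add: norm_mult)
  then show "L2_norm N (\<lambda>y. h y * \<phi> f y) = L2_norm M f"
    unfolding L2_unitaryD(3)[OF \<phi> f, symmetric] by (intro L2_norm_cong_AE L2_measurable m m')
next
  fix f g a b assume f: "f \<in> H" and g: "g \<in> H"
  show "AE y in N. h y * \<phi> (\<lambda>x. a * f x + b * g x) y = a * (h y * \<phi> f y) + b * (h y * \<phi> g y)"
    using L2_unitaryD(2)[OF \<phi> f g, of a b] by eventually_elim (simp add: algebra_simps)
next
  fix k assume "k \<in> L2 N"
  moreover have "AE y in N. norm (cnj (h y)) = 1" using h1 by simp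
  ultimately have "(\<lambda>y. cnj (h y) * k y) \<in> L2 N" by (intro L2_unimodular_mult) measurable
  then obtain f where "f \<in> H" "AE y in N. \<phi> f y = cnj (h y) * k y"
    using L2_unitaryD(4)[OF \<phi>] by blast
  moreover from this(2) h1 have "AE y in N. h y * \<phi> f y = k y"
    by eventually_elim (simp add: complex_norm_square[symmetric] mult.assoc[symmetric])
  ultimately show "\<exists>f\<in>H. AE y in N. h y * \<phi> f y = k y" by blast
qed

text \<open>Inner products with the generators are preserved, and surjectivity supplies a preimage
  for every candidate on the right. With the future and with the past as index set it gives the
  conditions on the incoming and the outgoing space.\<close>

lemma L2_image_orth_closed_span:
  assumes \<phi>: "L2_unitary M H N (L2 N) \<phi>" and H: "L2_subspace M H"
    and X: "\<And>i. i \<in> I \<Longrightarrow> X i \<in> H" and Y: "\<And>i. i \<in> I \<Longrightarrow> Y i \<in> L2 N"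
    and eq: "\<And>i. i \<in> I \<Longrightarrow> AE y in N. \<phi> (X i) y = Y i y"
  shows "L2_image N \<phi> (L2_orth_in M H (L2_closed_span M X I)) =
    L2_orth_in N (L2 N) (L2_closed_span N Y I)"
proof -
  have inner: "L2_inner M (X i) f = L2_inner N (Y i) k"
    if "i \<in> I" "f \<in> H" "k \<in> L2 N" "AE y in N. \<phi> f y = k y" for i f k
    unfolding L2_unitary_inner[OF \<phi> H X[OF that(1)] that(2), symmetric]
    using that X Y eq L2_unitaryD(5)[OF \<phi>] by (intro L2_inner_cong_AE) auto
  have "L2_orth_in M H (L2_closed_span M X I) = {f \<in> H. \<forall>i\<in>I. L2_inner M (X i) f = 0}"
    using L2_subspaceD(1)[OF H] X by (intro L2_orth_closed_span) auto
  moreover have "L2_orth_in N (L2 N) (L2_closed_span N Y I) = {f \<in> L2 N. \<forall>i\<in>I. L2_inner N (Y i) f = 0}"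
    using Y by (intro L2_orth_closed_span) auto
  moreover have "L2_image N \<phi> {f \<in> H. \<forall>i\<in>I. L2_inner M (X i) f = 0} =
      {f \<in> L2 N. \<forall>i\<in>I. L2_inner N (Y i) f = 0}"
  proof (safe)
    fix k assume k: "k \<in> L2_image N \<phi> {f \<in> H. \<forall>i\<in>I. L2_inner M (X i) f = 0}"
    then show "k \<in> L2 N" by (simp add: L2_image_def)
    fix i assume "i \<in> I"
    then show "L2_inner N (Y i) k = 0" using k inner by (auto simp: L2_image_def)
  next
    fix k assume k: "k \<in> L2 N" "\<forall>i\<in>I. L2_inner N (Y i) k = 0"
    obtain f where "f \<in> H" "AE y in N. \<phi> f y = k y" using L2_unitaryD(4)[OF \<phi> k(1)] by blast
    then show "k \<in> L2_image N \<phi> {f \<in> H. \<forall>i\<in>I. L2_inner M (X i) f = 0}"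
      using k inner by (auto simp: L2_image_def intro!: bexI[of _ f])
  qed
  ultimately show ?thesis by simp
qed

section \<open>Isometries determined by equality of Gram matrices\<close>

lemma L2_inner_sum_right:
  assumes h: "h \<in> L2 M" and X: "\<And>i. i \<in> F \<Longrightarrow> X i \<in> L2 M"
  shows "L2_inner M h (\<lambda>x. \<Sum>i\<in>F. a i * X i x) = (\<Sum>i\<in>F. a i * L2_inner M h (X i))"
  using X
proof (induction F rule: infinite_finite_induct)
  case (insert i F)
  then show ?case
    using L2_inner_lin_right[OF h, of "X i" "\<lambda>x. \<Sum>i\<in>F. a i * X i x" "a i" 1]
    by (simp add: L2_sum)
qed (auto simp: L2_inner_def)

lemma L2_norm_sum_cong:
  assumes X: "\<And>i. X i \<in> L2 M" and Y: "\<And>i. Y i \<in> L2 N"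
    and gram: "\<And>i j. L2_inner M (X i) (X j) = L2_inner N (Y i) (Y j)"
  shows "L2_norm M (\<lambda>x. \<Sum>i\<in>F. a i * X i x) = L2_norm N (\<lambda>x. \<Sum>i\<in>F. a i * Y i x)"
proof -
  have *: "L2_inner M' (\<lambda>x. \<Sum>i\<in>F. a i * Z i x) (\<lambda>x. \<Sum>i\<in>F. a i * Z i x) =
      (\<Sum>i\<in>F. a i * cnj (\<Sum>j\<in>F. a j * L2_inner M' (Z i) (Z j)))"
    if Z: "\<And>i. Z i \<in> L2 M'" for M' :: "'d measure" and Z
    by (simp add: L2_inner_sum_right Z L2_sum L2_inner_cnj[of _ "\<lambda>x. \<Sum>i\<in>F. a i * Z i x" "Z _"] del: cnj_sum)
  have "(L2_norm M (\<lambda>x. \<Sum>i\<in>F. a i * X i x))\<^sup>2 = (L2_norm N (\<lambda>x. \<Sum>i\<in>F. a i * Y i x))\<^sup>2"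
    unfolding of_real_eq_iff[where 'a = complex, symmetric] L2_inner_self[symmetric]
    by (simp only: *[OF X] *[OF Y] gram)
  then show ?thesis by (rule power2_eq_imp_eq) (rule L2_norm_nonneg)+
qed

text \<open>The closure of the graph of \<open>\<Sum> a i * X i \<mapsto> \<Sum> a i * Y i\<close>.
  The relation is symmetric in the two families, so a statement about the map is also one about its
  inverse.\<close>

definition L2_span_graph where
  "L2_span_graph M X N Y f g \<longleftrightarrow> f \<in> L2 M \<and> g \<in> L2 N \<and> (\<forall>e>0. \<exists>F a. finite F \<and>
     L2_norm M (\<lambda>x. f x - (\<Sum>i\<in>F. a i * X i x)) < e \<and>
     L2_norm N (\<lambda>x. g x - (\<Sum>i\<in>F. a i * Y i x)) < e)"

lemma L2_span_graph_sym: "L2_span_graph M X N Y f g \<longleftrightarrow> L2_span_graph N Y M X g f"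
  unfolding L2_span_graph_def by (simp only: conj_ac)

lemma L2_span_graphD:
  assumes "L2_span_graph M X N Y f g" "e > 0"
  obtains F a where "finite F" "L2_norm M (\<lambda>x. f x - (\<Sum>i\<in>F. a i * X i x)) < e"
     "L2_norm N (\<lambda>x. g x - (\<Sum>i\<in>F. a i * Y i x)) < e"
  using assms by (auto simp: L2_span_graph_def)

lemma L2_span_graph_span: "L2_span_graph M X N Y f g \<Longrightarrow> f \<in> L2_closed_span M X UNIV"
  unfolding L2_closed_span_iff
  by (intro conjI allI impI, simp add: L2_span_graph_def, elim L2_span_graphD) auto

lemma L2_span_graph_lin:
  assumes X: "\<And>i. X i \<in> L2 M" and Y: "\<And>i. Y i \<in> L2 N"
    and f: "L2_span_graph M X N Y f f'" and g: "L2_span_graph M X N Y g g'"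
  shows "L2_span_graph M X N Y (\<lambda>x. a * f x + b * g x) (\<lambda>x. a * f' x + b * g' x)"
  unfolding L2_span_graph_def
proof (intro conjI allI impI)
  show "(\<lambda>x. a * f x + b * g x) \<in> L2 M" "(\<lambda>x. a * f' x + b * g' x) \<in> L2 N"
    using f g by (auto simp: L2_span_graph_def intro!: L2_lin)
  fix e :: real assume e: "e > 0"
  let ?K = "norm a + norm b + 1"
  have K: "?K > 0" using norm_ge_zero[of a] norm_ge_zero[of b] by linarith
  then have eK: "e / ?K > 0" using e by simp
  obtain F p where F: "finite F" "L2_norm M (\<lambda>x. f x - (\<Sum>i\<in>F. p i * X i x)) < e / ?K"
      "L2_norm N (\<lambda>x. f' x - (\<Sum>i\<in>F. p i * Y i x)) < e / ?K"
    using L2_span_graphD[OF f eK] .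
  obtain G q where G: "finite G" "L2_norm M (\<lambda>x. g x - (\<Sum>i\<in>G. q i * X i x)) < e / ?K"
      "L2_norm N (\<lambda>x. g' x - (\<Sum>i\<in>G. q i * Y i x)) < e / ?K"
    using L2_span_graphD[OF g eK] .
  have "L2_norm M (\<lambda>x. (a * f x + b * g x) -
        (a * (\<Sum>i\<in>F. p i * X i x) + b * (\<Sum>i\<in>G. q i * X i x))) < e"
      using f g F G e X by (intro L2_norm_lin_diff_less L2_sum) (auto simp: L2_span_graph_def)
  moreover have "L2_norm N (\<lambda>x. (a * f' x + b * g' x) -
        (a * (\<Sum>i\<in>F. p i * Y i x) + b * (\<Sum>i\<in>G. q i * Y i x))) < e"
      using f g F G e Y by (intro L2_norm_lin_diff_less L2_sum) (auto simp: L2_span_graph_def)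
  ultimately show "\<exists>F a'. finite F \<and>
      L2_norm M (\<lambda>x. a * f x + b * g x - (\<Sum>i\<in>F. a' i * X i x)) < e \<and>
      L2_norm N (\<lambda>x. a * f' x + b * g' x - (\<Sum>i\<in>F. a' i * Y i x)) < e"
    unfolding sum_merge[OF F(1) G(1)]
    using F(1) G(1)
    by (intro exI[of _ "F \<union> G"] conjI
        exI[of _ "\<lambda>i. a * (if i \<in> F then p i else 0) + b * (if i \<in> G then q i else 0)"]) auto
qed

lemma L2_span_graph_norm:
  assumes X: "\<And>i. X i \<in> L2 M" and Y: "\<And>i. Y i \<in> L2 N"
    and gram: "\<And>i j. L2_inner M (X i) (X j) = L2_inner N (Y i) (Y j)"
    and f: "L2_span_graph M X N Y f g"
  shows "L2_norm N g = L2_norm M f"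
proof -
  have "\<bar>L2_norm N g - L2_norm M f\<bar> \<le> 2 * e" if e: "e > 0" for e
  proof -
    obtain F a where F: "finite F" "L2_norm M (\<lambda>x. f x - (\<Sum>i\<in>F. a i * X i x)) < e"
        "L2_norm N (\<lambda>x. g x - (\<Sum>i\<in>F. a i * Y i x)) < e"
      using L2_span_graphD[OF f e] .
    have "\<bar>L2_norm M f - L2_norm M (\<lambda>x. \<Sum>i\<in>F. a i * X i x)\<bar> \<le> L2_norm M (\<lambda>x. f x - (\<Sum>i\<in>F. a i * X i x))"
      "\<bar>L2_norm N g - L2_norm N (\<lambda>x. \<Sum>i\<in>F. a i * Y i x)\<bar> \<le> L2_norm N (\<lambda>x. g x - (\<Sum>i\<in>F. a i * Y i x))"
      using f X Y by (auto intro!: L2_norm_diff_bound L2_sum simp: L2_span_graph_def)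
    then show ?thesis
      using F L2_norm_sum_cong[where X = X and Y = Y and F = F and a = a, OF X Y gram] by linarith
  qed
  then show ?thesis using small_multiples_imp_zero[of "\<bar>L2_norm N g - L2_norm M f\<bar>" 2] by simp
qed

text \<open>The difference of two pairs over the same \<open>f\<close> is a pair with first entry 0,
  and pairs in the graph have equal norms.\<close>

lemma L2_span_graph_unique:
  assumes X: "\<And>i. X i \<in> L2 M" and Y: "\<And>i. Y i \<in> L2 N"
    and gram: "\<And>i j. L2_inner M (X i) (X j) = L2_inner N (Y i) (Y j)"
    and g: "L2_span_graph M X N Y f g" "L2_span_graph M X N Y f g'"
  shows "AE y in N. g y = g' y"
proof (rule AE_eq_if_L2_norm_diff_zero)
  show "g \<in> L2 N" "g' \<in> L2 N" using g by (auto simp: L2_span_graph_def)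
  show "L2_norm N (\<lambda>y. g y - g' y) = 0"
    using L2_span_graph_norm[OF X Y gram L2_span_graph_lin[OF X Y g, of 1 "-1"]]
    by (simp add: L2_norm_def)
qed

text \<open>Approximants of \<open>f\<close> have differences that are again finite combinations.
  Equality of the Gram matrices carries the Cauchy property over to the combinations of
  \<open>Y\<close> with the same coefficients, and completeness supplies \<open>g\<close>.\<close>

lemma L2_span_graph_exists:
  assumes X: "\<And>i. X i \<in> L2 M" and Y: "\<And>i. Y i \<in> L2 N" and fin: "finite_measure N"
    and gram: "\<And>i j. L2_inner M (X i) (X j) = L2_inner N (Y i) (Y j)"
    and f: "f \<in> L2_closed_span M X UNIV"
  obtains g where "L2_span_graph M X N Y f g"
proof -
  have fL: "f \<in> L2 M" using f by (simp add: L2_closed_span_iff)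
  have "\<exists>F a. finite F \<and> L2_norm M (\<lambda>x. f x - (\<Sum>i\<in>F. a i * X i x)) < inverse (real (Suc n))" for n
    using f[unfolded L2_closed_span_iff, THEN conjunct2, rule_format, of "inverse (real (Suc n))"] by auto
  from choice[OF allI[OF this]] obtain F where
    "\<forall>n. \<exists>a. finite (F n) \<and> L2_norm M (\<lambda>x. f x - (\<Sum>i\<in>F n. a i * X i x)) < inverse (real (Suc n))" ..
  from choice[OF this] obtain a where
    "\<forall>n. finite (F n) \<and> L2_norm M (\<lambda>x. f x - (\<Sum>i\<in>F n. a n i * X i x)) < inverse (real (Suc n))" ..
  then have F: "\<And>n. finite (F n)"
      "\<And>n. L2_norm M (\<lambda>x. f x - (\<Sum>i\<in>F n. a n i * X i x)) < inverse (real (Suc n))"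
    by auto
  let ?P = "\<lambda>n x. \<Sum>i\<in>F n. a n i * X i x" and ?Q = "\<lambda>n x. \<Sum>i\<in>F n. a n i * Y i x"
  have P: "?P n \<in> L2 M" and Q: "?Q n \<in> L2 N" for n using X Y by (auto intro: L2_sum)
  have PQ: "L2_norm N (\<lambda>x. ?Q n x - ?Q m x) = L2_norm M (\<lambda>x. ?P n x - ?P m x)" for n m
    using sum_merge[OF F(1)[of n] F(1)[of m], of 1 "a n" X _ "-1" "a m"]
      sum_merge[OF F(1)[of n] F(1)[of m], of 1 "a n" Y _ "-1" "a m"]
    by (simp add: L2_norm_sum_cong[OF X Y gram])
  have "\<exists>N0. \<forall>i\<ge>N0. \<forall>j\<ge>N0. L2_norm N (\<lambda>x. ?Q i x - ?Q j x) < e" if e: "e > 0" for e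
  proof -
    obtain N0 where N0: "inverse (real (Suc N0)) < e / 2"
      using reals_Archimedean[of "e / 2"] e by (auto simp del: of_nat_Suc)
    have small: "L2_norm M (\<lambda>x. f x - ?P i x) < e / 2" if "i \<ge> N0" for i
    proof -
      have "inverse (real (Suc i)) \<le> inverse (real (Suc N0))" using that by (intro le_imp_inverse_le) auto
      then show ?thesis using F(2)[of i] N0 by linarith
    qed
    have "L2_norm N (\<lambda>x. ?Q i x - ?Q j x) < e" if "i \<ge> N0" "j \<ge> N0" for i j
      unfolding PQ using L2_norm_triangle_sub[OF P fL P, of i j] small[OF that(1)] small[OF that(2)]
        L2_norm_minus_commute[of M "?P i" f] by linarith
    then show ?thesis by blast
  qed
  from L2_complete[of N ?Q, OF fin Q this]
  obtain g where g: "g \<in> L2 N" "(\<lambda>n. L2_norm N (\<lambda>x. ?Q n x - g x)) \<longlonglongrightarrow> 0" by blast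
  have "L2_span_graph M X N Y f g"
    unfolding L2_span_graph_def
  proof (intro conjI allI impI fL g)
    fix e :: real assume e: "e > 0"
    have "\<forall>\<^sub>F n in sequentially. L2_norm N (\<lambda>x. ?Q n x - g x) < e"
      using order_tendstoD(2)[OF g(2) e] .
    moreover have "\<forall>\<^sub>F n in sequentially. inverse (real (Suc n)) < e"
      using order_tendstoD(2)[OF LIMSEQ_inverse_real_of_nat e] .
    ultimately have "\<forall>\<^sub>F n in sequentially. L2_norm N (\<lambda>x. ?Q n x - g x) < e \<and> inverse (real (Suc n)) < e"
      by eventually_elim simp
    then obtain n where "L2_norm N (\<lambda>x. ?Q n x - g x) < e" "inverse (real (Suc n)) < e"
      by (auto simp: eventually_sequentially)
    then show "\<exists>F a. finite F \<and> L2_norm M (\<lambda>x. f x - (\<Sum>i\<in>F. a i * X i x)) < e \<and>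
        L2_norm N (\<lambda>x. g x - (\<Sum>i\<in>F. a i * Y i x)) < e"
      using F(1)[of n] F(2)[of n] L2_norm_minus_commute[of N g "?Q n"]
      by (intro exI[of _ "F n"] exI[of _ "a n"] conjI; (assumption | linarith))
  qed
  then show ?thesis by (rule that)
qed

lemma L2_unitary_extension:
  assumes X: "\<And>i. X i \<in> L2 M" and Y: "\<And>i. Y i \<in> L2 N"
    and fin: "finite_measure M" "finite_measure N"
    and gram: "\<And>i j. L2_inner M (X i) (X j) = L2_inner N (Y i) (Y j)"
  obtains \<phi> where "L2_unitary M (L2_closed_span M X UNIV) N (L2_closed_span N Y UNIV) \<phi>"
    "\<And>i. AE y in N. \<phi> (X i) y = Y i y"
proof -
  define \<phi> where "\<phi> f = (SOME g. L2_span_graph M X N Y f g)" for f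
  note unique = L2_span_graph_unique[OF X Y gram]
  have \<phi>: "L2_span_graph M X N Y f (\<phi> f)" if f: "f \<in> L2_closed_span M X UNIV" for f
  proof -
    obtain g where "L2_span_graph M X N Y f g"
      by (rule L2_span_graph_exists[OF X Y fin(2) gram f])
    then show ?thesis unfolding \<phi>_def by (rule someI[of "L2_span_graph M X N Y f"])
  qed
  have H: "L2_subspace M (L2_closed_span M X UNIV)" by (rule L2_subspace_closed_span[OF X])
  have "L2_unitary M (L2_closed_span M X UNIV) N (L2_closed_span N Y UNIV) \<phi>"
  proof (rule L2_unitaryI)
    show "L2_subspace N (L2_closed_span N Y UNIV)" by (rule L2_subspace_closed_span[OF Y])
  next
    fix f assume f: "f \<in> L2_closed_span M X UNIV"
    show "\<phi> f \<in> L2_closed_span N Y UNIV"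
      by (rule L2_span_graph_span[OF L2_span_graph_sym[THEN iffD1, OF \<phi>[OF f]]])
    show "L2_norm N (\<phi> f) = L2_norm M f"
      by (rule L2_span_graph_norm[OF X Y gram \<phi>[OF f]])
  next
    fix f g a b assume f: "f \<in> L2_closed_span M X UNIV" and g: "g \<in> L2_closed_span M X UNIV"
    show "AE y in N. \<phi> (\<lambda>x. a * f x + b * g x) y = a * \<phi> f y + b * \<phi> g y"
      by (rule unique[OF \<phi>[OF L2_subspaceD(3)[OF H f g]] L2_span_graph_lin[OF X Y \<phi>[OF f] \<phi>[OF g]]])
  next
    \<comment> \<open>Surjectivity: existence is applied with the two families exchanged, and the
      graph is read backwards.\<close>
    fix k assume "k \<in> L2_closed_span N Y UNIV"
    then obtain f where "L2_span_graph N Y M X k f"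
      by (rule L2_span_graph_exists[OF Y X fin(1) gram[symmetric]])
    then have f: "L2_span_graph M X N Y f k" by (rule L2_span_graph_sym[THEN iffD1])
    then show "\<exists>f\<in>L2_closed_span M X UNIV. AE y in N. \<phi> f y = k y"
      using unique[OF \<phi> f] L2_span_graph_span[OF f] by blast
  qed
  moreover have "AE y in N. \<phi> (X i) y = Y i y" for i
  proof (rule unique[OF \<phi>])
    show "X i \<in> L2_closed_span M X UNIV" using X by (intro L2_closed_span_superset) auto
    show "L2_span_graph M X N Y (X i) (Y i)"
      using X Y by (auto simp: L2_span_graph_def L2_norm_def intro!: exI[of _ "{i}"] exI[of _ "\<lambda>_. 1"])
  qed
  ultimately show ?thesis by (rule that)
qed

section \<open>Trigonometric polynomials on the circle\<close>

lemma cis_measurable_sphere: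
  "cis \<in> measurable borel (restrict_space borel (sphere 0 1))"
  by (intro measurable_restrict_space2 borel_measurable_continuous_onI continuous_intros) auto

lemma space_circle [simp]: "space circle_measure = sphere 0 1"
  by (simp add: circle_measure_def space_restrict_space)

lemma sets_circle [measurable_cong]: "sets circle_measure = sets (restrict_space borel (sphere 0 1))"
  by (simp add: circle_measure_def)

lemma prob_space_circle: "prob_space circle_measure"
  unfolding circle_measure_def
proof (rule prob_space.prob_space_distr)
  show "prob_space (uniform_measure lborel {0..<2 * pi :: real})"
    by (rule prob_space_uniform_measure) auto
  show "cis \<in> measurable (uniform_measure lborel {0..<2 * pi}) (restrict_space borel (sphere 0 1))"
    using cis_measurable_sphere by simp
qed

interpretation circle: prob_space circle_measure
  by (rule prob_space_circle)

lemma borel_measurable_circle: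
  assumes "f \<in> borel_measurable borel" shows "f \<in> borel_measurable circle_measure"
  using measurable_restrict_space1[OF assms] by (simp add: measurable_cong_sets[OF sets_circle])

lemma circle_ident_measurable [measurable]: "(\<lambda>z. z) \<in> borel_measurable circle_measure"
  by (rule borel_measurable_circle) simp

lemma AE_circle: "(\<And>z. norm z = 1 \<Longrightarrow> P z) \<Longrightarrow> AE z in circle_measure. P z"
  by (rule AE_I2) simp

lemma L2_circle_bounded:
  assumes "f \<in> borel_measurable circle_measure" "\<And>z. norm z = 1 \<Longrightarrow> norm (f z) \<le> B"
  shows "f \<in> L2 circle_measure"
proof -
  have "(\<lambda>z. f z * 1) \<in> L2 circle_measure"
    using assms by (intro L2_bounded_mult[where B = B] AE_circle) (auto simp: L2_def)
  then show ?thesis by simp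
qed

text \<open>The exponent comes first so that \<open>zpow\<close> is a family of functions indexed by
  the integers, as closed spans expect.\<close>

definition zpow :: "int \<Rightarrow> complex \<Rightarrow> complex" where
  "zpow n z = z powi n"

lemma norm_zpow: "norm z = 1 \<Longrightarrow> norm (zpow n z) = 1"
  by (simp add: zpow_def norm_power_int)

lemma zpow_add: "norm z = 1 \<Longrightarrow> zpow (m + n) z = zpow m z * zpow n z"
  by (subgoal_tac "z \<noteq> 0") (auto simp: zpow_def power_int_add)

lemma zpow_simps [simp]: "zpow 0 z = 1" "zpow 1 z = z"
  by (auto simp: zpow_def)

lemma zpow_of_nat: "zpow (int n) z = z ^ n"
  by (simp add: zpow_def)

lemma cnj_unit: "norm z = 1 \<Longrightarrow> cnj z = inverse z"
  by (simp add: inverse_complex_def complex_eq_iff cmod_def)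

lemma cnj_zpow: "norm z = 1 \<Longrightarrow> cnj (zpow n z) = zpow (- n) z"
  by (simp add: zpow_def cnj_unit power_int_inverse power_int_minus)

lemma zpow_measurable [measurable]: "zpow n \<in> borel_measurable circle_measure"
proof -
  have "(\<lambda>z. z powi n) \<in> borel_measurable circle_measure"
    unfolding power_int_def by measurable
  then show ?thesis unfolding zpow_def[abs_def] .
qed

lemma zpow_L2: "zpow n \<in> L2 circle_measure"
  by (rule L2_circle_bounded[where B = 1]) (auto simp: norm_zpow)

lemma zpow_mult_L2: "f \<in> L2 circle_measure \<Longrightarrow> (\<lambda>z. zpow n z * f z) \<in> L2 circle_measure"
  by (rule L2_bounded_mult[where B = 1]) (auto intro!: AE_circle simp: norm_zpow)

lemma integral_circle:
  assumes f: "f \<in> borel_measurable borel"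
  shows "(LINT z|circle_measure. f z) = (1 / (2 * pi)) *\<^sub>R (LINT x|lborel. indicator {0..<2 * pi} x *\<^sub>R (f (cis x) :: complex))"
proof -
  have m: "(\<lambda>x. f (cis x)) \<in> borel_measurable borel"
    using f by (intro measurable_compose[OF _ f] borel_measurable_continuous_onI continuous_intros)
  have u: "uniform_measure lborel {0..<2 * pi} = density lborel (\<lambda>x::real. ennreal (indicator {0..<2 * pi} x / (2 * pi)))"
    unfolding uniform_measure_def
    by (intro arg_cong2[where f = density] refl ext) (auto simp: indicator_def divide_ennreal[symmetric])
  have "(LINT z|circle_measure. f z) = (LINT x|uniform_measure lborel {0..<2 * pi}. f (cis x))"
    unfolding circle_measure_def
    using cis_measurable_sphere measurable_restrict_space1[OF f] by (intro integral_distr) auto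
  also have "\<dots> = (LINT x|lborel. (indicator {0..<2 * pi} x / (2 * pi)) *\<^sub>R f (cis x))"
    unfolding u using m by (intro integral_density) auto
  also have "\<dots> = (1 / (2 * pi)) *\<^sub>R (LINT x|lborel. indicator {0..<2 * pi} x *\<^sub>R f (cis x))"
    unfolding integral_scaleR_right[symmetric] by (simp add: scaleR_scaleR mult.commute)
  finally show ?thesis .
qed

lemma integral_zpow: "(LINT z|circle_measure. zpow n z) = (if n = 0 then 1 else 0)"
proof (cases "n = 0")
  case True
  then show ?thesis by (simp add: circle.prob_space[simplified])
next
  case False
  have m: "zpow n \<in> borel_measurable borel"
    unfolding zpow_def[abs_def] power_int_def by measurable
  \<comment> \<open>Adding the endpoint, a null set, gives the closed interval required by the
    fundamental theorem of calculus.\<close>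
  have "(LINT x|lborel. indicator {0..<2 * pi} x *\<^sub>R zpow n (cis x)) =
      (LINT x|lborel. indicator {0..2 * pi} x *\<^sub>R cis (of_int n * x))"
  proof (rule integral_cong_AE)
    have "AE x in lborel. x \<noteq> 2 * pi" by (rule AE_lborel_singleton)
    then show "AE x in lborel. indicator {0..<2 * pi} x *\<^sub>R zpow n (cis x) =
        indicator {0..2 * pi} x *\<^sub>R cis (of_int n * x)"
      by eventually_elim (auto simp: indicator_def zpow_def cis_power_int)
    show "(\<lambda>x. indicator {0..<2 * pi} x *\<^sub>R zpow n (cis x)) \<in> borel_measurable lborel"
      using measurable_compose[OF borel_measurable_continuous_onI m, OF continuous_on_cis[OF continuous_on_id]]
      by simp
    have [measurable]: "(\<lambda>x. cis (of_int n * x)) \<in> borel_measurable borel"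
      by (intro borel_measurable_continuous_onI continuous_intros)
    show "(\<lambda>x. indicator {0..2 * pi} x *\<^sub>R cis (of_int n * x)) \<in> borel_measurable lborel"
      by simp
  qed
  also have "\<dots> = cis (of_int n * (2 * pi)) / (\<i> * of_int n) - cis (of_int n * 0) / (\<i> * of_int n)"
  proof (rule integral_FTC_atLeastAtMost)
    show "continuous_on {0..2 * pi} (\<lambda>x. cis (of_int n * x))" by (intro continuous_intros)
    fix x :: real
    have "((\<lambda>x. exp (\<i> * of_real (of_int n * x)) / (\<i> * of_int n)) has_vector_derivative
        exp (\<i> * of_real (of_int n * x))) (at x within {0..2 * pi})"
      using False by (auto intro!: derivative_eq_intros has_vector_derivative_real_field simp: field_simps)
    then show "((\<lambda>x. cis (of_int n * x) / (\<i> * of_int n)) has_vector_derivative cis (of_int n * x)) (at x within {0..2 * pi})"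
      by (simp add: cis_conv_exp)
  qed simp
  also have "\<dots> = 0" using cis_multiple_2pi[of "of_int n"] by (simp add: mult.commute)
  finally show ?thesis using False m by (subst integral_circle) auto
qed

lemma inner_zpow: "L2_inner circle_measure (zpow n) (zpow m) = (if n = m then 1 else 0)"
proof -
  have "L2_inner circle_measure (zpow n) (zpow m) = (LINT z|circle_measure. zpow (m - n) z)"
    unfolding L2_inner_def
    by (intro Bochner_Integration.integral_cong) (auto simp: cnj_zpow zpow_add[symmetric])
  then show ?thesis by (auto simp: integral_zpow)
qed

lemma fourier_coeff_eq_inner: "fourier_coeff f n = L2_inner circle_measure (zpow n) f"
  unfolding fourier_coeff_def L2_inner_def
  by (intro Bochner_Integration.integral_cong) (auto simp: cnj_zpow, simp add: zpow_def)

section \<open>Density of the trigonometric polynomials\<close>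

definition trig_span :: "(complex \<Rightarrow> complex) set" where
  "trig_span = L2_closed_span circle_measure zpow UNIV"

lemma trig_span_subspace: "L2_subspace circle_measure trig_span"
  unfolding trig_span_def by (rule L2_subspace_closed_span[OF zpow_L2])

text \<open>Multiplication by a unimodular function is isometric, hence preimages of closed sets are
  closed. It serves the induction over closed spans when the claim concerns a product with a power
  of \<open>z\<close>.\<close>

lemma L2_subspace_mult_vimage:
  assumes S: "L2_subspace M S" and h[measurable]: "h \<in> borel_measurable M"
    and h1: "AE x in M. norm (h x) = 1"
  shows "L2_subspace M {f \<in> L2 M. (\<lambda>x. h x * f x) \<in> S}"
  unfolding L2_subspace_def
proof (intro conjI ballI allI impI CollectI; (elim CollectE conjE)?)
  show "(\<lambda>x. h x * 0) \<in> S" using L2_subspaceD(2)[OF S] by simp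
next
  fix f g a b assume "f \<in> L2 M" "g \<in> L2 M" "(\<lambda>x. h x * f x) \<in> S" "(\<lambda>x. h x * g x) \<in> S"
  then show "(\<lambda>x. h x * (a * f x + b * g x)) \<in> S"
    using L2_subspaceD(3)[OF S, of "\<lambda>x. h x * f x" "\<lambda>x. h x * g x" a b] by (simp add: algebra_simps)
next
  fix f assume f: "f \<in> L2 M"
    and *: "\<forall>e>0. \<exists>g\<in>{f \<in> L2 M. (\<lambda>x. h x * f x) \<in> S}. L2_norm M (\<lambda>x. f x - g x) < e"
  show "(\<lambda>x. h x * f x) \<in> S"
  proof (rule L2_subspaceD(4)[OF S])
    show hf: "(\<lambda>x. h x * f x) \<in> L2 M" by (rule L2_unimodular_mult[OF f h h1])
    fix e :: real assume "e > 0"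
    then obtain g where g: "g \<in> L2 M" "(\<lambda>x. h x * g x) \<in> S" "L2_norm M (\<lambda>x. f x - g x) < e"
      using * by auto
    have "L2_norm M (\<lambda>x. h x * f x - h x * g x) = L2_norm M (\<lambda>x. f x - g x)"
    proof (rule L2_norm_cong_AE)
      show "AE x in M. norm (h x * f x - h x * g x) = norm (f x - g x)"
        using h1 by eventually_elim (simp add: norm_mult flip: right_diff_distrib)
    qed (use f g hf in \<open>auto intro!: L2_measurable L2_diff L2_unimodular_mult[OF _ h h1]\<close>)
    then show "\<exists>g\<in>S. L2_norm M (\<lambda>x. h x * f x - g x) < e"
      using g by (intro bexI[of _ "\<lambda>x. h x * g x"]) auto
  qed
qed (auto simp: L2_zero intro: L2_lin)

lemma zpow_mult_trig_span:
  assumes "f \<in> trig_span" shows "(\<lambda>z. zpow n z * f z) \<in> trig_span"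
proof -
  have "L2_closed_span circle_measure zpow UNIV \<subseteq>
      {f \<in> L2 circle_measure. (\<lambda>z. zpow n z * f z) \<in> trig_span}"
  proof (rule L2_closed_span_least)
    show "L2_subspace circle_measure {f \<in> L2 circle_measure. (\<lambda>z. zpow n z * f z) \<in> trig_span}"
      by (rule L2_subspace_mult_vimage[OF trig_span_subspace]) (auto intro!: AE_circle simp: norm_zpow)
    fix m
    have "(\<lambda>z. zpow n z * zpow m z) \<in> trig_span"
    proof (rule L2_subspace_cong_AE[OF trig_span_subspace])
      show "zpow (n + m) \<in> trig_span"
        unfolding trig_span_def by (rule L2_closed_span_superset[OF _ zpow_L2]) simp
    qed (auto intro!: zpow_mult_L2 zpow_L2 AE_circle simp: zpow_add)
    then show "zpow m \<in> {f \<in> L2 circle_measure. (\<lambda>z. zpow n z * f z) \<in> trig_span}"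
      by (simp add: zpow_L2)
  qed
  then show ?thesis using assms by (auto simp: trig_span_def)
qed

text \<open>
  That \<open>trig_span\<close> is all of \<open>L\<^sup>2\<close> is proved by showing that its algebra of bounded multipliers,
  which is closed under bounded pointwise limits, contains all indicators.
\<close>

definition trig_multiplier :: "(complex \<Rightarrow> complex) \<Rightarrow> bool" where
  "trig_multiplier g \<longleftrightarrow> g \<in> borel_measurable circle_measure \<and>
     (\<exists>B. \<forall>z. norm z = 1 \<longrightarrow> norm (g z) \<le> B) \<and> (\<forall>h\<in>trig_span. (\<lambda>z. g z * h z) \<in> trig_span)"

text \<open>The uniform bound gives the integrable majorant
  \<open>(2 * B)\<^sup>2 * (norm (h z))\<^sup>2\<close>, so the products converge in
  \<open>L\<^sup>2\<close> by dominated convergence and closedness applies.\<close>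

lemma trig_multiplier_limit:
  assumes g: "\<And>n. trig_multiplier (g n)"
    and lim: "\<And>z. norm z = 1 \<Longrightarrow> (\<lambda>n. g n z) \<longlonglongrightarrow> f z"
    and bdd: "\<And>n z. norm z = 1 \<Longrightarrow> norm (g n z) \<le> B"
  shows "trig_multiplier f"
  unfolding trig_multiplier_def
proof (intro conjI exI[of _ B] allI impI ballI)
  have [measurable]: "g n \<in> borel_measurable circle_measure" for n
    using g by (simp add: trig_multiplier_def)
  show fm[measurable]: "f \<in> borel_measurable circle_measure"
    by (rule borel_measurable_LIMSEQ_metric[where f = g]) (auto intro: lim)
  show fB: "norm (f z) \<le> B" if "norm z = 1" for z
    by (rule LIMSEQ_le_const2[OF tendsto_norm[OF lim[OF that]]]) (auto intro: bdd that)
  fix h assume h: "h \<in> trig_span"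
  then have hL: "h \<in> L2 circle_measure" by (rule L2_subspaceD(1)[OF trig_span_subspace])
  note [measurable] = L2_measurable[OF hL]
  have "(\<lambda>n. LINT z|circle_measure. (norm (f z * h z - g n z * h z))\<^sup>2) \<longlonglongrightarrow> (LINT z|circle_measure. 0)"
  proof (rule integral_dominated_convergence[where w = "\<lambda>z. (2 * B)\<^sup>2 * (norm (h z))\<^sup>2"])
    show "integrable circle_measure (\<lambda>z. (2 * B)\<^sup>2 * (norm (h z))\<^sup>2)"
      using L2_integrable[OF hL] by simp
    show "AE z in circle_measure. (\<lambda>n. (norm (f z * h z - g n z * h z))\<^sup>2) \<longlonglongrightarrow> 0"
    proof (rule AE_circle)
      fix z :: complex assume "norm z = 1"
      have "(\<lambda>n. (norm (f z * h z - g n z * h z))\<^sup>2) \<longlonglongrightarrow> (norm (f z * h z - f z * h z))\<^sup>2"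
        by (intro tendsto_intros lim) fact
      then show "(\<lambda>n. (norm (f z * h z - g n z * h z))\<^sup>2) \<longlonglongrightarrow> 0" by simp
    qed
    fix n
    show "AE z in circle_measure. norm ((norm (f z * h z - g n z * h z))\<^sup>2) \<le> (2 * B)\<^sup>2 * (norm (h z))\<^sup>2"
    proof (rule AE_circle)
      fix z :: complex assume z: "norm z = 1"
      have "norm (f z * h z - g n z * h z) \<le> 2 * B * norm (h z)"
        using norm_triangle_ineq4[of "f z" "g n z"] fB[OF z] bdd[OF z, of n]
        by (auto simp: norm_mult simp flip: left_diff_distrib intro!: mult_right_mono)
      then have "(norm (f z * h z - g n z * h z))\<^sup>2 \<le> (2 * B * norm (h z))\<^sup>2"
        by (rule power_mono) simp
      then show "norm ((norm (f z * h z - g n z * h z))\<^sup>2) \<le> (2 * B)\<^sup>2 * (norm (h z))\<^sup>2"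
        by (simp add: power_mult_distrib)
    qed
  qed measurable
  then have lim0: "(\<lambda>n. LINT z|circle_measure. (norm (f z * h z - g n z * h z))\<^sup>2) \<longlonglongrightarrow> 0" by simp
  have norm0: "(\<lambda>n. L2_norm circle_measure (\<lambda>z. f z * h z - g n z * h z)) \<longlonglongrightarrow> 0"
    unfolding L2_norm_def using tendsto_real_sqrt[OF lim0] by simp
  show "(\<lambda>z. f z * h z) \<in> trig_span"
  proof (rule L2_subspaceD(4)[OF trig_span_subspace])
    show "(\<lambda>z. f z * h z) \<in> L2 circle_measure"
      by (rule L2_bounded_mult[OF hL fm]) (auto intro!: AE_circle fB)
    fix e :: real assume "e > 0"
    then obtain n where "L2_norm circle_measure (\<lambda>z. f z * h z - g n z * h z) < e"
      using order_tendstoD(2)[OF norm0] by (auto simp: eventually_sequentially)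
    moreover have "(\<lambda>z. g n z * h z) \<in> trig_span"
      using g h by (simp add: trig_multiplier_def)
    ultimately show "\<exists>k\<in>trig_span. L2_norm circle_measure (\<lambda>z. f z * h z - k z) < e"
      by (intro bexI[of _ "\<lambda>z. g n z * h z"])
  qed
qed

lemma trig_multiplier_const: "trig_multiplier (\<lambda>z. c)"
  unfolding trig_multiplier_def
  by (auto intro: exI[of _ "norm c"] L2_subspace_mult[OF trig_span_subspace])

lemma trig_multiplier_zpow: "trig_multiplier (zpow n)"
  unfolding trig_multiplier_def by (auto intro!: exI[of _ 1] zpow_mult_trig_span simp: norm_zpow)

lemma trig_multiplier_add:
  assumes f: "trig_multiplier f" and g: "trig_multiplier g"
  shows "trig_multiplier (\<lambda>z. f z + g z)"
proof -
  obtain A B where b: "\<And>z. norm z = 1 \<Longrightarrow> norm (f z) \<le> A" "\<And>z. norm z = 1 \<Longrightarrow> norm (g z) \<le> B"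
    using f g unfolding trig_multiplier_def by auto
  have "norm (f z + g z) \<le> A + B" if "norm z = 1" for z
    using norm_triangle_ineq[of "f z" "g z"] b[OF that] by linarith
  moreover have "(\<lambda>z. (f z + g z) * h z) \<in> trig_span" if "h \<in> trig_span" for h
    using f g that L2_subspaceD(3)[OF trig_span_subspace, of "\<lambda>z. f z * h z" "\<lambda>z. g z * h z" 1 1]
    by (simp add: trig_multiplier_def distrib_right)
  ultimately show ?thesis using f g by (auto simp: trig_multiplier_def)
qed

lemma trig_multiplier_mult:
  assumes f: "trig_multiplier f" and g: "trig_multiplier g"
  shows "trig_multiplier (\<lambda>z. f z * g z)"
proof -
  obtain A B where b: "\<And>z. norm z = 1 \<Longrightarrow> norm (f z) \<le> A" "\<And>z. norm z = 1 \<Longrightarrow> norm (g z) \<le> B"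
    using f g unfolding trig_multiplier_def by auto
  have "norm (f z * g z) \<le> A * B" if "norm z = 1" for z
    using b[OF that] order_trans[OF norm_ge_zero b(1)[OF that]] by (auto simp: norm_mult intro!: mult_mono)
  moreover have "(\<lambda>z. (f z * g z) * h z) \<in> trig_span" if "h \<in> trig_span" for h
    using f g that by (simp add: trig_multiplier_def mult.assoc)
  ultimately show ?thesis using f g by (auto simp: trig_multiplier_def)
qed

lemma trig_multiplier_cong:
  assumes f: "trig_multiplier f" and "\<And>z. norm z = 1 \<Longrightarrow> f z = g z"
  shows "trig_multiplier g"
proof -
  obtain B where B: "\<And>z. norm z = 1 \<Longrightarrow> norm (f z) \<le> B" using f by (auto simp: trig_multiplier_def)
  show ?thesis
  proof (rule trig_multiplier_limit[where g = "\<lambda>_. f"])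
    show "(\<lambda>_. f z) \<longlonglongrightarrow> g z" if "norm z = 1" for z
      unfolding assms(2)[OF that] by simp
  qed (rule f B, assumption?)+
qed

lemma trig_multiplier_real_polynomial:
  assumes "real_polynomial_function p"
  shows "trig_multiplier (\<lambda>z. of_real (p z))"
  using assms
proof (induction p)
  case (linear p)
  interpret bounded_linear p by fact
  \<comment> \<open>On the circle the conjugate of \<open>z\<close> is \<open>zpow (- 1) z\<close>,
    so both coordinates are trigonometric polynomials; a real-linear functional is a combination of
    the coordinates.\<close>
  have Re: "trig_multiplier (\<lambda>z. of_real (Re z))"
  proof (rule trig_multiplier_cong)
    show "trig_multiplier (\<lambda>z. (1 / 2) * (zpow 1 z + zpow (- 1) z))"
      by (intro trig_multiplier_mult trig_multiplier_add trig_multiplier_zpow trig_multiplier_const)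
  qed (simp add: cnj_zpow[symmetric] complex_add_cnj)
  have Im: "trig_multiplier (\<lambda>z. of_real (Im z))"
  proof (rule trig_multiplier_cong)
    show "trig_multiplier (\<lambda>z. (1 / (2 * \<i>)) * (zpow 1 z + (- 1) * zpow (- 1) z))"
      by (intro trig_multiplier_mult trig_multiplier_add trig_multiplier_zpow trig_multiplier_const)
  qed (simp add: cnj_zpow[symmetric] complex_eq_iff)
  have "Re z *\<^sub>R 1 + Im z *\<^sub>R \<i> = z" for z by (simp add: complex_eq_iff)
  then have p: "p z = Re z * p 1 + Im z * p \<i>" for z
    using add[of "Re z *\<^sub>R 1" "Im z *\<^sub>R \<i>"] scale[of "Re z" 1] scale[of "Im z" \<i>] by simp
  have "trig_multiplier (\<lambda>z. of_real (Re z) * of_real (p 1) + of_real (Im z) * of_real (p \<i>))"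
    by (intro trig_multiplier_mult trig_multiplier_add trig_multiplier_const Re Im)
  then show ?case
    by (rule trig_multiplier_cong) (subst p, simp)
qed (simp_all add: trig_multiplier_const trig_multiplier_add trig_multiplier_mult)

lemma trig_multiplier_continuous:
  fixes g :: "complex \<Rightarrow> real"
  assumes g: "continuous_on (sphere 0 1) g"
  shows "trig_multiplier (\<lambda>z. of_real (g z))"
proof -
  have "bounded (g ` sphere 0 1)"
    using compact_continuous_image[OF g] by (auto intro: compact_imp_bounded)
  then obtain B where "\<forall>x\<in>g ` sphere 0 1. norm x \<le> B"
    unfolding bounded_iff ..
  then have B: "\<And>z. norm z = 1 \<Longrightarrow> \<bar>g z\<bar> \<le> B" by auto
  have "\<exists>p. real_polynomial_function p \<and> (\<forall>z\<in>sphere 0 1. \<bar>g z - p z\<bar> < inverse (real (Suc n)))" for n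
    by (rule Stone_Weierstrass_real_polynomial_function[OF compact_sphere g, of "inverse (real (Suc n))"]) auto
  from choice[OF allI[OF this]] obtain p where "\<forall>n. real_polynomial_function (p n) \<and>
      (\<forall>z\<in>sphere 0 1. \<bar>g z - p n z\<bar> < inverse (real (Suc n)))" ..
  then have p: "\<And>n. real_polynomial_function (p n)"
      "\<And>n z. norm z = 1 \<Longrightarrow> \<bar>g z - p n z\<bar> < inverse (real (Suc n))"
    by (auto simp del: of_nat_Suc)
  show ?thesis
  \<comment> \<open>The approximation errors are below \<open>inverse (Suc n)\<close>, hence at most
    1; this is the origin of the bound \<open>B + 1\<close>.\<close>
  proof (rule trig_multiplier_limit[where g = "\<lambda>n z. of_real (p n z)" and B = "B + 1"])
    show "trig_multiplier (\<lambda>z. of_real (p n z))" for n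
      by (rule trig_multiplier_real_polynomial[OF p(1)])
    fix z :: complex assume z: "norm z = 1"
    have "(\<lambda>n. p n z - g z) \<longlonglongrightarrow> 0"
      using p(2)[OF z] by (intro Lim_null_comparison[OF _ LIMSEQ_inverse_real_of_nat])
        (auto intro!: eventuallyI simp: abs_minus_commute less_imp_le)
    then show "(\<lambda>n. complex_of_real (p n z)) \<longlonglongrightarrow> of_real (g z)"
      by (intro tendsto_of_real) (simp add: LIM_zero_iff)
    have "inverse (real (Suc n)) \<le> 1" for n by (simp add: inverse_le_1_iff)
    then show "norm (complex_of_real (p n z)) \<le> B + 1" for n
      using p(2)[OF z, of n] B[OF z] by (smt (verit) norm_of_real)
  qed
qed

text \<open>The continuous function \<open>1 / (1 + infdist z A)\<close> is 1 exactly on the closed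
  set \<open>A\<close> and below 1 elsewhere, so its powers decrease to the indicator.\<close>

lemma trig_multiplier_closed:
  fixes A :: "complex set"
  assumes A: "closed A"
  shows "trig_multiplier (indicator A)"
proof (cases "A = {}")
  \<comment> \<open>The empty set is treated apart because \<open>infdist\<close> to it is 0 by
    convention, which would make all the powers equal to 1.\<close>
  case True
  then show ?thesis using trig_multiplier_const[of 0] by (simp add: indicator_def[abs_def])
next
  case False
  define g where "g z = 1 / (1 + infdist z A)" for z
  have pos: "0 < 1 + infdist z A" for z using infdist_nonneg[of z A] by linarith
  have g: "0 < g z" "g z \<le> 1" for z
    using pos[of z] infdist_nonneg[of z A] by (auto simp: g_def)
  have cont: "continuous_on (sphere 0 1) (\<lambda>z. g z ^ n)" for n
    unfolding g_def using pos by (intro continuous_intros) (auto simp: less_imp_neq[symmetric])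
  show ?thesis
  proof (rule trig_multiplier_limit[where g = "\<lambda>n z. of_real (g z ^ n)" and B = 1])
    show "trig_multiplier (\<lambda>z. of_real (g z ^ n))" for n
      by (rule trig_multiplier_continuous[OF cont])
    fix z :: complex
    show "norm (complex_of_real (g z ^ n)) \<le> 1" for n
      using g[of z] by (simp add: norm_power power_le_one)
    show "(\<lambda>n. complex_of_real (g z ^ n)) \<longlonglongrightarrow> indicator A z"
    proof (cases "z \<in> A")
      case True
      then show ?thesis by (simp add: g_def)
    next
      case False
      then have "infdist z A > 0"
        using in_closed_iff_infdist_zero[OF A \<open>A \<noteq> {}\<close>, of z] infdist_nonneg[of z A] by auto
      then have "g z < 1" by (simp add: g_def)
      then have "(\<lambda>n. complex_of_real (g z ^ n)) \<longlonglongrightarrow> of_real 0"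
        using g[of z] by (intro tendsto_of_real LIMSEQ_realpow_zero) auto
      then show ?thesis using False by simp
    qed
  qed
qed

lemma trig_multiplier_borel:
  assumes "A \<in> sets borel"
  shows "trig_multiplier (indicator A)"
proof -
  have "A \<in> sigma_sets UNIV {S. closed S}"
    using assms by (simp add: borel_eq_closed)
  then show ?thesis
  proof induction
    case (Compl A)
    have "trig_multiplier (\<lambda>z. 1 + (- 1) * indicator A z)"
      by (intro trig_multiplier_mult trig_multiplier_add trig_multiplier_const Compl)
    then show ?case by (rule trig_multiplier_cong) (auto simp: indicator_def)
  next
    case (Union A)
    \<comment> \<open>A finite union is the complement of the intersection of the complements, and
      intersections are products of indicators; the countable union is the bounded limit.\<close>
    have "trig_multiplier (\<lambda>z. \<Prod>i<n. 1 + (- 1) * indicator (A i) z)" for n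
      by (induction n)
        (auto intro: trig_multiplier_const intro!: trig_multiplier_mult[OF _ trig_multiplier_add[OF trig_multiplier_const trig_multiplier_mult[OF trig_multiplier_const Union.IH]], of _ 1 "-1", simplified])
    then have m: "trig_multiplier (\<lambda>z. 1 + (- 1) * (\<Prod>i<n. 1 + (- 1) * indicator (A i) z))" for n
      by (intro trig_multiplier_mult trig_multiplier_add trig_multiplier_const)
    have eq: "1 + (- 1) * (\<Prod>i<n. 1 + (- 1) * indicator (A i) z) = (indicator (\<Union>i<n. A i) z :: complex)" for n z
      by (induction n) (auto simp: indicator_def less_Suc_eq)
    show ?case
    proof (rule trig_multiplier_limit)
      show "trig_multiplier (indicator (\<Union>i<n. A i))" for n
        using m[of n] unfolding eq .
      fix z :: complex
      show "norm (indicator (\<Union>i<n. A i) z :: complex) \<le> 1" for n by (simp add: indicator_def)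
      show "(\<lambda>n. indicator (\<Union>i<n. A i) z) \<longlonglongrightarrow> (indicator (\<Union>i. A i) z :: complex)"
        by (rule LIMSEQ_indicator_UN)
    qed
  qed (auto intro: trig_multiplier_closed trig_multiplier_const)
qed

lemma trig_span_eq_L2: "trig_span = L2 circle_measure"
proof
  show "trig_span \<subseteq> L2 circle_measure" using L2_subspaceD(1)[OF trig_span_subspace] by auto
  show "L2 circle_measure \<subseteq> trig_span"
  proof
    fix f assume f: "f \<in> L2 circle_measure"
    note fm[measurable] = L2_measurable[OF f]
    obtain s where s0: "(\<forall>i. simple_function circle_measure (s i)) \<and>
        (\<forall>z\<in>space circle_measure. (\<lambda>i. s i z) \<longlonglongrightarrow> f z) \<and>
        (\<forall>i. \<forall>z\<in>space circle_measure. dist (s i z) 0 \<le> 2 * dist (f z) 0)"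
      using borel_measurable_implies_sequence_metric[OF fm, of 0] ..
    then have s: "\<And>i. simple_function circle_measure (s i)"
        "\<And>z. norm z = 1 \<Longrightarrow> (\<lambda>i. s i z) \<longlonglongrightarrow> f z"
        "\<And>i z. norm z = 1 \<Longrightarrow> norm (s i z) \<le> 2 * norm (f z)"
      by auto
    have one: "(\<lambda>z. 1) \<in> trig_span"
      using L2_closed_span_superset[of 0 UNIV zpow, OF _ zpow_L2]
      unfolding trig_span_def by (simp add: zpow_def[abs_def])
    have simple: "s i \<in> trig_span" for i
    proof (rule L2_subspace_cong_AE[OF trig_span_subspace])
      \<comment> \<open>A multiplier applied to the constant 1, which lies in the span, is itself in
        the span.\<close>
      have ind: "indicator (s i -` {y} \<inter> sphere 0 1) \<in> trig_span" for y
      proof -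
        have "s i -` {y} \<inter> sphere 0 1 \<in> sets circle_measure"
          using simple_functionD(2)[OF s(1)[of i], of "{y}"] by simp
        then have "s i -` {y} \<inter> sphere 0 1 \<in> sets borel"
          unfolding sets_circle by (subst (asm) sets_restrict_space_iff) auto
        from trig_multiplier_borel[OF this] show ?thesis
          using one unfolding trig_multiplier_def by fastforce
      qed
      show "(\<lambda>z. \<Sum>y\<in>s i ` sphere 0 1. y * indicator (s i -` {y} \<inter> sphere 0 1) z) \<in> trig_span"
        by (rule L2_subspace_sum[OF trig_span_subspace ind])
      have fin: "finite (s i ` sphere 0 1)"
        using s(1)[of i] by (simp add: simple_function_def)
      obtain B where "\<forall>x\<in>s i ` sphere 0 1. norm x \<le> B"
        using finite_imp_bounded[OF fin] unfolding bounded_iff ..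
      then have "\<And>z. norm z = 1 \<Longrightarrow> norm (s i z) \<le> B" by auto
      then show "s i \<in> L2 circle_measure"
        by (intro L2_circle_bounded borel_measurable_simple_function s)
      show "AE z in circle_measure. (\<Sum>y\<in>s i ` sphere 0 1. y * indicator (s i -` {y} \<inter> sphere 0 1) z) = s i z"
      proof (rule AE_circle)
        fix z :: complex assume z: "norm z = 1"
        have "(\<Sum>y\<in>s i ` sphere 0 1. y * indicator (s i -` {y} \<inter> sphere 0 1) z) =
            (\<Sum>y\<in>s i ` sphere 0 1. if y = s i z then y else 0)"
          using z by (intro sum.cong) (auto simp: indicator_def)
        also have "\<dots> = s i z" using fin z by (simp add: sum.delta)
        finally show "(\<Sum>y\<in>s i ` sphere 0 1. y * indicator (s i -` {y} \<inter> sphere 0 1) z) = s i z" .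
      qed
    qed
    have [measurable]: "s i \<in> borel_measurable circle_measure" for i
      by (rule borel_measurable_simple_function[OF s(1)])
    have "(\<lambda>n. LINT z|circle_measure. (norm (f z - s n z))\<^sup>2) \<longlonglongrightarrow> (LINT z|circle_measure. 0)"
    \<comment> \<open>The constant 9 is the square of 3: the simple functions satisfy
      \<open>norm (s n z) \<le> 2 * norm (f z)\<close>.\<close>
    proof (rule integral_dominated_convergence[where w = "\<lambda>z. 9 * (norm (f z))\<^sup>2"])
      show "integrable circle_measure (\<lambda>z. 9 * (norm (f z))\<^sup>2)"
        using L2_integrable[OF f] by simp
      show "AE z in circle_measure. (\<lambda>n. (norm (f z - s n z))\<^sup>2) \<longlonglongrightarrow> 0"
      proof (rule AE_circle)
        fix z :: complex assume "norm z = 1"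
        have "(\<lambda>n. (norm (f z - s n z))\<^sup>2) \<longlonglongrightarrow> (norm (f z - f z))\<^sup>2"
          by (intro tendsto_intros s) fact
        then show "(\<lambda>n. (norm (f z - s n z))\<^sup>2) \<longlonglongrightarrow> 0" by simp
      qed
      show "AE z in circle_measure. norm ((norm (f z - s n z))\<^sup>2) \<le> 9 * (norm (f z))\<^sup>2" for n
      proof (rule AE_circle)
        fix z :: complex assume z: "norm z = 1"
        have "norm (f z - s n z) \<le> 3 * norm (f z)"
          using norm_triangle_ineq4[of "f z" "s n z"] s(3)[OF z, of n] by linarith
        then have "(norm (f z - s n z))\<^sup>2 \<le> (3 * norm (f z))\<^sup>2" by (intro power_mono) auto
        then show "norm ((norm (f z - s n z))\<^sup>2) \<le> 9 * (norm (f z))\<^sup>2" by (simp add: power_mult_distrib)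
      qed
    qed measurable
    then have lim0: "(\<lambda>n. LINT z|circle_measure. (norm (f z - s n z))\<^sup>2) \<longlonglongrightarrow> 0" by simp
    have norm0: "(\<lambda>n. L2_norm circle_measure (\<lambda>z. f z - s n z)) \<longlonglongrightarrow> 0"
      unfolding L2_norm_def using tendsto_real_sqrt[OF lim0] by simp
    show "f \<in> trig_span"
    proof (rule L2_subspaceD(4)[OF trig_span_subspace f])
      fix e :: real assume "e > 0"
      then obtain n where "L2_norm circle_measure (\<lambda>z. f z - s n z) < e"
        using order_tendstoD(2)[OF norm0] by (auto simp: eventually_sequentially)
      then show "\<exists>k\<in>trig_span. L2_norm circle_measure (\<lambda>z. f z - k z) < e"
        using simple by blast
    qed
  qed
qed

section \<open>The Hardy space\<close>

text \<open>Such an \<open>f\<close> is orthogonal to the whole of \<open>trig_span\<close>, and by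
  density to itself.\<close>

lemma fourier_coeff_L2_norm_eq_0:
  assumes f: "f \<in> L2 circle_measure" and "\<And>n. fourier_coeff f n = 0"
  shows "AE z in circle_measure. f z = 0"
proof -
  have "f \<in> L2_orth_in circle_measure (L2 circle_measure) trig_span"
    unfolding trig_span_def L2_orth_closed_span[OF order_refl zpow_L2]
    using assms by (simp add: fourier_coeff_eq_inner)
  then have "L2_inner circle_measure f f = 0"
    using f by (simp add: L2_orth_in_def trig_span_eq_L2)
  then have "L2_norm circle_measure f = 0"
    unfolding L2_inner_self by simp
  then show ?thesis using L2_norm_eq_0[OF f] by simp
qed

lemma fourier_coeff_diff:
  "f \<in> L2 circle_measure \<Longrightarrow> g \<in> L2 circle_measure \<Longrightarrow>
    fourier_coeff (\<lambda>z. f z - g z) n = fourier_coeff f n - fourier_coeff g n"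
  unfolding fourier_coeff_eq_inner by (rule L2_inner_diff_right[OF zpow_L2])

lemma fourier_coeff_const: "fourier_coeff (\<lambda>z. c) n = (if n = 0 then c else 0)"
  using integral_zpow[of "- n"] by (simp add: fourier_coeff_def zpow_def)

lemma constant_if_fourier_coeff_eq_0:
  assumes f: "f \<in> L2 circle_measure" and "\<And>n. n \<noteq> 0 \<Longrightarrow> fourier_coeff f n = 0"
  shows "AE z in circle_measure. f z = fourier_coeff f 0"
proof -
  have c: "(\<lambda>z. fourier_coeff f 0) \<in> L2 circle_measure"
    by (rule L2_circle_bounded[where B = "norm (fourier_coeff f 0)"]) auto
  have "AE z in circle_measure. f z - fourier_coeff f 0 = 0"
  proof (rule fourier_coeff_L2_norm_eq_0[OF L2_diff[OF f c]])
    show "fourier_coeff (\<lambda>z. f z - fourier_coeff f 0) n = 0" for n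
      unfolding fourier_coeff_diff[OF f c] fourier_coeff_const using assms(2) by simp
  qed
  then show ?thesis by simp
qed

lemma hardy2_eq_orth: "hardy2 = L2_orth_in circle_measure (L2 circle_measure) (zpow ` {..<0})"
  by (auto simp: hardy2_def L2_orth_in_def fourier_coeff_eq_inner)

lemma hardy2_subspace: "L2_subspace circle_measure hardy2"
  unfolding hardy2_eq_orth by (rule L2_subspace_orth) (auto simp: zpow_L2)

lemma zpow_hardy2: "0 \<le> n \<Longrightarrow> zpow n \<in> hardy2"
  by (auto simp: hardy2_def zpow_L2 fourier_coeff_eq_inner inner_zpow)

text \<open>Approximate by a trigonometric polynomial and discard its negative frequencies. These
  are orthogonal to the Hardy space, so by Pythagoras the error does not grow.\<close>

lemma hardy2_eq_span: "hardy2 = L2_closed_span circle_measure zpow {0..}"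
proof
  show "L2_closed_span circle_measure zpow {0..} \<subseteq> hardy2"
    by (rule L2_closed_span_least[OF hardy2_subspace]) (simp add: zpow_hardy2)
  show "hardy2 \<subseteq> L2_closed_span circle_measure zpow {0..}"
  proof
    fix f assume f: "f \<in> hardy2"
    then have fL: "f \<in> L2 circle_measure" by (simp add: hardy2_def)
    show "f \<in> L2_closed_span circle_measure zpow {0..}"
      unfolding L2_closed_span_iff
    proof (intro conjI allI impI fL)
      fix e :: real assume e: "e > 0"
      have "f \<in> L2_closed_span circle_measure zpow UNIV"
        using fL by (simp add: trig_span_eq_L2 flip: trig_span_def)
      then obtain F a where F: "finite F"
          "L2_norm circle_measure (\<lambda>z. f z - (\<Sum>n\<in>F. a n * zpow n z)) < e"
        unfolding L2_closed_span_iff using e by auto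
      let ?q = "\<lambda>z. \<Sum>n\<in>F \<inter> {0..}. a n * zpow n z" and ?s = "\<lambda>z. \<Sum>n\<in>F \<inter> {..<0}. a n * zpow n z"
      have q: "?q \<in> hardy2" by (rule L2_subspace_sum[OF hardy2_subspace]) (simp add: zpow_hardy2)
      have fq: "(\<lambda>z. f z - ?q z) \<in> hardy2" by (rule L2_subspace_diff[OF hardy2_subspace f q])
      then have fqL: "(\<lambda>z. f z - ?q z) \<in> L2 circle_measure" by (simp add: hardy2_def)
      have sL: "?s \<in> L2 circle_measure" by (rule L2_sum[OF zpow_L2])
      have split: "(\<Sum>n\<in>F. a n * zpow n z) = ?q z + ?s z" for z
        using F(1) by (subst sum.union_disjoint[symmetric]) (auto intro!: sum.cong)
      have "L2_inner circle_measure (\<lambda>z. f z - ?q z) (zpow n) = 0" if "n < 0" for n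
        using fq that L2_inner_cnj[of circle_measure "\<lambda>z. f z - ?q z" "zpow n"]
        by (simp add: hardy2_def fourier_coeff_eq_inner)
      then have "L2_inner circle_measure (\<lambda>z. f z - ?q z) ?s = 0"
        by (subst L2_inner_sum_right[OF fqL zpow_L2]) (auto intro!: sum.neutral)
      then have "(L2_norm circle_measure (\<lambda>z. f z - (\<Sum>n\<in>F. a n * zpow n z)))\<^sup>2 =
          (L2_norm circle_measure (\<lambda>z. f z - ?q z))\<^sup>2 + (L2_norm circle_measure ?s)\<^sup>2"
        using L2_norm_lin[OF fqL sL, of 1 "-1"] by (simp add: split algebra_simps)
      then have "(L2_norm circle_measure (\<lambda>z. f z - ?q z))\<^sup>2 \<le>
          (L2_norm circle_measure (\<lambda>z. f z - (\<Sum>n\<in>F. a n * zpow n z)))\<^sup>2"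
        by simp
      then have "L2_norm circle_measure (\<lambda>z. f z - ?q z) < e"
        using F(2) power2_le_imp_le[OF _ L2_norm_nonneg] by (meson le_less_trans)
      then show "\<exists>F a. finite F \<and> F \<subseteq> {0..} \<and>
          L2_norm circle_measure (\<lambda>z. f z - (\<Sum>n\<in>F. a n * zpow n z)) < e"
        using F(1) by (intro exI[of _ "F \<inter> {0..}"] exI[of _ a]) auto
    qed
  qed
qed

lemma hardy2_orth:
  "L2_orth_in circle_measure (L2 circle_measure) hardy2 =
    {f \<in> L2 circle_measure. \<forall>n\<ge>0. fourier_coeff f n = 0}"
  unfolding hardy2_eq_span L2_orth_closed_span[OF order_refl zpow_L2]
  by (auto simp: fourier_coeff_eq_inner)

lemma fourier_coeff_zpow_mult: "fourier_coeff (\<lambda>z. zpow m z * f z) n = fourier_coeff f (n - m)"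
proof -
  have "zpow (- n) z * (zpow m z * f z) = zpow (m - n) z * f z" if "norm z = 1" for z
    using zpow_add[OF that, of "- n" m] by (simp add: mult.assoc[symmetric])
  then show ?thesis
    unfolding fourier_coeff_def zpow_def[symmetric]
    by (intro Bochner_Integration.integral_cong) auto
qed

lemma zpow_mult_hardy2: "f \<in> hardy2 \<Longrightarrow> 0 \<le> n \<Longrightarrow> (\<lambda>z. zpow n z * f z) \<in> hardy2"
  by (auto simp: hardy2_def zpow_mult_L2 fourier_coeff_zpow_mult)

lemma zpow_mult_closed_span:
  assumes f: "f \<in> L2 circle_measure" and IJ: "\<And>n. n \<in> I \<Longrightarrow> n + m \<in> J"
    and g: "g \<in> L2_closed_span circle_measure (\<lambda>n z. zpow n z * f z) I"
  shows "(\<lambda>z. zpow m z * g z) \<in> L2_closed_span circle_measure (\<lambda>n z. zpow n z * f z) J"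
proof -
  let ?S = "L2_closed_span circle_measure (\<lambda>n z. zpow n z * f z) J"
  have S: "L2_subspace circle_measure ?S"
    by (rule L2_subspace_closed_span[OF zpow_mult_L2[OF f]])
  have "L2_closed_span circle_measure (\<lambda>n z. zpow n z * f z) I \<subseteq>
      {g \<in> L2 circle_measure. (\<lambda>z. zpow m z * g z) \<in> ?S}"
  proof (rule L2_closed_span_least)
    show "L2_subspace circle_measure {g \<in> L2 circle_measure. (\<lambda>z. zpow m z * g z) \<in> ?S}"
      by (rule L2_subspace_mult_vimage[OF S]) (auto intro!: AE_circle simp: norm_zpow)
    fix n assume "n \<in> I"
    have "(\<lambda>z. zpow m z * (zpow n z * f z)) \<in> ?S"
    proof (rule L2_subspace_cong_AE[OF S])
      show "(\<lambda>z. zpow (n + m) z * f z) \<in> ?S"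
        using L2_closed_span_superset[where X = "\<lambda>n z. zpow n z * f z", OF IJ[OF \<open>n \<in> I\<close>] zpow_mult_L2[OF f]] .
    qed (auto intro!: zpow_mult_L2 f AE_circle simp: zpow_add)
    then show "(\<lambda>z. zpow n z * f z) \<in> {g \<in> L2 circle_measure. (\<lambda>z. zpow m z * g z) \<in> ?S}"
      by (simp add: zpow_mult_L2 f)
  qed
  then show ?thesis using g by auto
qed

section \<open>Poisson and Herglotz integrals\<close>

text \<open>Termwise integration against an integrable density, stated for arbitrary unimodular
  \<open>e n\<close> so that it covers positive and negative powers: the Herglotz and Poisson
  kernels as well as dilated Taylor series.\<close>

lemma integral_uniform_series:
  fixes b :: "nat \<Rightarrow> complex"
  assumes b: "summable (\<lambda>n. norm (b n))" and f: "integrable circle_measure f"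
    and e[measurable]: "\<And>n. e n \<in> borel_measurable circle_measure"
    and e1: "\<And>n w. norm w = 1 \<Longrightarrow> norm (e n w) = 1"
  shows "integrable circle_measure (\<lambda>w. (\<Sum>n. b n * e n w) * f w)"
    "(\<lambda>n. b n * (LINT w|circle_measure. e n w * f w)) sums
      (LINT w|circle_measure. (\<Sum>n. b n * e n w) * f w)"
proof -
  note [measurable] = borel_measurable_integrable[OF f]
  have int: "integrable circle_measure (\<lambda>w. e n w * f w)" for n
    by (rule Bochner_Integration.integrable_bound[OF f]) (auto simp: norm_mult e1 intro!: AE_circle)
  have smb: "summable (\<lambda>n. norm (b n * e n w))" if "norm w = 1" for w
    using b by (simp add: norm_mult e1[OF that])
  have sm: "AE w in circle_measure. summable (\<lambda>n. norm (b n * (e n w * f w)))"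
  proof (rule AE_circle)
    fix w :: complex assume w: "norm w = 1"
    show "summable (\<lambda>n. norm (b n * (e n w * f w)))"
      using summable_mult2[OF b, of "norm (f w)"] by (simp add: norm_mult e1[OF w])
  qed
  have "(LINT w|circle_measure. norm (b n * (e n w * f w))) = norm (b n) * (LINT w|circle_measure. norm (f w))" for n
    unfolding integral_mult_right_zero[symmetric]
    by (intro Bochner_Integration.integral_cong) (auto simp: norm_mult e1)
  then have sm': "summable (\<lambda>n. LINT w|circle_measure. norm (b n * (e n w * f w)))"
    using summable_mult2[OF b] by simp
  have eq: "(\<Sum>n. b n * (e n w * f w)) = (\<Sum>n. b n * e n w) * f w" if "norm w = 1" for w
    using suminf_mult2[OF summable_norm_cancel[OF smb[OF that]], of "f w"] by (simp add: mult.assoc)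
  have i: "integrable circle_measure (\<lambda>w. b n * (e n w * f w))" for n using int by simp
  have "integrable circle_measure (\<lambda>w. \<Sum>n. b n * (e n w * f w))"
    by (rule integrable_suminf[OF i sm sm'])
  also have "integrable circle_measure (\<lambda>w. \<Sum>n. b n * (e n w * f w)) \<longleftrightarrow>
      integrable circle_measure (\<lambda>w. (\<Sum>n. b n * e n w) * f w)"
    by (rule Bochner_Integration.integrable_cong) (auto simp: eq)
  finally show "integrable circle_measure (\<lambda>w. (\<Sum>n. b n * e n w) * f w)" .
  have "(\<lambda>n. LINT w|circle_measure. b n * (e n w * f w)) sums (LINT w|circle_measure. (\<Sum>n. b n * (e n w * f w)))"
    by (rule sums_integral[OF i sm sm'])
  also have "(LINT w|circle_measure. (\<Sum>n. b n * (e n w * f w))) =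
      (LINT w|circle_measure. (\<Sum>n. b n * e n w) * f w)"
    by (rule Bochner_Integration.integral_cong) (auto simp: eq)
  finally show "(\<lambda>n. b n * (LINT w|circle_measure. e n w * f w)) sums
      (LINT w|circle_measure. (\<Sum>n. b n * e n w) * f w)" by simp
qed

definition herglotz :: "(complex \<Rightarrow> complex) \<Rightarrow> complex \<Rightarrow> complex" where
  "herglotz f z = (LINT w|circle_measure. (w + z) / (w - z) * f w)"

text \<open>Taken as the real part of the Herglotz kernel because the modulus of an outer function
  is the exponential of such a real part; the classical quotient is
  \<open>poisson_kernel_explicit\<close>.\<close>

definition poisson_kernel :: "complex \<Rightarrow> complex \<Rightarrow> real" where
  "poisson_kernel z w = Re ((w + z) / (w - z))"

definition poisson :: "(complex \<Rightarrow> complex) \<Rightarrow> complex \<Rightarrow> complex" where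
  "poisson f z = (LINT w|circle_measure. of_real (poisson_kernel z w) * f w)"

lemma zpow_uminus_of_nat: "zpow (- int n) w = inverse w ^ n"
  by (simp add: zpow_def power_int_minus power_inverse)

lemma geometric_circle:
  assumes z: "norm z < 1" and w: "norm w = 1"
  shows "(\<Sum>n. z ^ n * zpow (- int n) w) = w / (w - z)"
proof -
  have w0: "w \<noteq> 0" "w \<noteq> z" using z w by auto
  have "norm (z * inverse w) < 1" using z w by (simp add: norm_mult norm_inverse)
  then have "(\<Sum>n. (z * inverse w) ^ n) = 1 / (1 - z * inverse w)" by (rule suminf_geometric)
  also have "\<dots> = w / (w - z)" using w0 by (simp add: field_simps)
  finally show ?thesis by (simp add: zpow_uminus_of_nat power_mult_distrib)
qed

lemma herglotz_kernel_eq: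
  assumes z: "norm z < 1" and w: "norm w = 1"
  shows "(w + z) / (w - z) = 2 * (\<Sum>n. z ^ n * zpow (- int n) w) - 1"
proof -
  have "w \<noteq> z" using z w by auto
  then show ?thesis unfolding geometric_circle[OF assms] by (simp add: field_simps)
qed

text \<open>The Herglotz kernel is \<open>2 * G - 1\<close> with the geometric series
  \<open>G\<close>, so its real part is \<open>G + cnj G - 1\<close>; on the circle conjugating
  \<open>G\<close> inverts the powers of \<open>w\<close>.\<close>

lemma poisson_kernel_eq:
  assumes z: "norm z < 1" and w: "norm w = 1"
  shows "of_real (poisson_kernel z w) =
    (\<Sum>n. z ^ n * zpow (- int n) w) + (\<Sum>n. cnj z ^ n * zpow (int n) w) - 1"
proof -
  have "norm (cnj z) < 1" "norm (cnj w) = 1" using z w by auto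
  from geometric_circle[OF this]
  have "(\<Sum>n. cnj z ^ n * zpow (int n) w) = cnj (w / (w - z))"
    using w by (simp add: zpow_uminus_of_nat zpow_of_nat flip: cnj_unit)
  also have "\<dots> = cnj (\<Sum>n. z ^ n * zpow (- int n) w)" unfolding geometric_circle[OF assms] ..
  finally show ?thesis
    unfolding poisson_kernel_def herglotz_kernel_eq[OF assms]
    by (simp add: complex_eq_iff)
qed

lemma summable_norm_geometric:
  fixes z :: complex assumes "norm z < 1" shows "summable (\<lambda>n. norm (z ^ n))"
  using assms by (simp add: norm_power summable_geometric)

lemma integrable_herglotz_kernel:
  assumes z: "norm z < 1" and f: "integrable circle_measure f"
  shows "integrable circle_measure (\<lambda>w. (w + z) / (w - z) * f w)"
proof -
  have "integrable circle_measure (\<lambda>w. 2 * ((\<Sum>n. z ^ n * zpow (- int n) w) * f w) - f w)"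
    by (intro Bochner_Integration.integrable_diff integrable_mult_right f
        integral_uniform_series(1)[OF summable_norm_geometric[OF z] f]) (auto simp: norm_zpow)
  also have "?this \<longleftrightarrow> ?thesis"
    by (rule Bochner_Integration.integrable_cong) (auto simp: herglotz_kernel_eq[OF z] algebra_simps)
  finally show ?thesis .
qed

lemma fourier_coeff_eq_integral: "fourier_coeff f n = (LINT w|circle_measure. zpow (- n) w * f w)"
  by (simp add: fourier_coeff_def zpow_def)

lemma herglotz_sums:
  assumes z: "norm z < 1" and f: "integrable circle_measure f"
  shows "(\<lambda>n. (if n = 0 then 1 else 2) * fourier_coeff f (int n) * z ^ n) sums herglotz f z"
proof -
  note ser = integral_uniform_series[OF summable_norm_geometric[OF z] f, of "\<lambda>n. zpow (- int n)", OF zpow_measurable norm_zpow]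
  have "(\<lambda>n. 2 * (z ^ n * fourier_coeff f (int n))) sums (2 * (LINT w|circle_measure. (\<Sum>n. z ^ n * zpow (- int n) w) * f w))"
    unfolding fourier_coeff_eq_integral by (intro sums_mult ser(2))
  \<comment> \<open>The kernel is twice the geometric series minus 1, so the constant coefficient is
    counted once and all the others twice.\<close>
  from sums_diff[OF this sums_single[of 0 "\<lambda>_. fourier_coeff f 0"]]
  have "(\<lambda>n. (if n = 0 then 1 else 2) * fourier_coeff f (int n) * z ^ n) sums
     (2 * (LINT w|circle_measure. (\<Sum>n. z ^ n * zpow (- int n) w) * f w) - fourier_coeff f 0)"
    by (rule sums_cong[THEN iffD1, rotated]) auto
  moreover have "herglotz f z = (LINT w|circle_measure. 2 * ((\<Sum>n. z ^ n * zpow (- int n) w) * f w) - f w)"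
    unfolding herglotz_def
    by (rule Bochner_Integration.integral_cong) (auto simp: herglotz_kernel_eq[OF z] algebra_simps)
  moreover have "\<dots> = 2 * (LINT w|circle_measure. (\<Sum>n. z ^ n * zpow (- int n) w) * f w) - fourier_coeff f 0"
    using ser(1) f by (simp add: fourier_coeff_eq_integral)
  ultimately show ?thesis by simp
qed

section \<open>Positivity and symmetry of the Poisson kernel, and its action on Fourier
  modes\<close>

lemma poisson_kernel_explicit:
  assumes z: "norm z < 1" and w: "norm w = 1"
  shows "poisson_kernel z w = (1 - (norm z)\<^sup>2) / (norm (w - z))\<^sup>2"
proof -
  have "Re ((w + z) * cnj (w - z)) = (norm w)\<^sup>2 - (norm z)\<^sup>2"
    unfolding cmod_power2 by (simp add: algebra_simps power2_eq_square)
  then show ?thesis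
    unfolding poisson_kernel_def
    by (subst complex_div_cnj) (simp only: Re_divide_of_real w power_one flip: of_real_power)
qed

lemma poisson_kernel_pos: "norm z < 1 \<Longrightarrow> norm w = 1 \<Longrightarrow> 0 \<le> poisson_kernel z w"
  by (simp add: poisson_kernel_explicit power_le_one)

text \<open>\<open>norm (w - r z)\<close> depends on the two unit vectors only through
  \<open>r\<close> and their real scalar product. The symmetry lets the normalization of the kernel
  be used in either variable.\<close>

lemma poisson_kernel_sym:
  assumes "0 \<le> r" "r < 1" and z: "norm z = 1" and w: "norm w = 1"
  shows "poisson_kernel (of_real r * z) w = poisson_kernel (of_real r * w) z"
proof -
  have *: "(norm (b - of_real r * a))\<^sup>2 = 1 + r\<^sup>2 - 2 * r * (Re a * Re b + Im a * Im b)"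
    if "norm a = 1" "norm b = 1" for a b
  proof -
    have "(Re a)\<^sup>2 + (Im a)\<^sup>2 = 1" "(Re b)\<^sup>2 + (Im b)\<^sup>2 = 1"
      using that by (simp_all add: cmod_power2[symmetric])
    then show ?thesis by (simp add: cmod_power2) algebra
  qed
  have rz: "norm (of_real r * z) < 1" "norm (of_real r * w) < 1"
    using assms by (simp_all add: norm_mult)
  show ?thesis
    unfolding poisson_kernel_explicit[OF rz(1) w] poisson_kernel_explicit[OF rz(2) z] *[OF z w] *[OF w z]
    by (simp add: norm_mult z w mult.commute)
qed

lemma integrable_poisson_kernel:
  fixes f :: "complex \<Rightarrow> complex"
  assumes z: "norm z < 1" and f: "integrable circle_measure f"
  shows "integrable circle_measure (\<lambda>w. of_real (poisson_kernel z w) * f w)"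
proof -
  note [measurable] = borel_measurable_integrable[OF f]
  have [measurable]: "poisson_kernel z \<in> borel_measurable circle_measure"
    unfolding poisson_kernel_def[abs_def] by measurable
  show ?thesis
  proof (rule Bochner_Integration.integrable_bound[OF integrable_herglotz_kernel[OF z f]])
    show "AE w in circle_measure. norm (of_real (poisson_kernel z w) * f w) \<le> norm ((w + z) / (w - z) * f w)"
      unfolding norm_mult norm_of_real poisson_kernel_def
      by (intro AE_I2 mult_right_mono abs_Re_le_cmod norm_ge_zero)
  qed measurable
qed

lemma poisson_eq:
  assumes z: "norm z < 1" and f: "integrable circle_measure f"
  shows "poisson f z = (\<Sum>n. fourier_coeff f (int n) * z ^ n) +
    (\<Sum>n. fourier_coeff f (- int n) * cnj z ^ n) - fourier_coeff f 0"
proof -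
  have z': "norm (cnj z) < 1" using z by simp
  note s1 = integral_uniform_series[OF summable_norm_geometric[OF z] f, of "\<lambda>n. zpow (- int n)", OF zpow_measurable norm_zpow]
  note s2 = integral_uniform_series[OF summable_norm_geometric[OF z'] f, of "\<lambda>n. zpow (int n)", OF zpow_measurable norm_zpow]
  have "poisson f z = (LINT w|circle_measure. (\<Sum>n. z ^ n * zpow (- int n) w) * f w +
      (\<Sum>n. cnj z ^ n * zpow (int n) w) * f w - f w)"
    unfolding poisson_def
    by (rule Bochner_Integration.integral_cong) (auto simp: poisson_kernel_eq[OF z] algebra_simps)
  also have "\<dots> = (LINT w|circle_measure. (\<Sum>n. z ^ n * zpow (- int n) w) * f w) +
      (LINT w|circle_measure. (\<Sum>n. cnj z ^ n * zpow (int n) w) * f w) - fourier_coeff f 0"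
    using s1(1) s2(1) f by (simp add: fourier_coeff_eq_integral)
  finally show ?thesis
    using sums_unique[OF s1(2)] sums_unique[OF s2(2)] by (simp add: fourier_coeff_eq_integral mult.commute)
qed

lemma poisson_zpow:
  assumes z: "norm z = 1" and r: "0 \<le> r" "r < 1"
  shows "poisson (zpow m) (of_real r * z) = of_real (r ^ nat \<bar>m\<bar>) * zpow m z"
proof -
  let ?z = "of_real r * z"
  have rz: "norm ?z < 1" using z r by (simp add: norm_mult)
  have int: "integrable circle_measure (zpow m)"
    by (rule L2_integral_norm_le(1)[OF circle.finite_measure_axioms zpow_L2])
  have fc: "fourier_coeff (zpow m) n = (if n = m then 1 else 0)" for n
    by (simp add: fourier_coeff_eq_inner inner_zpow)
  have s1: "(\<Sum>n. fourier_coeff (zpow m) (int n) * ?z ^ n) = (if 0 \<le> m then ?z ^ nat m else 0)"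
    by (subst suminf_finite[of "{nat m}"]) (auto simp: fc)
  have s2: "(\<Sum>n. fourier_coeff (zpow m) (- int n) * cnj ?z ^ n) = (if m \<le> 0 then cnj ?z ^ nat (- m) else 0)"
    by (subst suminf_finite[of "{nat (- m)}"]) (auto simp: fc)
  have "cnj z = inverse z" by (rule cnj_unit[OF z])
  then show ?thesis
    unfolding poisson_eq[OF rz int] s1 s2 unfolding fc
    by (cases m "0 :: int" rule: linorder_cases)
      (auto simp: zpow_def power_int_def power_mult_distrib)
qed

text \<open>The series over negative frequencies in \<open>poisson_eq\<close> collapses to its
  constant term, which is the one subtracted there. Boundary limits of Poisson integrals thereby
  become boundary limits of the holomorphic function.\<close>

lemma poisson_hardy2:
  assumes z: "norm z < 1" and f: "f \<in> hardy2"
  shows "poisson f z = hardy_ext f z"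
proof -
  have int: "integrable circle_measure f"
    using f by (intro L2_integral_norm_le(1)[OF circle.finite_measure_axioms]) (simp add: hardy2_def)
  have "(\<Sum>n. fourier_coeff f (- int n) * cnj z ^ n) = fourier_coeff f 0"
    using f by (subst suminf_finite[of "{0}"]) (auto simp: hardy2_def)
  then show ?thesis unfolding poisson_eq[OF z int] hardy_ext_def by simp
qed

lemma integral_poisson_kernel:
  assumes z: "norm z < 1"
  shows "integrable circle_measure (poisson_kernel z)" "(LINT w|circle_measure. poisson_kernel z w) = 1"
proof -
  have one: "integrable circle_measure (\<lambda>w. 1 :: complex)" by simp
  have i: "integrable circle_measure (\<lambda>w. complex_of_real (poisson_kernel z w))"
    using integrable_poisson_kernel[OF z one] by simp
  then show "integrable circle_measure (poisson_kernel z)" using integrable_Re[OF i] by simp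
  have "poisson (\<lambda>w. 1) z = 1"
    unfolding poisson_eq[OF z one] fourier_coeff_const
    by (subst (1 2) suminf_finite[of "{0}"]) auto
  then have "complex_of_real (LINT w|circle_measure. poisson_kernel z w) = 1"
    unfolding poisson_def by simp
  then show "(LINT w|circle_measure. poisson_kernel z w) = 1" by (simp only: of_real_eq_1_iff)
qed

section \<open>Boundary convergence of Poisson integrals in the mean\<close>

lemma poisson_measurable:
  assumes [measurable]: "f \<in> borel_measurable circle_measure"
  shows "(\<lambda>z. poisson f (of_real r * z)) \<in> borel_measurable circle_measure"
    "(\<lambda>p. poisson_kernel (of_real r * fst p) (snd p)) \<in> borel_measurable (circle_measure \<Otimes>\<^sub>M circle_measure)"
    "(\<lambda>p. poisson_kernel (of_real r * snd p) (fst p)) \<in> borel_measurable (circle_measure \<Otimes>\<^sub>M circle_measure)"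
proof -
  have [measurable]: "fst \<in> borel_measurable (circle_measure \<Otimes>\<^sub>M circle_measure)"
    "snd \<in> borel_measurable (circle_measure \<Otimes>\<^sub>M circle_measure)"
    using measurable_compose[OF measurable_fst circle_ident_measurable]
      measurable_compose[OF measurable_snd circle_ident_measurable] by simp_all
  show [measurable]: "(\<lambda>p. poisson_kernel (of_real r * fst p) (snd p)) \<in> borel_measurable (circle_measure \<Otimes>\<^sub>M circle_measure)"
    unfolding poisson_kernel_def by measurable
  show "(\<lambda>p. poisson_kernel (of_real r * snd p) (fst p)) \<in> borel_measurable (circle_measure \<Otimes>\<^sub>M circle_measure)"
    unfolding poisson_kernel_def by measurable
  have "(\<lambda>p. of_real (poisson_kernel (of_real r * fst p) (snd p)) * f (snd p)) \<in>
      borel_measurable (circle_measure \<Otimes>\<^sub>M circle_measure)" by measurable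
  then show "(\<lambda>z. poisson f (of_real r * z)) \<in> borel_measurable circle_measure"
    unfolding poisson_def
    by (intro circle.borel_measurable_lebesgue_integral) (simp add: case_prod_beta')
qed

text \<open>Tonelli's theorem: after exchanging the integrals the kernel is integrated over its
  outer variable and, by symmetry, contributes 1. Nonnegative integrals come first so that
  integrability results together with the bound.\<close>

lemma poisson_contraction:
  assumes f: "integrable circle_measure f" and r: "0 \<le> r" "r < 1"
  shows "integrable circle_measure (\<lambda>z. poisson f (of_real r * z))"
    "(LINT z|circle_measure. norm (poisson f (of_real r * z))) \<le> (LINT z|circle_measure. norm (f z))"
proof -
  interpret pair_prob_space circle_measure circle_measure ..
  note fm[measurable] = borel_measurable_integrable[OF f]
  note [measurable] = poisson_measurable[OF fm]
  have rz: "norm (of_real r * z) < 1" if "norm z = 1" for z :: complex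
    using that r by (simp add: norm_mult)
  have "(\<integral>\<^sup>+ z. ennreal (norm (poisson f (of_real r * z))) \<partial>circle_measure) \<le>
      (\<integral>\<^sup>+ z. (\<integral>\<^sup>+ w. ennreal (poisson_kernel (of_real r * z) w) * ennreal (norm (f w)) \<partial>circle_measure) \<partial>circle_measure)"
  proof (rule nn_integral_mono)
    fix z assume "z \<in> space circle_measure"
    then have z: "norm (of_real r * z) < 1" by (simp add: rz)
    have "ennreal (norm (poisson f (of_real r * z))) \<le>
        (\<integral>\<^sup>+ w. ennreal (norm (of_real (poisson_kernel (of_real r * z) w) * f w)) \<partial>circle_measure)"
      unfolding poisson_def by (rule integral_norm_bound_ennreal[OF integrable_poisson_kernel[OF z f]])
    also have "\<dots> = (\<integral>\<^sup>+ w. ennreal (poisson_kernel (of_real r * z) w) * ennreal (norm (f w)) \<partial>circle_measure)"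
      by (rule nn_integral_cong) (simp add: norm_mult poisson_kernel_pos[OF z] ennreal_mult)
    finally show "ennreal (norm (poisson f (of_real r * z))) \<le> \<dots>" .
  qed
  also have "\<dots> = (\<integral>\<^sup>+ w. (\<integral>\<^sup>+ z. ennreal (poisson_kernel (of_real r * z) w) * ennreal (norm (f w)) \<partial>circle_measure) \<partial>circle_measure)"
    by (rule Fubini') (simp add: case_prod_beta')
  also have "\<dots> = (\<integral>\<^sup>+ w. ennreal (norm (f w)) \<partial>circle_measure)"
  proof (rule nn_integral_cong)
    fix w assume "w \<in> space circle_measure"
    then have w: "norm w = 1" by simp
    note k = integral_poisson_kernel[OF rz[OF w]]
    note [measurable] = borel_measurable_integrable[OF k(1)]
    have "(\<integral>\<^sup>+ z. ennreal (poisson_kernel (of_real r * z) w) * ennreal (norm (f w)) \<partial>circle_measure) =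
        (\<integral>\<^sup>+ z. ennreal (poisson_kernel (of_real r * w) z) * ennreal (norm (f w)) \<partial>circle_measure)"
      by (rule nn_integral_cong) (simp add: poisson_kernel_sym[OF r _ w])
    also have "\<dots> = (\<integral>\<^sup>+ z. ennreal (poisson_kernel (of_real r * w) z) \<partial>circle_measure) * ennreal (norm (f w))"
      by (rule nn_integral_multc) measurable
    also have "(\<integral>\<^sup>+ z. ennreal (poisson_kernel (of_real r * w) z) \<partial>circle_measure) = 1"
      by (subst nn_integral_eq_integral[OF k(1)]) (auto intro!: AE_circle poisson_kernel_pos rz[OF w] simp: k(2))
    finally show "(\<integral>\<^sup>+ z. ennreal (poisson_kernel (of_real r * z) w) * ennreal (norm (f w)) \<partial>circle_measure) =
        ennreal (norm (f w))" by simp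
  qed
  also have "\<dots> = ennreal (LINT w|circle_measure. norm (f w))"
    using f by (intro nn_integral_eq_integral) auto
  finally have *: "(\<integral>\<^sup>+ z. ennreal (norm (poisson f (of_real r * z))) \<partial>circle_measure) \<le>
      ennreal (LINT w|circle_measure. norm (f w))" .
  show int: "integrable circle_measure (\<lambda>z. poisson f (of_real r * z))"
    using * by (intro integrableI_bounded) (auto intro: le_less_trans)
  show "(LINT z|circle_measure. norm (poisson f (of_real r * z))) \<le> (LINT z|circle_measure. norm (f z))"
    using * nn_integral_eq_integral[OF integrable_norm[OF int]] by simp
qed

text \<open>Cutting \<open>f\<close> off where it is large gives a bounded function close in
  \<open>L\<^sup>1\<close>; density in \<open>L\<^sup>2\<close> applies to it, and on a probability
  space the \<open>L\<^sup>1\<close> norm is at most the \<open>L\<^sup>2\<close> norm.\<close>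

lemma trig_polynomial_dense_L1:
  assumes f: "integrable circle_measure f" and e: "e > 0"
  obtains F a where "finite F" "(LINT z|circle_measure. norm (f z - (\<Sum>n\<in>F. a n * zpow n z))) < e"
proof -
  note [measurable] = borel_measurable_integrable[OF f]
  define g where "g n z = (if norm (f z) \<le> real n then f z else 0)" for n z
  have gm[measurable]: "g n \<in> borel_measurable circle_measure" for n unfolding g_def by measurable
  have gL: "g n \<in> L2 circle_measure" for n
    by (rule L2_circle_bounded[where B = "real n"]) (auto simp: g_def)
  have "(\<lambda>n. LINT z|circle_measure. norm (f z - g n z)) \<longlonglongrightarrow> (LINT z|circle_measure. 0)"
  proof (rule integral_dominated_convergence[where w = "\<lambda>z. norm (f z)"])
    show "AE z in circle_measure. (\<lambda>n. norm (f z - g n z)) \<longlonglongrightarrow> 0"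
    proof (rule AE_I2)
      fix z
      obtain N where "norm (f z) \<le> real N" using real_arch_simple by blast
      then have "norm (f z - g n z) = 0" if "n \<ge> N" for n
        using that by (simp add: g_def)
      then have "\<forall>\<^sub>F n in sequentially. norm (f z - g n z) = 0"
        unfolding eventually_sequentially by blast
      then show "(\<lambda>n. norm (f z - g n z)) \<longlonglongrightarrow> 0" by (rule tendsto_eventually)
    qed
  qed (use f in \<open>auto simp: g_def\<close>)
  then have "(\<lambda>n. LINT z|circle_measure. norm (f z - g n z)) \<longlonglongrightarrow> 0" by simp
  from order_tendstoD(2)[OF this half_gt_zero[OF e]]
  obtain n where n: "(LINT z|circle_measure. norm (f z - g n z)) < e / 2"
    by (auto simp: eventually_sequentially)
  have "g n \<in> L2_closed_span circle_measure zpow UNIV"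
    using gL by (simp add: trig_span_eq_L2 flip: trig_span_def)
  from this[unfolded L2_closed_span_iff, THEN conjunct2, rule_format, OF half_gt_zero[OF e]]
  obtain F a where F: "finite F" "L2_norm circle_measure (\<lambda>z. g n z - (\<Sum>m\<in>F. a m * zpow m z)) < e / 2"
    by blast
  let ?p = "\<lambda>z. \<Sum>m\<in>F. a m * zpow m z"
  have p: "?p \<in> L2 circle_measure" by (rule L2_sum[OF zpow_L2])
  note L1 = L2_integral_norm_le[OF circle.finite_measure_axioms]
  have "(LINT z|circle_measure. norm (g n z - ?p z)) < e / 2"
    using L1(2)[OF L2_diff[OF gL p], of n] F(2) by (simp add: circle.prob_space[simplified])
  moreover have "(LINT z|circle_measure. norm (f z - ?p z)) \<le>
      (LINT z|circle_measure. norm (f z - g n z) + norm (g n z - ?p z))"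
    using f L1(1)[OF gL] L1(1)[OF p] norm_triangle_ineq[of "f z - g n z" "g n z - ?p z" for z]
    by (intro integral_mono) auto
  moreover have "\<dots> = (LINT z|circle_measure. norm (f z - g n z)) + (LINT z|circle_measure. norm (g n z - ?p z))"
    using f L1(1)[OF gL] L1(1)[OF p] by (intro Bochner_Integration.integral_add) auto
  ultimately have "(LINT z|circle_measure. norm (f z - ?p z)) < e" using n by linarith
  with F(1) show ?thesis by (rule that)
qed

lemma poisson_diff:
  assumes "norm z < 1" "integrable circle_measure f" "integrable circle_measure g"
  shows "poisson (\<lambda>w. f w - g w) z = poisson f z - poisson g z"
  unfolding poisson_def
  using integrable_poisson_kernel[OF assms(1,2)] integrable_poisson_kernel[OF assms(1,3)]
  by (simp add: right_diff_distrib)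

lemma poisson_sum:
  assumes z: "norm z < 1"
  shows "poisson (\<lambda>w. \<Sum>n\<in>F. a n * zpow n w) z = (\<Sum>n\<in>F. a n * poisson (zpow n) z)"
proof -
  have i: "integrable circle_measure (\<lambda>w. of_real (poisson_kernel z w) * zpow n w)" for n
    by (intro integrable_poisson_kernel[OF z] L2_integral_norm_le(1)[OF circle.finite_measure_axioms zpow_L2])
  have "poisson (\<lambda>w. \<Sum>n\<in>F. a n * zpow n w) z =
      (LINT w|circle_measure. (\<Sum>n\<in>F. a n * (of_real (poisson_kernel z w) * zpow n w)))"
    unfolding poisson_def by (simp add: sum_distrib_left mult_ac)
  also have "\<dots> = (\<Sum>n\<in>F. a n * poisson (zpow n) z)"
    unfolding poisson_def using i by (subst Bochner_Integration.integral_sum) auto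
  finally show ?thesis .
qed

text \<open>For a trigonometric polynomial the convergence is explicit and uniform. The contraction
  property transfers it to all integrable functions.\<close>

lemma poisson_tendsto_L1:
  assumes f: "integrable circle_measure f"
    and r: "\<And>i. 0 \<le> r i" "\<And>i. r i < 1" "r \<longlonglongrightarrow> 1"
  shows "(\<lambda>i. LINT z|circle_measure. norm (poisson f (of_real (r i) * z) - f z)) \<longlonglongrightarrow> 0"
proof (rule LIMSEQ_I)
  fix e :: real assume "e > 0"
  then have "e / 3 > 0" by simp
  from trig_polynomial_dense_L1[OF f this]
  obtain F a where F: "finite F" "(LINT z|circle_measure. norm (f z - (\<Sum>n\<in>F. a n * zpow n z))) < e / 3" .
  let ?p = "\<lambda>z. \<Sum>n\<in>F. a n * zpow n z"
  have p: "integrable circle_measure ?p"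
    by (rule L2_integral_norm_le(1)[OF circle.finite_measure_axioms L2_sum[OF zpow_L2]])
  have fp: "integrable circle_measure (\<lambda>z. f z - ?p z)" using f p by simp
  \<comment> \<open>\<open>d i\<close> bounds, uniformly on the circle, the change of the polynomial
    under the Poisson integral, which multiplies frequency \<open>n\<close> by
    \<open>r i ^ nat \<bar>n\<bar>\<close>.\<close>
  define d where "d i = (\<Sum>n\<in>F. norm (a n) * (1 - r i ^ nat \<bar>n\<bar>))" for i
  have "d \<longlonglongrightarrow> (\<Sum>n\<in>F. norm (a n) * (1 - 1 ^ nat \<bar>n\<bar>))"
    unfolding d_def by (intro tendsto_intros r)
  then have "d \<longlonglongrightarrow> 0" by simp
  from order_tendstoD(2)[OF this \<open>e / 3 > 0\<close>]
  obtain N where N: "\<And>i. i \<ge> N \<Longrightarrow> d i < e / 3" by (auto simp: eventually_sequentially)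
  have "norm ((LINT z|circle_measure. norm (poisson f (of_real (r i) * z) - f z)) - 0) < e" if "i \<ge> N" for i
  proof -
    let ?P = "\<lambda>g z. poisson g (of_real (r i) * z)"
    note con = poisson_contraction[OF fp r(1,2)[of i]]
    have rz: "norm (of_real (r i) * z) < 1" if "norm z = 1" for z :: complex
      using that r by (simp add: norm_mult)
    have bound: "norm (?P f z - f z) \<le> norm (?P (\<lambda>z. f z - ?p z) z) + d i + norm (f z - ?p z)"
      if z: "norm z = 1" for z
    proof -
      have "?P ?p z - ?p z = (\<Sum>n\<in>F. a n * (of_real (r i ^ nat \<bar>n\<bar>) - 1) * zpow n z)"
        unfolding poisson_sum[OF rz[OF z]] poisson_zpow[OF z r(1,2)] sum_subtractf[symmetric]
        by (simp add: algebra_simps)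
      also have "norm \<dots> \<le> (\<Sum>n\<in>F. norm (a n * (of_real (r i ^ nat \<bar>n\<bar>) - 1) * zpow n z))"
        by (rule norm_sum)
      also have "\<dots> = d i"
        unfolding d_def
      proof (rule sum.cong[OF refl])
        fix n
        have "norm (complex_of_real (r i ^ nat \<bar>n\<bar>) - 1) = norm (complex_of_real (r i ^ nat \<bar>n\<bar> - 1))" by simp
        also have "\<dots> = 1 - r i ^ nat \<bar>n\<bar>"
          using power_le_one[OF r(1), of i "nat \<bar>n\<bar>"] less_imp_le[OF r(2)[of i]] unfolding norm_of_real by simp
        finally show "norm (a n * (of_real (r i ^ nat \<bar>n\<bar>) - 1) * zpow n z) = norm (a n) * (1 - r i ^ nat \<bar>n\<bar>)"
          by (simp add: norm_mult norm_zpow[OF z])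
      qed
      finally have d: "norm (?P ?p z - ?p z) \<le> d i" .
      have eq: "?P f z - f z = (?P (\<lambda>z. f z - ?p z) z + (?P ?p z - ?p z)) - (f z - ?p z)"
        unfolding poisson_diff[OF rz[OF z] f p] by simp
      show ?thesis
        unfolding eq using norm_triangle_ineq4[of "?P (\<lambda>z. f z - ?p z) z + (?P ?p z - ?p z)" "f z - ?p z"]
          norm_triangle_ineq[of "?P (\<lambda>z. f z - ?p z) z" "?P ?p z - ?p z"] d by linarith
    qed
    have "(LINT z|circle_measure. norm (?P f z - f z)) \<le>
        (LINT z|circle_measure. norm (?P (\<lambda>z. f z - ?p z) z) + d i + norm (f z - ?p z))"
      using poisson_contraction(1)[OF f r(1,2)[of i]] con(1) f fp
      by (intro integral_mono) (auto simp: bound)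
    also have "\<dots> = (LINT z|circle_measure. norm (?P (\<lambda>z. f z - ?p z) z)) + d i + (LINT z|circle_measure. norm (f z - ?p z))"
      using con(1) fp by (simp add: circle.prob_space[simplified])
    also have "\<dots> < e" using con(2) F(2) N[OF that] by linarith
    finally show ?thesis by simp
  qed
  then show "\<exists>N. \<forall>i\<ge>N. norm ((LINT z|circle_measure. norm (poisson f (of_real (r i) * z) - f z)) - 0) < e" by blast
qed

section \<open>Outer functions are cyclic\<close>

lemma hardy2_integrable: "f \<in> hardy2 \<Longrightarrow> integrable circle_measure f"
  by (rule L2_integral_norm_le(1)[OF circle.finite_measure_axioms]) (simp add: hardy2_def)

lemma Re_herglotz:
  fixes k :: "complex \<Rightarrow> real"
  assumes z: "norm z < 1" and k: "integrable circle_measure k"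
  shows "Re (herglotz (\<lambda>w. of_real (k w)) z) = (LINT w|circle_measure. poisson_kernel z w * k w)"
    "Re (herglotz (\<lambda>w. of_real (k w)) z) = Re (poisson (\<lambda>w. of_real (k w)) z)"
    "integrable circle_measure (\<lambda>w. poisson_kernel z w * k w)"
proof -
  have Re_mult: "Re (a * complex_of_real x) = Re a * x" for a x by simp
  have k': "integrable circle_measure (\<lambda>w. complex_of_real (k w))" using k by simp
  have int: "integrable circle_measure (\<lambda>w. (w + z) / (w - z) * complex_of_real (k w))"
    by (rule integrable_herglotz_kernel[OF z k'])
  show 1: "Re (herglotz (\<lambda>w. of_real (k w)) z) = (LINT w|circle_measure. poisson_kernel z w * k w)"
    unfolding herglotz_def integral_Re[OF int, symmetric] poisson_kernel_def Re_mult ..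
  have "poisson (\<lambda>w. of_real (k w)) z = of_real (LINT w|circle_measure. poisson_kernel z w * k w)"
    unfolding poisson_def integral_complex_of_real[symmetric] by simp
  then show "Re (herglotz (\<lambda>w. of_real (k w)) z) = Re (poisson (\<lambda>w. of_real (k w)) z)"
    using 1 by simp
  show "integrable circle_measure (\<lambda>w. poisson_kernel z w * k w)"
    using integrable_Re[OF int] unfolding poisson_kernel_def Re_mult .
qed

lemma herglotz_holomorphic:
  assumes f: "integrable circle_measure f"
  shows "herglotz f holomorphic_on ball 0 1"
  by (rule power_series_holomorphic[where a = "\<lambda>n. (if n = 0 then 1 else 2) * fourier_coeff f (int n)"])
    (use herglotz_sums[OF _ f] in auto)

lemma herglotz_0: "herglotz f 0 = (LINT w|circle_measure. f w)"
  unfolding herglotz_def by (rule Bochner_Integration.integral_cong) auto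

definition radius :: "nat \<Rightarrow> real" where
  "radius i = real (Suc i) / real (Suc (Suc i))"

lemma radius: "0 \<le> radius i" "radius i < 1" "radius \<longlonglongrightarrow> 1"
proof -
  show "0 \<le> radius i" "radius i < 1" by (auto simp: radius_def)
  show "radius \<longlonglongrightarrow> 1"
    unfolding radius_def using LIMSEQ_Suc[OF LIMSEQ_n_over_Suc_n] by simp
qed

lemma norm_radius_mult: "norm (z :: complex) = 1 \<Longrightarrow> norm (of_real (radius i) * z) < 1"
  using radius(1,2)[of i] by (simp add: norm_mult)

text \<open>The subsequence is extracted from a prescribed one, so that two functions can be given a
  common sequence of radii by applying the lemma twice.\<close>

lemma poisson_AE_subseq:
  assumes f: "integrable circle_measure f" and s: "strict_mono s"
  obtains r where "strict_mono (r :: nat \<Rightarrow> nat)"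
    "AE z in circle_measure. (\<lambda>i. poisson f (of_real (radius (s (r i))) * z)) \<longlonglongrightarrow> f z"
proof -
  have "(\<lambda>i. LINT z|circle_measure. norm (poisson f (of_real (radius (s i)) * z) - f z)) \<longlonglongrightarrow> 0"
    using LIMSEQ_subseq_LIMSEQ[OF radius(3) s]
    by (intro poisson_tendsto_L1 f radius(1,2)) (simp add: comp_def)
  then obtain r where r: "strict_mono (r :: nat \<Rightarrow> nat)"
      "AE z in circle_measure. (\<lambda>i. poisson f (of_real (radius (s (r i))) * z) - f z) \<longlonglongrightarrow> 0"
    using tendsto_L1_AE_subseq[where M = circle_measure and u = "\<lambda>i z. poisson f (of_real (radius (s i)) * z) - f z"]
      poisson_contraction(1)[OF f radius(1,2)] f by auto
  from r(2) have "AE z in circle_measure. (\<lambda>i. poisson f (of_real (radius (s (r i))) * z)) \<longlonglongrightarrow> f z"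
    by eventually_elim (rule LIM_zero_cancel)
  with r(1) show ?thesis by (rule that)
qed

lemma outer_functionE:
  assumes "outer_function f"
  obtains c k where "f \<in> hardy2" "norm c = 1" "integrable circle_measure k"
    "\<And>z. norm z < 1 \<Longrightarrow> hardy_ext f z = c * exp (herglotz (\<lambda>w. of_real (k w)) z)"
  using assms unfolding outer_function_def herglotz_def[symmetric] by auto

text \<open>In the disc the modulus is the exponential of the Poisson integral of \<open>k\<close>.
  Along a common sequence of radii both the function and the exponent tend to their boundary
  values.\<close>

lemma norm_outer_boundary:
  assumes f: "f \<in> hardy2" and c: "norm c = 1" and k: "integrable circle_measure k"
    and ext: "\<And>z. norm z < 1 \<Longrightarrow> hardy_ext f z = c * exp (herglotz (\<lambda>w. of_real (k w)) z)"
  shows "AE z in circle_measure. norm (f z) = exp (k z)"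
proof -
  have k': "integrable circle_measure (\<lambda>w. complex_of_real (k w))" using k by simp
  obtain s where s: "strict_mono (s :: nat \<Rightarrow> nat)"
      "AE z in circle_measure. (\<lambda>i. poisson f (of_real (radius (s i)) * z)) \<longlonglongrightarrow> f z"
    using poisson_AE_subseq[OF hardy2_integrable[OF f] strict_mono_id] by auto
  obtain r where r: "strict_mono (r :: nat \<Rightarrow> nat)"
      "AE z in circle_measure. (\<lambda>i. poisson (\<lambda>w. of_real (k w)) (of_real (radius (s (r i))) * z)) \<longlonglongrightarrow> of_real (k z)"
    by (rule poisson_AE_subseq[OF k' s(1)])
  from s(2) r(2) AE_space show ?thesis
  proof eventually_elim
    case (elim z)
    then have z: "norm z = 1" by simp
    let ?r = "\<lambda>i. of_real (radius (s (r i))) * z"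
    have "(\<lambda>i. norm (poisson f (?r i))) \<longlonglongrightarrow> norm (f z)"
      using LIMSEQ_subseq_LIMSEQ[OF elim(1) r(1)] by (intro tendsto_norm) (simp add: comp_def)
    moreover have "norm (poisson f (?r i)) = exp (Re (poisson (\<lambda>w. of_real (k w)) (?r i)))" for i
      using norm_radius_mult[OF z, of "s (r i)"] Re_herglotz(2)[OF _ k, of "?r i"]
      by (simp add: poisson_hardy2[OF _ f] ext norm_mult c)
    moreover have "(\<lambda>i. exp (Re (poisson (\<lambda>w. of_real (k w)) (?r i)))) \<longlonglongrightarrow> exp (Re (of_real (k z)))"
      by (intro tendsto_intros elim(2))
    ultimately show "norm (f z) = exp (k z)"
      using LIMSEQ_unique by simp blast
  qed
qed

lemma outer_function_nonzero:
  assumes "outer_function f"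
  shows "AE z in circle_measure. f z \<noteq> 0"
proof -
  obtain c k where f: "f \<in> hardy2" and c: "norm c = 1" and k: "integrable circle_measure k"
    and ext: "\<And>z. norm z < 1 \<Longrightarrow> hardy_ext f z = c * exp (herglotz (\<lambda>w. of_real (k w)) z)"
    using assms by (rule outer_functionE) blast
  have "AE z in circle_measure. norm (f z) = exp (k z)"
    by (rule norm_outer_boundary[OF f c k ext])
  then show ?thesis by eventually_elim auto
qed

text \<open>For \<open>r < 1\<close> the Taylor series of the dilated \<open>h\<close> converges
  absolutely and uniformly on the circle, so its partial sums times \<open>f\<close> converge in
  \<open>L\<^sup>2\<close> and the integral can be taken term by term.\<close>

lemma holomorphic_dilation_mult:
  assumes h: "h holomorphic_on ball 0 1" and r: "0 \<le> r" "r < 1" and f: "f \<in> hardy2"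
  shows "(\<lambda>z. h (of_real r * z) * f z) \<in> L2_closed_span circle_measure (\<lambda>n z. zpow n z * f z) {0..}"
    "(LINT z|circle_measure. h (of_real r * z) * f z) = h 0 * fourier_coeff f 0"
proof -
  define b where "b n = (deriv ^^ n) h 0 / fact n" for n
  have ser: "(\<lambda>n. b n * z ^ n) sums h z" if "norm z < 1" for z
    using holomorphic_power_series[OF h, of z] that by (simp add: b_def)
  have b0: "b 0 = h 0" by (simp add: b_def)
  \<comment> \<open>Convergence at the larger radius \<open>s\<close> yields absolute convergence at
    \<open>r\<close>.\<close>
  obtain s where s: "r < s" "s < 1" using dense[OF r(2)] by blast
  have "summable (\<lambda>n. b n * of_real s ^ n)"
    using ser[of "of_real s"] s r by (auto intro: sums_summable)
  then have sm: "summable (\<lambda>n. norm (b n * of_real r ^ n))"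
    by (rule powser_insidea) (use s r in auto)
  have hs: "(\<Sum>n. b n * of_real r ^ n * zpow (int n) z) = h (of_real r * z)" if "norm z = 1" for z
    using sums_unique[OF ser[of "of_real r * z"]] that r
    by (simp add: norm_mult power_mult_distrib zpow_of_nat mult.assoc)
  have fL: "f \<in> L2 circle_measure" using f by (simp add: hardy2_def)
  note fm[measurable] = L2_measurable[OF fL]
  note ser' = integral_uniform_series[OF sm hardy2_integrable[OF f], of "\<lambda>n. zpow (int n)", OF zpow_measurable norm_zpow]
  have eq: "(LINT z|circle_measure. (\<Sum>n. b n * of_real r ^ n * zpow (int n) z) * f z) =
      (LINT z|circle_measure. h (of_real r * z) * f z)"
    by (rule Bochner_Integration.integral_cong) (auto simp: hs)
  \<comment> \<open>This integral is the Fourier coefficient of \<open>f\<close> at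
    \<open>- n\<close>, so only the constant Taylor term survives.\<close>
  have "(LINT z|circle_measure. zpow (int n) z * f z) = (if n = 0 then fourier_coeff f 0 else 0)" for n
    using f fourier_coeff_eq_integral[of f "- int n"] by (auto simp: hardy2_def)
  then have "(\<lambda>n. b n * of_real r ^ n * (if n = 0 then fourier_coeff f 0 else 0)) sums
      (LINT z|circle_measure. h (of_real r * z) * f z)"
    using ser'(2) unfolding eq by simp
  moreover have "(\<lambda>n. b n * of_real r ^ n * (if n = 0 then fourier_coeff f 0 else 0)) sums (h 0 * fourier_coeff f 0)"
  proof -
    have "(\<lambda>n. b n * of_real r ^ n * (if n = 0 then fourier_coeff f 0 else 0)) =
        (\<lambda>n. if n = 0 then b n * of_real r ^ n * fourier_coeff f 0 else 0)" by auto
    then show ?thesis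
      using sums_single[of 0 "\<lambda>n. b n * of_real r ^ n * fourier_coeff f 0"] b0 by simp
  qed
  ultimately show "(LINT z|circle_measure. h (of_real r * z) * f z) = h 0 * fourier_coeff f 0"
    by (rule sums_unique2)
  let ?S = "L2_closed_span circle_measure (\<lambda>n z. zpow n z * f z) {0..}"
  have S: "L2_subspace circle_measure ?S" by (rule L2_subspace_closed_span[OF zpow_mult_L2[OF fL]])
  have ul: "uniform_limit (sphere 0 1) (\<lambda>N z. \<Sum>n<N. b n * of_real r ^ n * zpow (int n) z)
      (\<lambda>z. \<Sum>n. b n * of_real r ^ n * zpow (int n) z) sequentially"
    by (rule Weierstrass_m_test[OF _ sm]) (simp add: norm_mult norm_zpow)
  define p where "p N z = (\<Sum>n<N. b n * of_real r ^ n * zpow (int n) z)" for N z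
  have pm[measurable]: "p N \<in> borel_measurable circle_measure" for N unfolding p_def by measurable
  have ul: "\<exists>N. \<forall>z\<in>sphere 0 1. norm (p N z - h (of_real r * z)) < e" if "e > 0" for e
    using uniform_limitD[OF ul that] unfolding eventually_sequentially
    by (auto simp: p_def hs dist_norm)
  have hm[measurable]: "(\<lambda>z. h (of_real r * z)) \<in> borel_measurable circle_measure"
  proof (rule measurable_cong[THEN iffD1])
    show "(\<lambda>z. \<Sum>n. b n * of_real r ^ n * zpow (int n) z) \<in> borel_measurable circle_measure" by measurable
  qed (simp add: hs)
  have bd: "(\<lambda>z. g z * f z) \<in> L2 circle_measure \<and>
      L2_norm circle_measure (\<lambda>z. g z * f z) \<le> e * L2_norm circle_measure f"
    if [measurable]: "g \<in> borel_measurable circle_measure" and g: "\<And>z. norm z = 1 \<Longrightarrow> norm (g z) \<le> e"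
    for g e
  proof
    have e: "0 \<le> e" using order_trans[OF norm_ge_zero g[of 1]] by simp
    show gf: "(\<lambda>z. g z * f z) \<in> L2 circle_measure"
      by (rule L2_bounded_mult[OF fL, of _ e]) (auto intro!: AE_circle g)
    have "(LINT z|circle_measure. (norm (g z * f z))\<^sup>2) \<le> (LINT z|circle_measure. e\<^sup>2 * (norm (f z))\<^sup>2)"
      using L2_integrable[OF gf] L2_integrable[OF fL] e
      by (intro integral_mono) (auto simp: norm_mult power_mult_distrib intro!: mult_right_mono power_mono g)
    then have "(L2_norm circle_measure (\<lambda>z. g z * f z))\<^sup>2 \<le> (e * L2_norm circle_measure f)\<^sup>2"
      by (simp add: L2_norm_square power_mult_distrib)
    then show "L2_norm circle_measure (\<lambda>z. g z * f z) \<le> e * L2_norm circle_measure f"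
      by (rule power2_le_imp_le) (intro mult_nonneg_nonneg e L2_norm_nonneg)
  qed
  have pS: "(\<lambda>z. p N z * f z) \<in> ?S" for N
  proof -
    have "(\<lambda>z. \<Sum>n<N. b n * of_real r ^ n * (zpow (int n) z * f z)) \<in> ?S"
      by (rule L2_subspace_sum[OF S, of _ "\<lambda>n z. zpow (int n) z * f z"])
        (rule L2_closed_span_superset[where X = "\<lambda>n z. zpow n z * f z", OF _ zpow_mult_L2[OF fL]], simp)
    then show ?thesis by (simp add: p_def sum_distrib_right mult.assoc)
  qed
  show "(\<lambda>z. h (of_real r * z) * f z) \<in> ?S"
  proof (rule L2_subspaceD(4)[OF S])
    obtain N where N: "\<forall>z\<in>sphere 0 1. norm (p N z - h (of_real r * z)) < 1" using ul[of 1] by auto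
    have "(\<lambda>z. (p N z - h (of_real r * z)) * f z) \<in> L2 circle_measure"
      using bd[of "\<lambda>z. p N z - h (of_real r * z)" 1] N by (simp add: less_imp_le)
    from L2_diff[OF L2_subspaceD(1)[OF S pS[of N]] this]
    show "(\<lambda>z. h (of_real r * z) * f z) \<in> L2 circle_measure" by (simp add: algebra_simps)
  next
    fix e :: real assume e: "e > 0"
    let ?K = "L2_norm circle_measure f + 1"
    have K: "?K > 0" using L2_norm_nonneg[of circle_measure f] by simp
    obtain N where N: "\<forall>z\<in>sphere 0 1. norm (p N z - h (of_real r * z)) < e / ?K"
      using ul[of "e / ?K"] e K by auto
    have "L2_norm circle_measure (\<lambda>z. (p N z - h (of_real r * z)) * f z) \<le> e / ?K * L2_norm circle_measure f"
      using bd[of "\<lambda>z. p N z - h (of_real r * z)" "e / ?K"] N by (simp add: less_imp_le)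
    also have "\<dots> < e" using e K by (simp add: field_simps)
    finally have "L2_norm circle_measure (\<lambda>z. h (of_real r * z) * f z - p N z * f z) < e"
      by (subst L2_norm_minus_commute) (simp add: algebra_simps)
    then show "\<exists>g\<in>?S. L2_norm circle_measure (\<lambda>z. h (of_real r * z) * f z - g z) < e"
      using pS[of N] by (intro bexI[of _ "\<lambda>z. p N z * f z"])
  qed
qed

lemma outer_constant_in_span:
  assumes "outer_function f"
  shows "(\<lambda>z. 1) \<in> L2_closed_span circle_measure (\<lambda>n z. zpow n z * f z) {0..}"
proof -
  obtain c k where f: "f \<in> hardy2" and c: "norm c = 1" and k: "integrable circle_measure k"
    and ext: "\<And>z. norm z < 1 \<Longrightarrow> hardy_ext f z = c * exp (herglotz (\<lambda>w. of_real (k w)) z)"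
    using assms by (rule outer_functionE) blast
  note [measurable] = borel_measurable_integrable[OF k]
  have fL: "f \<in> L2 circle_measure" using f by (simp add: hardy2_def)
  note fm[measurable] = L2_measurable[OF fL]
  let ?S = "L2_closed_span circle_measure (\<lambda>n z. zpow n z * f z) {0..}"
  have S: "L2_subspace circle_measure ?S" by (rule L2_subspace_closed_span[OF zpow_mult_L2[OF fL]])
  have fk: "AE z in circle_measure. norm (f z) = exp (k z)"
    by (rule norm_outer_boundary[OF f c k ext])
  have cL: "(\<lambda>z. c) \<in> L2 circle_measure"
    by (rule L2_circle_bounded[where B = "norm c"]) auto
  have f0: "fourier_coeff f 0 = c * exp (of_real (LINT z|circle_measure. k z))"
  proof -
    have "fourier_coeff f 0 = hardy_ext f 0"
      unfolding hardy_ext_def by (subst suminf_finite[of "{0}"]) auto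
    then show ?thesis by (simp add: ext herglotz_0)
  qed
  define m where "m n z = max (k z) (- real n)" for n z
  have m[simp]: "integrable circle_measure (m n)" for n
    unfolding m_def using k by (intro integrable_max) auto
  have mm[measurable]: "m n \<in> borel_measurable circle_measure" for n
    by (rule borel_measurable_integrable[OF m])
  have m': "integrable circle_measure (\<lambda>w. complex_of_real (m n w))" for n by simp
  define h where "h n z = exp (- herglotz (\<lambda>w. of_real (m n w)) z)" for n z
  have hol: "h n holomorphic_on ball 0 1" for n
    unfolding h_def by (intro holomorphic_intros herglotz_holomorphic m')
  have norm_h: "norm (h n z) = exp (- Re (poisson (\<lambda>w. of_real (m n w)) z))" if "norm z < 1" for n z
    using Re_herglotz(2)[OF that m, of n] by (simp add: h_def)
  \<comment> \<open>The Poisson kernel is positive with total mass 1, hence averages of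
    \<open>m n\<close>, which is at least \<open>- n\<close>, stay above \<open>- n\<close>. The
    bound is also the majorant for the limit of dilations.\<close>
  have h_bound: "norm (h n z) \<le> exp (real n)" if z: "norm z < 1" for n z
  proof -
    have "(LINT w|circle_measure. poisson_kernel z w * (- real n)) \<le> (LINT w|circle_measure. poisson_kernel z w * m n w)"
      using integral_poisson_kernel[OF z] Re_herglotz(3)[OF z m]
      by (intro integral_mono mult_left_mono) (auto simp: m_def poisson_kernel_pos[OF z])
    then have "- real n \<le> Re (herglotz (\<lambda>w. of_real (m n w)) z)"
      unfolding Re_herglotz(1)[OF z m] using integral_poisson_kernel[OF z] by simp
    then show ?thesis by (simp add: h_def)
  qed
  \<comment> \<open>For fixed \<open>n\<close> the squared norms tend to the integral of
    \<open>exp (2 * (k - m n))\<close>, which is at most 1. A single index \<open>i\<close> is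
    wanted, so the subsequence of radii may depend on \<open>n\<close>.\<close>
  have conv: "\<exists>i. (L2_norm circle_measure (\<lambda>z. h n (of_real (radius i) * z) * f z))\<^sup>2 < 1 + e" if e: "e > 0" for n e
  proof -
    obtain s where s: "strict_mono (s :: nat \<Rightarrow> nat)"
        "AE z in circle_measure. (\<lambda>i. poisson (\<lambda>w. of_real (m n w)) (of_real (radius (s i)) * z)) \<longlonglongrightarrow> of_real (m n z)"
      using poisson_AE_subseq[OF m' strict_mono_id, of n] by auto
    let ?r = "\<lambda>i z. of_real (radius (s i)) * z"
    have "(\<lambda>i. LINT z|circle_measure. (norm (h n (?r i z) * f z))\<^sup>2) \<longlonglongrightarrow>
        (LINT z|circle_measure. (exp (- m n z) * norm (f z))\<^sup>2)"
    proof (rule integral_dominated_convergence[where w = "\<lambda>z. (exp (real n))\<^sup>2 * (norm (f z))\<^sup>2"])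
      show "integrable circle_measure (\<lambda>z. (exp (real n))\<^sup>2 * (norm (f z))\<^sup>2)"
        using L2_integrable[OF fL] by simp
      show "(\<lambda>z. (norm (h n (?r i z) * f z))\<^sup>2) \<in> borel_measurable circle_measure" for i
        using L2_measurable[OF L2_subspaceD(1)[OF S holomorphic_dilation_mult(1)[OF hol radius(1,2) f]], of n "s i"]
        by measurable
      show "AE z in circle_measure. (\<lambda>i. (norm (h n (?r i z) * f z))\<^sup>2) \<longlonglongrightarrow> (exp (- m n z) * norm (f z))\<^sup>2"
        using s(2) AE_space
      proof eventually_elim
        case (elim z)
        then have z: "norm z = 1" by simp
        have "(\<lambda>i. (exp (- Re (poisson (\<lambda>w. of_real (m n w)) (?r i z))) * norm (f z))\<^sup>2) \<longlonglongrightarrow>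
            (exp (- Re (of_real (m n z))) * norm (f z))\<^sup>2"
          by (intro tendsto_intros elim(1))
        then show ?case by (simp add: norm_mult norm_h[OF norm_radius_mult[OF z]])
      qed
      show "AE z in circle_measure. norm ((norm (h n (?r i z) * f z))\<^sup>2) \<le> (exp (real n))\<^sup>2 * (norm (f z))\<^sup>2" for i
      proof (rule AE_circle)
        fix z :: complex assume z: "norm z = 1"
        have "(norm (h n (?r i z)))\<^sup>2 * (norm (f z))\<^sup>2 \<le> (exp (real n))\<^sup>2 * (norm (f z))\<^sup>2"
          by (intro mult_right_mono power_mono h_bound norm_radius_mult z) auto
        then show "norm ((norm (h n (?r i z) * f z))\<^sup>2) \<le> (exp (real n))\<^sup>2 * (norm (f z))\<^sup>2"
          by (simp add: norm_mult power_mult_distrib)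
      qed
    qed measurable
    moreover have "(LINT z|circle_measure. (exp (- m n z) * norm (f z))\<^sup>2) \<le> (LINT z|circle_measure. 1)"
    proof (rule integral_mono_AE')
      show "AE z in circle_measure. (exp (- m n z) * norm (f z))\<^sup>2 \<le> 1"
        using fk
      proof eventually_elim
        case (elim z)
        then have "exp (- m n z) * norm (f z) = exp (k z - m n z)" by (simp add: exp_diff exp_minus field_simps)
        also have "\<dots> \<le> 1" by (simp add: m_def)
        finally show ?case by (intro power_le_one) auto
      qed
    qed auto
    ultimately have "\<forall>\<^sub>F i in sequentially. (LINT z|circle_measure. (norm (h n (?r i z) * f z))\<^sup>2) < 1 + e"
      using e by (intro order_tendstoD(2)) (auto simp: circle.prob_space[simplified])
    then obtain i where "(LINT z|circle_measure. (norm (h n (?r i z) * f z))\<^sup>2) < 1 + e"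
      by (auto simp: eventually_sequentially)
    then show ?thesis unfolding L2_norm_square by blast
  qed
  \<comment> \<open>The exponential of this integral is the factor by which the mean of the product
    differs from \<open>c\<close>: the mean is the product of the values at 0 of \<open>h n\<close>
    and of the extension of \<open>f\<close>.\<close>
  have "(\<lambda>n. LINT z|circle_measure. k z - m n z) \<longlonglongrightarrow> (LINT z|circle_measure. 0)"
  proof (rule integral_dominated_convergence[where w = "\<lambda>z. \<bar>k z\<bar>"])
    show "AE z in circle_measure. (\<lambda>n. k z - m n z) \<longlonglongrightarrow> 0"
    proof (rule AE_I2)
      fix z
      obtain N where "- k z \<le> real N" using real_arch_simple by blast
      then have "k z - m n z = 0" if "n \<ge> N" for n using that by (simp add: m_def)
      then have "\<forall>\<^sub>F n in sequentially. k z - m n z = 0"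
        unfolding eventually_sequentially by blast
      then show "(\<lambda>n. k z - m n z) \<longlonglongrightarrow> 0" by (rule tendsto_eventually)
    qed
    show "AE z in circle_measure. norm (k z - m n z) \<le> \<bar>k z\<bar>" for n
      by (rule AE_I2) (auto simp: m_def max_def)
  qed (use k in auto)
  then have "(\<lambda>n. exp (LINT z|circle_measure. k z - m n z)) \<longlonglongrightarrow> exp 0"
    by (intro tendsto_exp) simp
  then have lim: "(\<lambda>n. exp (LINT z|circle_measure. k z - m n z)) \<longlonglongrightarrow> 1" by simp
  have "(\<lambda>z. c) \<in> ?S"
  proof (rule L2_subspaceD(4)[OF S cL])
    fix e :: real assume e: "e > 0"
    \<comment> \<open>The fractions are chosen for the expansion of the squared distance:
      \<open>1 + (1 + e\<^sup>2 / 2) - 2 * (1 - e\<^sup>2 / 4)\<close> equals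
      \<open>e\<^sup>2\<close>.\<close>
    have "1 - e\<^sup>2 / 4 < 1" using e by simp
    from order_tendstoD(1)[OF lim this]
    obtain n where n: "1 - e\<^sup>2 / 4 < exp (LINT z|circle_measure. k z - m n z)"
      by (auto simp: eventually_sequentially)
    obtain i where i: "(L2_norm circle_measure (\<lambda>z. h n (of_real (radius i) * z) * f z))\<^sup>2 < 1 + e\<^sup>2 / 2"
      using conv[of "e\<^sup>2 / 2" n] e by auto
    let ?g = "\<lambda>z. h n (of_real (radius i) * z) * f z"
    note dil = holomorphic_dilation_mult[OF hol radius(1,2) f, of n i]
    have gL: "?g \<in> L2 circle_measure" by (rule L2_subspaceD(1)[OF S dil(1)])
    have "L2_inner circle_measure (\<lambda>z. c) ?g = cnj c * (LINT z|circle_measure. ?g z)"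
      unfolding L2_inner_def by (rule integral_mult_right_zero)
    also have "\<dots> = cnj c * c * (h n 0 * exp (of_real (LINT z|circle_measure. k z)))"
      unfolding dil(2) f0 by simp
    also have "cnj c * c = 1" using c complex_norm_square[of c] by (simp add: mult.commute)
    also have "h n 0 = of_real (exp (- (LINT z|circle_measure. m n z)))"
      by (simp add: h_def herglotz_0 flip: exp_of_real)
    also have "1 * (of_real (exp (- (LINT z|circle_measure. m n z))) * exp (complex_of_real (LINT z|circle_measure. k z))) =
        of_real (exp (- (LINT z|circle_measure. m n z)) * exp (LINT z|circle_measure. k z))"
      by (simp only: exp_of_real of_real_mult mult_1_left)
    also have "exp (- (LINT z|circle_measure. m n z)) * exp (LINT z|circle_measure. k z) =
        exp (LINT z|circle_measure. k z - m n z)"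
      using k by (simp add: exp_add[symmetric])
    finally have inner: "L2_inner circle_measure (\<lambda>z. c) ?g = of_real (exp (LINT z|circle_measure. k z - m n z))" .
    have nc: "(L2_norm circle_measure (\<lambda>z. c))\<^sup>2 = 1"
      unfolding L2_norm_square by (simp add: c circle.prob_space[simplified])
    have "(L2_norm circle_measure (\<lambda>z. c - ?g z))\<^sup>2 =
        1 + (L2_norm circle_measure ?g)\<^sup>2 - 2 * exp (LINT z|circle_measure. k z - m n z)"
      using L2_norm_lin[OF cL gL, of 1 "-1"] unfolding inner nc by simp
    also have "\<dots> < e\<^sup>2" using n i by simp
    finally have "L2_norm circle_measure (\<lambda>z. c - ?g z) < e"
      using e by (intro power2_less_imp_less[of _ e]) auto
    then show "\<exists>g\<in>?S. L2_norm circle_measure (\<lambda>z. c - g z) < e"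
      using dil(1) by (intro bexI[of _ ?g])
  qed
  moreover have "c \<noteq> 0" using c by auto
  ultimately show ?thesis
    using L2_subspace_mult[OF S, of "\<lambda>z. c" "inverse c"] by simp
qed

lemma outer_cyclic:
  assumes f: "outer_function f"
  shows "L2_closed_span circle_measure (\<lambda>n z. zpow n z * f z) {0..} = hardy2"
proof
  have fH: "f \<in> hardy2" using f by (simp add: outer_function_def)
  then have fL: "f \<in> L2 circle_measure" by (simp add: hardy2_def)
  let ?S = "L2_closed_span circle_measure (\<lambda>n z. zpow n z * f z) {0..}"
  show "?S \<subseteq> hardy2"
    by (rule L2_closed_span_least[OF hardy2_subspace]) (auto intro: zpow_mult_hardy2 fH)
  show "hardy2 \<subseteq> ?S"
    unfolding hardy2_eq_span
  proof (rule L2_closed_span_least)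
    show "L2_subspace circle_measure ?S" by (rule L2_subspace_closed_span[OF zpow_mult_L2[OF fL]])
    show "zpow n \<in> ?S" if "n \<in> {0..}" for n
      using zpow_mult_closed_span[OF fL _ outer_constant_in_span[OF f], of n "{0..}"] that by simp
  qed
qed

lemma outer_bicyclic:
  assumes f: "outer_function f"
  shows "L2_closed_span circle_measure (\<lambda>n z. zpow n z * f z) UNIV = L2 circle_measure"
proof
  have fL: "f \<in> L2 circle_measure" using f by (simp add: outer_function_def hardy2_def)
  let ?S = "L2_closed_span circle_measure (\<lambda>n z. zpow n z * f z) UNIV"
  show "?S \<subseteq> L2 circle_measure" by (auto simp: L2_closed_span_def)
  show "L2 circle_measure \<subseteq> ?S"
    unfolding trig_span_eq_L2[symmetric] trig_span_def
  proof (rule L2_closed_span_least)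
    show "L2_subspace circle_measure ?S" by (rule L2_subspace_closed_span[OF zpow_mult_L2[OF fL]])
    show "zpow n \<in> ?S" for n
      using zpow_mult_closed_span[OF fL _ outer_constant_in_span[OF f], of n UNIV] by simp
  qed
qed

section \<open>Uniqueness of the intertwiners\<close>

lemma L2_inv:
  assumes "L2_unitary M H N K \<phi>" "k \<in> K"
  shows "L2_inv H N \<phi> k \<in> H" "AE y in N. \<phi> (L2_inv H N \<phi> k) y = k y"
proof -
  have "\<exists>f. f \<in> H \<and> (AE y in N. \<phi> f y = k y)" using L2_unitaryD(4)[OF assms] by blast
  from someI_ex[OF this] show "L2_inv H N \<phi> k \<in> H" "AE y in N. \<phi> (L2_inv H N \<phi> k) y = k y"
    unfolding L2_inv_def by auto
qed

lemma L2_unitary_inv: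
  assumes \<phi>: "L2_unitary M H N K \<phi>" and H: "L2_subspace M H" and K: "L2_subspace N K"
  shows "L2_unitary N K M H (L2_inv H N \<phi>)"
proof (rule L2_unitaryI[OF H])
  note inv = L2_inv[OF \<phi>]
  fix k assume k: "k \<in> K"
  show "L2_inv H N \<phi> k \<in> H" by (rule inv(1)[OF k])
  have "L2_norm N (\<phi> (L2_inv H N \<phi> k)) = L2_norm N k"
    using inv(2)[OF k]
    by (intro L2_norm_cong_AE L2_measurable L2_unitaryD(5)[OF \<phi>] inv(1) k L2_subspaceD(1)[OF K]) auto
  then show "L2_norm M (L2_inv H N \<phi> k) = L2_norm N k"
    by (simp add: L2_unitaryD(3)[OF \<phi> inv(1)[OF k]])
next
  note inv = L2_inv[OF \<phi>]
  fix k l a b assume k: "k \<in> K" and l: "l \<in> K"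
  have kl: "(\<lambda>y. a * k y + b * l y) \<in> K" by (rule L2_subspaceD(3)[OF K k l])
  have "AE y in N. \<phi> (L2_inv H N \<phi> (\<lambda>y. a * k y + b * l y)) y =
      \<phi> (\<lambda>x. a * L2_inv H N \<phi> k x + b * L2_inv H N \<phi> l x) y"
    using inv(2)[OF kl] inv(2)[OF k] inv(2)[OF l] L2_unitaryD(2)[OF \<phi> inv(1)[OF k] inv(1)[OF l], of a b]
    by eventually_elim simp
  then show "AE x in M. L2_inv H N \<phi> (\<lambda>y. a * k y + b * l y) x =
      a * L2_inv H N \<phi> k x + b * L2_inv H N \<phi> l x"
    using L2_unitary_AE_eq_iff[OF \<phi> H inv(1)[OF kl] L2_subspaceD(3)[OF H inv(1)[OF k] inv(1)[OF l]]] by blast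
next
  fix f assume f: "f \<in> H"
  have "AE x in M. L2_inv H N \<phi> (\<phi> f) x = f x"
    using L2_inv[OF \<phi> L2_unitaryD(1)[OF \<phi> f]] L2_unitary_AE_eq_iff[OF \<phi> H _ f] by blast
  then show "\<exists>k\<in>K. AE x in M. L2_inv H N \<phi> k x = f x"
    using L2_unitaryD(1)[OF \<phi> f] by blast
qed

text \<open>The choice made in \<open>L2_inv\<close> is immaterial: by isometry, preimages of the
  same element agree almost everywhere.\<close>

lemma L2_inv_left:
  assumes \<phi>: "L2_unitary M H N K \<phi>" and H: "L2_subspace M H" and f: "f \<in> H" and k: "k \<in> K"
    and "AE y in N. \<phi> f y = k y"
  shows "AE x in M. L2_inv H N \<phi> k x = f x"
proof -
  have "AE y in N. \<phi> (L2_inv H N \<phi> k) y = \<phi> f y"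
    using L2_inv(2)[OF \<phi> k] assms(5) by eventually_elim simp
  then show ?thesis using L2_unitary_AE_eq_iff[OF \<phi> H L2_inv(1)[OF \<phi> k] f] by blast
qed

lemma fourier_coeff_cong_AE:
  assumes "f \<in> L2 circle_measure" "g \<in> L2 circle_measure" "AE z in circle_measure. f z = g z"
  shows "fourier_coeff f n = fourier_coeff g n"
  unfolding fourier_coeff_eq_inner using assms by (intro L2_inner_cong_AE zpow_L2) auto

text \<open>
  A unitary operator on \<open>L\<^sup>2\<close> of the circle that commutes with multiplication by \<open>z\<close> is
  multiplication by \<open>g = T 1\<close>, and the last two hypotheses leave \<open>g\<close> only its constant term.
\<close>

lemma commuting_unitary_constant:
  assumes T: "L2_unitary circle_measure (L2 circle_measure) circle_measure (L2 circle_measure) T"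
    and comm: "\<And>k. k \<in> L2 circle_measure \<Longrightarrow> AE z in circle_measure. T (\<lambda>z. z * k z) z = z * T k z"
    and T0: "\<And>n. n < 0 \<Longrightarrow> fourier_coeff (T (zpow 0)) n = 0"
    and T1: "\<And>n. 0 \<le> n \<Longrightarrow> fourier_coeff (T (zpow (- 1))) n = 0"
  obtains c where "norm c = 1" "\<And>k. k \<in> L2 circle_measure \<Longrightarrow> AE z in circle_measure. T k z = c * k z"
proof -
  note L = L2_subspace_L2[of circle_measure]
  define g where "g = T (zpow 0)"
  have g: "g \<in> L2 circle_measure" unfolding g_def by (rule L2_unitaryD(1)[OF T zpow_L2])
  have step: "AE z in circle_measure. T (zpow (n + 1)) z = z * T (zpow n) z" for n
  proof -
    have "(\<lambda>z. z * zpow n z) \<in> L2 circle_measure"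
      using zpow_mult_L2[OF zpow_L2, of 1 n] by simp
    then have "AE z in circle_measure. T (zpow (n + 1)) z = T (\<lambda>z. z * zpow n z) z"
      by (subst L2_unitary_AE_eq_iff[OF T L zpow_L2]) (auto intro!: AE_circle simp: zpow_add mult.commute)
    with comm[OF zpow_L2[of n]] show ?thesis by eventually_elim simp
  qed
  have Tn: "AE z in circle_measure. T (zpow n) z = zpow n z * g z" for n
  proof (induction n rule: int_induct[where k = 0])
    case base
    show ?case unfolding g_def[symmetric] by simp
  next
    case (step1 n)
    from step[of n] step1(2) AE_space show ?case
      by eventually_elim (simp add: zpow_add)
  next
    \<comment> \<open>Downward the commutation relation is solved for the earlier power, dividing by
      \<open>z\<close>, which is nonzero on the circle.\<close>
    case (step2 n)
    from step[of "n - 1"] step2(2) AE_space show ?case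
    proof eventually_elim
      case (elim z)
      then have "norm z = 1" by simp
      then have "zpow n z = z * zpow (n - 1) z" "z \<noteq> 0" using zpow_add[of z 1 "n - 1"] by auto
      with elim show ?case by (simp add: mult.assoc)
    qed
  qed
  have "fourier_coeff g n = 0" if "n \<noteq> 0" for n
  proof (cases "n < 0")
    case True
    then show ?thesis using T0 by (simp add: g_def)
  next
    case False
    \<comment> \<open>\<open>T (zpow (- 1))\<close> is \<open>g\<close> divided by \<open>z\<close>,
      so its coefficient at \<open>n - 1\<close> is that of \<open>g\<close> at \<open>n\<close>;
      the hypothesis on it removes the positive frequencies of \<open>g\<close>.\<close>
    have "fourier_coeff (T (zpow (- 1))) (n - 1) = fourier_coeff (\<lambda>z. zpow (- 1) z * g z) (n - 1)"
      by (intro fourier_coeff_cong_AE Tn L2_unitaryD(1)[OF T] zpow_L2 zpow_mult_L2 g)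
    then show ?thesis using T1[of "n - 1"] False that by (simp add: fourier_coeff_zpow_mult)
  qed
  then have gc: "AE z in circle_measure. g z = fourier_coeff g 0"
    by (rule constant_if_fourier_coeff_eq_0[OF g])
  let ?c = "fourier_coeff g 0"
  have cL: "(\<lambda>z. ?c) \<in> L2 circle_measure"
    by (rule L2_circle_bounded[where B = "norm ?c"]) auto
  have "L2_norm circle_measure (\<lambda>z. ?c) = L2_norm circle_measure g"
    using gc by (intro L2_norm_cong_AE L2_measurable cL g) auto
  also have "\<dots> = L2_norm circle_measure (zpow 0)"
    unfolding g_def by (rule L2_unitaryD(3)[OF T zpow_L2])
  finally have c: "norm ?c = 1"
    by (simp add: L2_norm_def zpow_simps circle.prob_space[simplified])
  have I: "L2_unitary circle_measure (L2 circle_measure) circle_measure (L2 circle_measure) (\<lambda>k. k)"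
    by (rule L2_unitaryI[OF L]) auto
  have C: "L2_unitary circle_measure (L2 circle_measure) circle_measure (L2 circle_measure) (\<lambda>k z. ?c * k z)"
    by (rule L2_unitary_unimodular_mult[OF I]) (auto simp: c)
  have span: "L2_closed_span circle_measure zpow UNIV = L2 circle_measure"
    using trig_span_eq_L2 by (simp add: trig_span_def)
  have "AE z in circle_measure. T (zpow n) z = ?c * zpow n z" for n
    using Tn[of n] gc by eventually_elim simp
  then have "AE z in circle_measure. T k z = ?c * k z" if "k \<in> L2 circle_measure" for k
    using L2_unitary_eq_on_span[where M = circle_measure and X = zpow and I = UNIV, unfolded span, OF T C zpow_L2 _ that] by simp
  with c show ?thesis by (rule that)
qed

text \<open>The transition operator from \<open>\<phi>\<close> to \<open>\<phi>'\<close> fixes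
  \<open>K\<close>, and, since inner products can be computed back in \<open>H\<close>, also its
  orthogonal complement. Both facts are needed to pin it down.\<close>

lemma unitary_transfer_image:
  assumes \<phi>: "L2_unitary M H N (L2 N) \<phi>" and \<phi>': "L2_unitary M H N (L2 N) \<phi>'"
    and H: "L2_subspace M H" and D: "D \<subseteq> H"
    and im: "L2_image N \<phi> D = K" "L2_image N \<phi>' D = K"
  shows "k \<in> K \<Longrightarrow> \<phi>' (L2_inv H N \<phi> k) \<in> K"
    "k \<in> L2 N \<Longrightarrow> (\<And>l. l \<in> K \<Longrightarrow> L2_inner N l k = 0) \<Longrightarrow> l \<in> K \<Longrightarrow>
      L2_inner N l (\<phi>' (L2_inv H N \<phi> k)) = 0"
proof -
  assume k: "k \<in> K"
  then obtain d where d: "k \<in> L2 N" "d \<in> D" "AE y in N. \<phi> d y = k y"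
    unfolding im(1)[symmetric] L2_image_def by auto
  then have dH: "d \<in> H" using D by auto
  have "AE x in M. L2_inv H N \<phi> k x = d x" by (rule L2_inv_left[OF \<phi> H dH d(1,3)])
  then have "AE x in M. d x = L2_inv H N \<phi> k x" by eventually_elim simp
  then have "AE y in N. \<phi>' d y = \<phi>' (L2_inv H N \<phi> k) y"
    using L2_unitary_AE_eq_iff[OF \<phi>' H dH L2_inv(1)[OF \<phi> d(1)]] by blast
  then show "\<phi>' (L2_inv H N \<phi> k) \<in> K"
    unfolding im(2)[symmetric] L2_image_def
    using d(2) L2_unitaryD(1)[OF \<phi>' L2_inv(1)[OF \<phi> d(1)]] by auto
next
  assume k: "k \<in> L2 N" and orth: "\<And>l. l \<in> K \<Longrightarrow> L2_inner N l k = 0" and l: "l \<in> K"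
  let ?f = "L2_inv H N \<phi> k"
  note f = L2_inv[OF \<phi> k]
  obtain d where d: "l \<in> L2 N" "d \<in> D" "AE y in N. \<phi>' d y = l y"
    using l unfolding im(2)[symmetric] L2_image_def by auto
  then have dH: "d \<in> H" using D by auto
  have "L2_inner N l (\<phi>' ?f) = L2_inner N (\<phi>' d) (\<phi>' ?f)"
    using d(3) by (intro L2_inner_cong_AE d(1) L2_unitaryD(1)[OF \<phi>'] f(1) dH) auto
  also have "\<dots> = L2_inner M d ?f" by (rule L2_unitary_inner[OF \<phi>' H dH f(1)])
  also have "\<dots> = L2_inner N (\<phi> d) (\<phi> ?f)" by (rule L2_unitary_inner[OF \<phi> H dH f(1), symmetric])
  also have "\<dots> = L2_inner N (\<phi> d) k"
    using f(2) by (intro L2_inner_cong_AE L2_unitaryD(1)[OF \<phi>] f(1) dH k) auto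
  also have "\<dots> = 0"
    using L2_unitaryD(1)[OF \<phi> dH] d(2) by (intro orth) (auto simp: im(1)[symmetric] L2_image_def)
  finally show "L2_inner N l (\<phi>' ?f) = 0" .
qed

text \<open>\<open>D\<close> and \<open>K\<close> are left general so that one argument serves the
  incoming and the outgoing side. The transition operator commutes with \<open>z\<close>, and
  \<open>commuting_unitary_constant\<close> makes it a constant.\<close>

lemma intertwiner_unique:
  assumes X: "\<And>n. X n \<in> L2 M" and U: "shift_operator M X U"
    and \<phi>: "intertwiner M X U \<phi>" and \<phi>': "intertwiner M X U \<phi>'"
    and D: "D \<subseteq> process_space M X"
    and im: "L2_image circle_measure \<phi> D = K" "L2_image circle_measure \<phi>' D = K"
    and K: "K = hardy2 \<or> K = L2_orth_in circle_measure (L2 circle_measure) hardy2"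
  obtains c where "norm c = 1" "\<And>f. f \<in> process_space M X \<Longrightarrow> AE z in circle_measure. \<phi>' f z = c * \<phi> f z"
proof -
  let ?H = "process_space M X"
  have H: "L2_subspace M ?H" by (rule L2_subspace_closed_span[OF X])
  note L = L2_subspace_L2[of circle_measure]
  have u: "L2_unitary M ?H circle_measure (L2 circle_measure) \<phi>"
    and u': "L2_unitary M ?H circle_measure (L2 circle_measure) \<phi>'"
    using \<phi> \<phi>' by (auto simp: intertwiner_def)
  have uU: "L2_unitary M ?H M ?H U" using U by (simp add: shift_operator_def)
  let ?T = "\<lambda>k. \<phi>' (L2_inv ?H circle_measure \<phi> k)"
  have T: "L2_unitary circle_measure (L2 circle_measure) circle_measure (L2 circle_measure) ?T"
    by (rule L2_unitary_compose[OF L2_unitary_inv[OF u H L] u' L H L])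
  have comm: "AE z in circle_measure. ?T (\<lambda>z. z * k z) z = z * ?T k z" if k: "k \<in> L2 circle_measure" for k
  proof -
    let ?f = "L2_inv ?H circle_measure \<phi> k"
    note f = L2_inv[OF u k]
    have zk: "(\<lambda>z. z * k z) \<in> L2 circle_measure" using zpow_mult_L2[OF k, of 1] by simp
    have Uf: "U ?f \<in> ?H" by (rule L2_unitaryD(1)[OF uU f(1)])
    have "AE z in circle_measure. \<phi> (U ?f) z = z * \<phi> ?f z" using \<phi> f(1) by (simp add: intertwiner_def)
    with f(2) have "AE z in circle_measure. \<phi> (U ?f) z = z * k z" by eventually_elim simp
    then have "AE x in M. L2_inv ?H circle_measure \<phi> (\<lambda>z. z * k z) x = U ?f x"
      by (rule L2_inv_left[OF u H Uf zk])
    then have 1: "AE z in circle_measure. ?T (\<lambda>z. z * k z) z = \<phi>' (U ?f) z"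
      using L2_unitary_AE_eq_iff[OF u' H L2_inv(1)[OF u zk] Uf] by blast
    have "AE z in circle_measure. \<phi>' (U ?f) z = z * \<phi>' ?f z" using \<phi>' f(1) by (simp add: intertwiner_def)
    with 1 show ?thesis by eventually_elim simp
  qed
  note tr = unitary_transfer_image[OF u u' H D im]
  note orth = hardy2_orth
  have cnj0: "L2_inner circle_measure l (zpow n) = cnj (fourier_coeff l n)" for l n
    unfolding fourier_coeff_eq_inner by (rule L2_inner_cnj)
  have neg: "zpow n \<in> L2_orth_in circle_measure (L2 circle_measure) hardy2" if "n < 0" for n
    using that unfolding orth by (auto simp: zpow_L2 fourier_coeff_eq_inner inner_zpow)
  \<comment> \<open>In each case one condition is invariance of \<open>K\<close> and the other is
    invariance of its orthogonal complement; the two cases exchange these roles.\<close>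
  have T01: "(\<forall>n<0. fourier_coeff (?T (zpow 0)) n = 0) \<and> (\<forall>n\<ge>0. fourier_coeff (?T (zpow (- 1))) n = 0)"
    using K
  proof
    assume K: "K = hardy2"
    have "?T (zpow 0) \<in> hardy2" using tr(1)[of "zpow 0"] zpow_hardy2[of 0] unfolding K by blast
    moreover have "L2_inner circle_measure (zpow n) (?T (zpow (- 1))) = 0" if "n \<ge> 0" for n
      by (rule tr(2)[OF zpow_L2]) (use that in \<open>auto simp: K cnj0 zpow_hardy2, auto simp: hardy2_def\<close>)
    ultimately show ?thesis by (auto simp: hardy2_def fourier_coeff_eq_inner)
  next
    assume K: "K = L2_orth_in circle_measure (L2 circle_measure) hardy2"
    have "?T (zpow (- 1)) \<in> K" by (rule tr(1)) (simp add: K neg)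
    moreover have "L2_inner circle_measure (zpow n) (?T (zpow 0)) = 0" if "n < 0" for n
      by (rule tr(2)[OF zpow_L2]) (use that neg in \<open>auto simp: K cnj0, auto simp: orth\<close>)
    ultimately show ?thesis unfolding K orth by (auto simp: fourier_coeff_eq_inner)
  qed
  obtain c where c: "norm c = 1" "\<And>k. k \<in> L2 circle_measure \<Longrightarrow> AE z in circle_measure. ?T k z = c * k z"
    by (rule commuting_unitary_constant[OF T comm]) (use T01 in blast)+
  have "AE z in circle_measure. \<phi>' f z = c * \<phi> f z" if f: "f \<in> ?H" for f
  proof -
    note k = L2_unitaryD(1)[OF u f]
    have "AE x in M. L2_inv ?H circle_measure \<phi> (\<phi> f) x = f x"
      by (rule L2_inv_left[OF u H f k]) simp
    then have "AE z in circle_measure. ?T (\<phi> f) z = \<phi>' f z"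
      using L2_unitary_AE_eq_iff[OF u' H L2_inv(1)[OF u k] f] by blast
    with c(2)[OF k] show ?thesis by eventually_elim simp
  qed
  with c(1) show ?thesis by (rule that)
qed

lemma shift_operator_unique:
  assumes X: "\<And>n. X n \<in> L2 M" and U: "shift_operator M X U" and U': "shift_operator M X U'"
    and f: "f \<in> process_space M X"
  shows "AE x in M. U f x = U' f x"
proof (rule L2_unitary_eq_on_span[OF _ _ X _ f])
  show "L2_unitary M (process_space M X) M (process_space M X) U"
    "L2_unitary M (process_space M X) M (process_space M X) U'"
    using U U' by (auto simp: shift_operator_def)
  fix n
  have "AE x in M. U (X n) x = X (n + 1) x" "AE x in M. U' (X n) x = X (n + 1) x"
    using U U' by (auto simp: shift_operator_def)
  then show "AE x in M. U (X n) x = U' (X n) x" by eventually_elim simp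
qed

text \<open>A scattering function brings its own shift operator. Since shift operators agree almost
  everywhere on the span, its intertwiners can be moved to a fixed one and then compared.\<close>

lemma intertwiner_shift_cong:
  assumes X: "\<And>n. X n \<in> L2 M" and U: "shift_operator M X U" and U': "shift_operator M X U'"
    and \<phi>: "intertwiner M X U \<phi>"
  shows "intertwiner M X U' \<phi>"
  unfolding intertwiner_def
proof (intro conjI ballI)
  let ?H = "process_space M X"
  have H: "L2_subspace M ?H" by (rule L2_subspace_closed_span[OF X])
  show u: "L2_unitary M ?H circle_measure (L2 circle_measure) \<phi>" using \<phi> by (simp add: intertwiner_def)
  fix f assume f: "f \<in> ?H"
  have "U f \<in> ?H" "U' f \<in> ?H"
    using U U' f by (auto simp: shift_operator_def intro: L2_unitaryD(1))
  then have 1: "AE z in circle_measure. \<phi> (U' f) z = \<phi> (U f) z"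
    using L2_unitary_AE_eq_iff[OF u H] shift_operator_unique[OF X U' U f] by blast
  have "AE z in circle_measure. \<phi> (U f) z = z * \<phi> f z" using \<phi> f by (simp add: intertwiner_def)
  with 1 show "AE z in circle_measure. \<phi> (U' f) z = z * \<phi> f z" by eventually_elim simp
qed

section \<open>The dual scattering function\<close>

text \<open>Stationarity says that the family and its translate have the same Gram matrix, so the
  isometric extension exists; it is onto because translating all of the integers leaves the span
  unchanged.\<close>

lemma shift_operator_exists:
  assumes ws: "weakly_stationary M X"
  obtains U where "shift_operator M X U"
proof -
  have X: "\<And>n. X n \<in> L2 M" and M: "finite_measure M"
    using ws by (auto simp: weakly_stationary_def prob_space_def)
  have "L2_inner M (X n) (X m) = L2_inner M (X (n + 1)) (X (m + 1))" for n m
    using ws by (simp add: weakly_stationary_def L2_inner_def)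
  from L2_unitary_extension[of X M "\<lambda>n. X (n + 1)" M, OF X X M M this]
  obtain U where U: "L2_unitary M (process_space M X) M (L2_closed_span M (\<lambda>n. X (n + 1)) UNIV) U"
      "\<And>n. AE x in M. U (X n) x = X (n + 1) x" by blast
  have "L2_closed_span M (\<lambda>n. X (n + 1)) UNIV = process_space M X"
  proof
    show "L2_closed_span M (\<lambda>n. X (n + 1)) UNIV \<subseteq> process_space M X"
      by (rule L2_closed_span_least[OF L2_subspace_closed_span[OF X]]) (auto intro: L2_closed_span_superset X)
    show "process_space M X \<subseteq> L2_closed_span M (\<lambda>n. X (n + 1)) UNIV"
    proof (rule L2_closed_span_least[OF L2_subspace_closed_span[OF X]])
      show "X n \<in> L2_closed_span M (\<lambda>n. X (n + 1)) UNIV" for n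
        using L2_closed_span_superset[of "n - 1" UNIV "\<lambda>n. X (n + 1)" M] X by simp
    qed
  qed
  with U have "shift_operator M X U" by (simp add: shift_operator_def)
  then show ?thesis by (rule that)
qed

text \<open>Both \<open>\<phi>\<close> after \<open>U\<close> and \<open>z\<close> times
  \<open>\<phi>\<close> are unitary maps on the closed span, so comparing them on the generators is
  enough.\<close>

lemma intertwinerI:
  assumes X: "\<And>n. X n \<in> L2 M" and U: "shift_operator M X U"
    and \<phi>: "L2_unitary M (process_space M X) circle_measure (L2 circle_measure) \<phi>"
    and \<phi>X: "\<And>n. AE z in circle_measure. \<phi> (X n) z = zpow n z * p z"
  shows "intertwiner M X U \<phi>"
  unfolding intertwiner_def
proof (intro conjI ballI \<phi>)
  let ?H = "process_space M X"
  have H: "L2_subspace M ?H" by (rule L2_subspace_closed_span[OF X])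
  have uU: "L2_unitary M ?H M ?H U" using U by (simp add: shift_operator_def)
  fix f assume f: "f \<in> ?H"
  show "AE z in circle_measure. \<phi> (U f) z = z * \<phi> f z"
  proof (rule L2_unitary_eq_on_span[OF L2_unitary_compose[OF uU \<phi> H H L2_subspace_L2]
        L2_unitary_unimodular_mult[OF \<phi>] X _ f])
    fix n
    have XH: "X n \<in> ?H" for n by (rule L2_closed_span_superset[OF _ X]) simp
    have "AE x in M. U (X n) x = X (n + 1) x" using U by (simp add: shift_operator_def)
    then have "AE z in circle_measure. \<phi> (U (X n)) z = \<phi> (X (n + 1)) z"
      using L2_unitary_AE_eq_iff[OF \<phi> H L2_unitaryD(1)[OF uU XH] XH] by blast
    with \<phi>X[of n] \<phi>X[of "n + 1"] AE_space show "AE z in circle_measure. \<phi> (U (X n)) z = z * \<phi> (X n) z"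
      by eventually_elim (simp add: zpow_add)
  qed (auto intro: AE_circle)
qed

lemma fourier_coeff_cnj: "fourier_coeff (\<lambda>z. cnj (f z)) n = cnj (fourier_coeff f (- n))"
proof -
  have "fourier_coeff (\<lambda>z. cnj (f z)) n = (LINT z|circle_measure. cnj (zpow n z * f z))"
    unfolding fourier_coeff_eq_integral by (rule Bochner_Integration.integral_cong) (auto simp: cnj_zpow)
  also have "\<dots> = cnj (LINT z|circle_measure. zpow n z * f z)"
    by (rule Bochner_Integration.integral_cnj)
  finally show ?thesis by (simp add: fourier_coeff_eq_integral)
qed

text \<open>
  Complex conjugation turns the past of \<open>cnj p\<close> into \<open>z\<close> times the future of \<open>p\<close>.
\<close>

lemma orth_past_cnj_outer:
  assumes p: "outer_function p"
  shows "L2_orth_in circle_measure (L2 circle_measure)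
    (L2_closed_span circle_measure (\<lambda>n z. zpow n z * cnj (p z)) {..<0}) = hardy2"
proof -
  have pL: "p \<in> L2 circle_measure" using p by (simp add: outer_function_def hardy2_def)
  have cL: "(\<lambda>z. cnj (f z)) \<in> L2 circle_measure" if "f \<in> L2 circle_measure" for f
    using that by (auto simp: L2_def)
  have "(\<forall>n\<in>{..<0}. L2_inner circle_measure (\<lambda>z. zpow n z * cnj (p z)) f = 0) \<longleftrightarrow>
      (\<forall>n<0. fourier_coeff f n = 0)" if f: "f \<in> L2 circle_measure" for f
  proof -
    \<comment> \<open>Conjugation reflects frequencies and the factor \<open>zpow (- 1)\<close>
      shifts them by one. Together they send \<open>n\<close> to \<open>- 1 - n\<close>, which
      exchanges the negative and the nonnegative integers exactly.\<close>
    let ?g = "\<lambda>z. zpow (- 1) z * cnj (f z)"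
    have gL: "?g \<in> L2 circle_measure" by (rule zpow_mult_L2[OF cL[OF f]])
    have inner: "L2_inner circle_measure (\<lambda>z. zpow n z * cnj (p z)) f =
        cnj (L2_inner circle_measure (\<lambda>z. zpow (- 1 - n) z * p z) ?g)" for n
      unfolding L2_inner_cnj[of _ ?g, symmetric] unfolding L2_inner_def
    proof (rule Bochner_Integration.integral_cong)
      fix z assume "z \<in> space circle_measure"
      then have z: "norm z = 1" by simp
      have "zpow (- n) z = zpow 1 z * zpow (- 1 - n) z" using zpow_add[OF z, of 1 "- 1 - n"] by simp
      then show "cnj (zpow n z * cnj (p z)) * f z = cnj (?g z) * (zpow (- 1 - n) z * p z)"
        using cnj_zpow[OF z, of "- 1"] cnj_zpow[OF z, of n] by (simp add: mult_ac)
    qed simp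
    have "(\<forall>n\<in>{..<0}. L2_inner circle_measure (\<lambda>z. zpow n z * cnj (p z)) f = 0) \<longleftrightarrow>
        (\<forall>m\<in>{0..}. L2_inner circle_measure (\<lambda>z. zpow m z * p z) ?g = 0)"
    proof
      assume *: "\<forall>n\<in>{..<0}. L2_inner circle_measure (\<lambda>z. zpow n z * cnj (p z)) f = 0"
      show "\<forall>m\<in>{0..}. L2_inner circle_measure (\<lambda>z. zpow m z * p z) ?g = 0"
      proof
        fix m :: int assume "m \<in> {0..}"
        then show "L2_inner circle_measure (\<lambda>z. zpow m z * p z) ?g = 0"
          using *[rule_format, of "- 1 - m"] inner[of "- 1 - m"] by simp
      qed
    qed (simp add: inner)
    also have "\<dots> \<longleftrightarrow> ?g \<in> L2_orth_in circle_measure (L2 circle_measure) hardy2"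
      unfolding outer_cyclic[OF p, symmetric] L2_orth_closed_span[OF order_refl zpow_mult_L2[OF pL]]
      using gL by simp
    also have "\<dots> \<longleftrightarrow> (\<forall>n\<ge>0. fourier_coeff f (- (n + 1)) = 0)"
      unfolding hardy2_orth using gL by (simp add: fourier_coeff_zpow_mult fourier_coeff_cnj)
    also have "\<dots> \<longleftrightarrow> (\<forall>n<0. fourier_coeff f n = 0)"
    proof (intro iffI allI impI)
      fix n :: int assume *: "\<forall>n\<ge>0. fourier_coeff f (- (n + 1)) = 0" and "n < 0"
      then show "fourier_coeff f n = 0" using *[rule_format, of "- n - 1"] by simp
    qed simp
    finally show ?thesis .
  qed
  then show ?thesis
    unfolding L2_orth_closed_span[OF order_refl zpow_mult_L2[OF cL[OF pL]]] hardy2_def by auto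
qed

lemma cnj_div_unimodular: "z \<noteq> 0 \<Longrightarrow> norm (cnj z / z) = 1"
  by (simp add: norm_divide)

text \<open>The spectral density enters only through a modulus, which is why \<open>\<psi>\<close>
  may be replaced by any \<open>p\<close> of the same modulus, in particular by its outer
  factor.\<close>

lemma spectral_gram:
  assumes ws: "weakly_stationary M X"
    and \<psi>: "\<psi> \<in> L2 circle_measure" and p: "p \<in> L2 circle_measure"
    and sp: "is_spectral_measure M X (density circle_measure (\<lambda>z. ennreal ((norm (\<psi> z))\<^sup>2)))"
    and eq: "AE z in circle_measure. norm (\<psi> z) = norm (p z)"
  shows "L2_inner M (X n) (X m) = L2_inner circle_measure (\<lambda>z. zpow n z * p z) (\<lambda>z. zpow m z * p z)"
proof -
  note [measurable] = L2_measurable[OF \<psi>] L2_measurable[OF p]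
  have "L2_inner M (X n) (X m) = autocov M X (n - m)"
    using ws by (simp add: weakly_stationary_def L2_inner_def)
  also have "\<dots> = (LINT z|density circle_measure (\<lambda>z. ennreal ((norm (\<psi> z))\<^sup>2)). zpow (m - n) z)"
    using sp by (simp add: is_spectral_measure_def zpow_def)
  also have "\<dots> = (LINT z|circle_measure. (norm (\<psi> z))\<^sup>2 *\<^sub>R zpow (m - n) z)"
    by (rule integral_density) auto
  also have "\<dots> = (LINT z|circle_measure. cnj (zpow n z * p z) * (zpow m z * p z))"
  proof (rule integral_cong_AE)
    show "AE z in circle_measure. (norm (\<psi> z))\<^sup>2 *\<^sub>R zpow (m - n) z = cnj (zpow n z * p z) * (zpow m z * p z)"
      using eq AE_space
    proof eventually_elim
      case (elim z)
      then have z: "norm z = 1" by simp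
      have "zpow (m - n) z = zpow (- n) z * zpow m z" using zpow_add[OF z, of "- n" m] by simp
      then show ?case
        using elim(1) cnj_zpow[OF z, of n] complex_norm_square[of "p z"]
        by (simp add: scaleR_conv_of_real mult_ac)
    qed
  qed measurable
  finally show ?thesis by (simp add: L2_inner_def)
qed

theorem theorem1p3:
  fixes M :: "'a measure" and X :: "int \<Rightarrow> 'a \<Rightarrow> complex"
    and \<psi> \<psi>inn \<psi>out :: "complex \<Rightarrow> complex"
  assumes "weakly_stationary M X"
    and "purely_innovating M X"
    and "\<psi> \<in> hardy2"
    and "is_spectral_measure M X (density circle_measure (\<lambda>z. ennreal ((norm (\<psi> z))\<^sup>2)))"
    and "inner_outer_factorization \<psi> \<psi>inn \<psi>out"
  shows "is_dual_scattering_function M X (\<lambda>z. cnj (\<psi>out z) / \<psi>out z) \<and>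
    (\<forall>s. is_dual_scattering_function M X s \<longrightarrow>
       (\<exists>c. norm c = 1 \<and> (AE z in circle_measure. s z = c * (cnj (\<psi>out z) / \<psi>out z))))"
proof -
  let ?H = "process_space M X" and ?s = "\<lambda>z. cnj (\<psi>out z) / \<psi>out z"
  have X: "\<And>n. X n \<in> L2 M" and M: "finite_measure M"
    using assms(1) by (auto simp: weakly_stationary_def prob_space_def)
  have H: "L2_subspace M ?H" by (rule L2_subspace_closed_span[OF X])
  have XH: "X n \<in> ?H" for n by (rule L2_closed_span_superset[OF _ X]) simp
  have out: "outer_function \<psi>out" and inn: "inner_function \<psi>inn"
    and fact: "AE z in circle_measure. \<psi> z = \<psi>inn z * \<psi>out z"
    using assms(5) by (auto simp: inner_outer_factorization_def)
  have pL: "\<psi>out \<in> L2 circle_measure" using out by (simp add: outer_function_def hardy2_def)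
  note [measurable] = L2_measurable[OF pL]
  have "AE z in circle_measure. norm (\<psi>inn z) = 1" using inn by (simp add: inner_function_def)
  with fact have "AE z in circle_measure. norm (\<psi> z) = norm (\<psi>out z)"
    by eventually_elim (simp add: norm_mult)
  from spectral_gram[OF assms(1) _ pL assms(4) this] assms(3)
  have gram: "L2_inner M (X n) (X m) =
      L2_inner circle_measure (\<lambda>z. zpow n z * \<psi>out z) (\<lambda>z. zpow m z * \<psi>out z)" for n m
    by (simp add: hardy2_def)
  have s1: "AE z in circle_measure. norm (?s z) = 1"
    using outer_function_nonzero[OF out] by eventually_elim (rule cnj_div_unimodular)
  obtain U where U: "shift_operator M X U" by (rule shift_operator_exists[OF assms(1)])
  from L2_unitary_extension[of X M "\<lambda>n z. zpow n z * \<psi>out z" circle_measure,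
      OF X zpow_mult_L2[OF pL] M circle.finite_measure_axioms gram]
  obtain \<phi>m where um: "L2_unitary M ?H circle_measure (L2 circle_measure) \<phi>m"
      and mX: "\<And>n. AE z in circle_measure. \<phi>m (X n) z = zpow n z * \<psi>out z"
    unfolding outer_bicyclic[OF out] by blast
  \<comment> \<open>Defined from \<open>\<phi>m\<close> by multiplication with the claimed function,
    so that the scattering operator is read off at once; what needs proof is that
    \<open>\<phi>p\<close> is outgoing.\<close>
  define \<phi>p where "\<phi>p f z = ?s z * \<phi>m f z" for f z
  have up: "L2_unitary M ?H circle_measure (L2 circle_measure) \<phi>p"
    unfolding \<phi>p_def[abs_def] by (rule L2_unitary_unimodular_mult[OF um _ s1]) measurable
  have pX: "AE z in circle_measure. \<phi>p (X n) z = zpow n z * cnj (\<psi>out z)" for n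
    using mX[of n] outer_function_nonzero[OF out] by eventually_elim (simp add: \<phi>p_def)
  have cL: "(\<lambda>z. cnj (\<psi>out z)) \<in> L2 circle_measure"
    using pL by (auto simp: L2_def)
  have im: "incoming_intertwiner M X U \<phi>m"
    unfolding incoming_intertwiner_def dual_incoming_def
    using L2_image_orth_closed_span[where X = X and I = "{0..}", OF um H XH zpow_mult_L2[OF pL] mX]
      intertwinerI[OF X U um mX] by (simp add: outer_cyclic[OF out])
  have ip: "outgoing_intertwiner M X U \<phi>p"
    unfolding outgoing_intertwiner_def dual_outgoing_def
    using L2_image_orth_closed_span[where X = X and I = "{..<0}", OF up H XH zpow_mult_L2[OF cL] pX]
      intertwinerI[OF X U up pX] by (simp add: orth_past_cnj_outer[OF out])
  have "AE z in circle_measure. scattering_operator M X \<phi>m \<phi>p k z = ?s z * k z" if "k \<in> L2 circle_measure" for k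
    using L2_inv(2)[OF um that] by eventually_elim (simp add: scattering_operator_def \<phi>p_def)
  moreover have "?s \<in> borel_measurable circle_measure" by measurable
  ultimately have 1: "is_dual_scattering_function M X ?s"
    unfolding is_dual_scattering_function_def using s1 U im ip by blast
  have "\<exists>c. norm c = 1 \<and> (AE z in circle_measure. s z = c * ?s z)"
    if sc: "is_dual_scattering_function M X s" for s
  proof -
    obtain U' \<phi>m' \<phi>p' where U': "shift_operator M X U'"
      and im': "incoming_intertwiner M X U' \<phi>m'" and ip': "outgoing_intertwiner M X U' \<phi>p'"
      and s: "\<And>k. k \<in> L2 circle_measure \<Longrightarrow> AE z in circle_measure. scattering_operator M X \<phi>m' \<phi>p' k z = s z * k z"
      using sc unfolding is_dual_scattering_function_def by blast
    have DH: "dual_incoming M X \<subseteq> ?H" "dual_outgoing M X \<subseteq> ?H"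
      by (auto simp: dual_incoming_def dual_outgoing_def L2_orth_in_def)
    have um': "L2_unitary M ?H circle_measure (L2 circle_measure) \<phi>m'"
      using im' by (simp add: incoming_intertwiner_def intertwiner_def)
    have "intertwiner M X U \<phi>m'" "intertwiner M X U \<phi>p'"
      using im' ip' by (auto intro: intertwiner_shift_cong[OF X U' U]
        simp: incoming_intertwiner_def outgoing_intertwiner_def)
    then obtain c d where c: "norm c = 1" "\<And>f. f \<in> ?H \<Longrightarrow> AE z in circle_measure. \<phi>m' f z = c * \<phi>m f z"
      and d: "norm d = 1" "\<And>f. f \<in> ?H \<Longrightarrow> AE z in circle_measure. \<phi>p' f z = d * \<phi>p f z"
      using intertwiner_unique[OF X U, of \<phi>m \<phi>m' "dual_incoming M X"]
        intertwiner_unique[OF X U, of \<phi>p \<phi>p' "dual_outgoing M X"] im im' ip ip' DH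
      unfolding incoming_intertwiner_def outgoing_intertwiner_def by metis
    \<comment> \<open>Applying the scattering operator to the constant 1 recovers \<open>s\<close>.
      On this preimage \<open>\<phi>m\<close> takes the value \<open>1 / c\<close>, whence the
      factor \<open>d / c\<close>.\<close>
    let ?f = "L2_inv ?H circle_measure \<phi>m' (zpow 0)"
    note f = L2_inv[OF um' zpow_L2[of 0]]
    have "AE z in circle_measure. s z = (d / c) * ?s z"
      using s[OF zpow_L2[of 0]] f(2) c(2)[OF f(1)] d(2)[OF f(1)]
    proof eventually_elim
      case (elim z)
      have "c \<noteq> 0" using c(1) by auto
      then have "\<phi>m ?f z = 1 / c" using elim(2,3) by (simp add: field_simps)
      with elim show ?case by (simp add: scattering_operator_def \<phi>p_def field_simps)
    qed
    moreover have "norm (d / c) = 1" using c(1) d(1) by (simp add: norm_divide)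
    ultimately show ?thesis by blast
  qed
  with 1 show ?thesis by blast
qed

end
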